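(* Let $p$ be an odd prime and $R$ a $p$-torsion-free commutative $\mathbb{Z}_{(p)}$-algebra. Then $\mathrm{HC}_i(R/\!/p)=0$ for $i$ odd and $\mathrm{HC}_0(R/\!/p)\cong R/p$. There furthermore exists an infinite set $Z$ of positive even integers such that for any $i\in Z$ the $R$-module $\mathrm{HC}_i(R/\!/p)$ is isomorphic to $$R/p^{a_{i-1}+2}\oplus R/1\oplus R/3\oplus\cdots\oplus R/(i-1)$$ (the summands after the first being $R/n$ for all odd $n$ with $1\le n\le i-1$). The set $Z$ contains all even numbers of the form $\frac{p^a\pm 1}{2}+1$ for $a>0$ an integer.
   Context: $R/\!/p$ denotes the differential graded $R$-algebra whose underlying graded algebra is $R[x]$ with $x$ in degree $1$ (the tensor algebra on $x$; it is not graded commutative), with differential $\delta$ of degree $-1$ determined by $\delta x=p$ and the graded Leibniz rule, so $\delta x^n=p\,x^{n-1}$ for $n$ odd and $\delta x^n=0$ for $n$ even. $\mathrm{HC}_i(R/\!/p)$ denotes the cyclic homology of $R/\!/p$ over $R$ (all tensor products over $R$, usual Koszul signs for dg algebras). "$p$-torsion-free" means multiplication by $p$ is injective on $R$. $R/n$ means $R/nR$. Define $A_1:=p$ and, for each odd integer $j\ge 3$, recursively $A_j:=\frac{p^2A_{j-2}}{j}\in\mathbb{Q}$. These lie in $\mathbb{Z}_{(p)}$, and $a_j:=\nu_p(A_j)\geq 0$, where $\nu_p$ is the $p$-adic valuation. *)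

theory Defs
  imports
    Complex_Main
    "HOL-Computational_Algebra.Computational_Algebra"
    "HOL-Library.Poly_Mapping"
    "HOL-Library.Set_Algebras"
    "HOL-Library.FuncSet"
begin

section \<open>Modules over a commutative ring, with explicit carriers\<close>

record ('r, 'm) rmodule =
  mcarrier :: "'m set"
  mplus :: "'m \<Rightarrow> 'm \<Rightarrow> 'm"
  mscale :: "'r \<Rightarrow> 'm \<Rightarrow> 'm"

definition module_iso :: "('r, 'm) rmodule \<Rightarrow> ('r, 'n) rmodule \<Rightarrow> ('m \<Rightarrow> 'n) \<Rightarrow> bool" where
  "module_iso M N f \<longleftrightarrow>
     bij_betw f (mcarrier M) (mcarrier N) \<and>
     (\<forall>x\<in>mcarrier M. \<forall>y\<in>mcarrier M. f (mplus M x y) = mplus N (f x) (f y)) \<and>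
     (\<forall>r. \<forall>x\<in>mcarrier M. f (mscale M r x) = mscale N r (f x))"

definition isomorphic :: "('r, 'm) rmodule \<Rightarrow> ('r, 'n) rmodule \<Rightarrow> bool"  (infix \<open>\<cong>\<^sub>R\<close> 50) where
  "M \<cong>\<^sub>R N \<longleftrightarrow> (\<exists>f. module_iso M N f)"

definition is_zero_module :: "('r, 'm) rmodule \<Rightarrow> bool" where
  "is_zero_module M \<longleftrightarrow> (\<exists>z. mcarrier M = {z})"

text \<open>The quotient \<open>M / N\<close> of a submodule \<open>M\<close> of an ambient module with scalar multiplication
  \<open>scale\<close> by a submodule \<open>N\<close> of \<open>M\<close>; its elements are the cosets \<open>x +o N\<close>, and the sum of
  two cosets is their elementwise sum.  In the scalar multiplication, \<open>N\<close> is added because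
  \<open>r (x + N)\<close> is in general smaller than the coset \<open>r x + N\<close>.\<close>

definition quotient_module ::
  "('r \<Rightarrow> 'v \<Rightarrow> 'v) \<Rightarrow> 'v set \<Rightarrow> 'v set \<Rightarrow> ('r, 'v::ab_group_add set) rmodule" where
  "quotient_module scale M N =
     \<lparr>mcarrier = (\<lambda>x. x +o N) ` M,
      mplus = (\<lambda>X Y. X + Y),
      mscale = (\<lambda>r X. scale r ` X + N)\<rparr>"

definition cyclic_module :: "'r::comm_ring_1 \<Rightarrow> ('r, 'r set) rmodule" where
  "cyclic_module c = quotient_module (*) UNIV (range ((*) c))"

definition binary_sum :: "('r, 'm) rmodule \<Rightarrow> ('r, 'n) rmodule \<Rightarrow> ('r, 'm \<times> 'n) rmodule"
    (infixr \<open>\<oplus>\<^sub>R\<close> 65) where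
  "M \<oplus>\<^sub>R N =
     \<lparr>mcarrier = mcarrier M \<times> mcarrier N,
      mplus = (\<lambda>x y. (mplus M (fst x) (fst y), mplus N (snd x) (snd y))),
      mscale = (\<lambda>r x. (mscale M r (fst x), mscale N r (snd x)))\<rparr>"

text \<open>Direct sum of a family of modules indexed by a finite set \<open>I\<close>.\<close>

definition finite_direct_sum ::
  "'i set \<Rightarrow> ('i \<Rightarrow> ('r, 'm) rmodule) \<Rightarrow> ('r, 'i \<Rightarrow> 'm) rmodule" where
  "finite_direct_sum I M =
     \<lparr>mcarrier = (\<Pi>\<^sub>E i\<in>I. mcarrier (M i)),
      mplus = (\<lambda>x y. \<lambda>i\<in>I. mplus (M i) (x i) (y i)),
      mscale = (\<lambda>r x. \<lambda>i\<in>I. mscale (M i) r (x i))\<rparr>"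


section \<open>Free modules\<close>

text \<open>\<open>'g \<Rightarrow>\<^sub>0 'r\<close> is the free module on \<open>'g\<close>, with basis elements \<open>Poly_Mapping.single g 1\<close>.\<close>

definition free_scale :: "'r::comm_ring_1 \<Rightarrow> ('g \<Rightarrow>\<^sub>0 'r) \<Rightarrow> ('g \<Rightarrow>\<^sub>0 'r)" where
  "free_scale r x = Poly_Mapping.map ((*) r) x"

abbreviation gen :: "'g \<Rightarrow> ('g \<Rightarrow>\<^sub>0 'r::comm_ring_1)" where
  "gen g \<equiv> Poly_Mapping.single g 1"

definition linear_ext :: "('g \<Rightarrow> ('h \<Rightarrow>\<^sub>0 'r::comm_ring_1)) \<Rightarrow> ('g \<Rightarrow>\<^sub>0 'r) \<Rightarrow> ('h \<Rightarrow>\<^sub>0 'r)" where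
  "linear_ext f x = (\<Sum>g\<in>Poly_Mapping.keys x. free_scale (Poly_Mapping.lookup x g) (f g))"

lemma lookup_free_scale:
  "Poly_Mapping.lookup (free_scale r x) g = r * Poly_Mapping.lookup x g"
  by (simp add: free_scale_def map.rep_eq when_def)

lemma module_free_scale: "module (free_scale :: 'r::comm_ring_1 \<Rightarrow> ('g \<Rightarrow>\<^sub>0 'r) \<Rightarrow> _)"
  by unfold_locales
     (auto intro!: poly_mapping_eqI simp: lookup_free_scale lookup_add algebra_simps)


section \<open>Differential graded algebras\<close>

text \<open>Multiplication, addition and unit are those of the type \<open>'a\<close>.  Differentials have
  degree \<open>-1\<close>.\<close>

record ('r, 'a) dga =
  dg_scale :: "'r \<Rightarrow> 'a \<Rightarrow> 'a"
  dg_comp :: "int \<Rightarrow> 'a set"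
  dg_diff :: "'a \<Rightarrow> 'a"

definition ksign :: "int \<Rightarrow> 'r::comm_ring_1" where
  "ksign k = (if even k then 1 else - 1)"

locale dg_algebra =
  fixes A :: "('r::comm_ring_1, 'a::ring_1) dga"
  assumes scale_module: "module (dg_scale A)"
    and scale_mult_left: "\<And>r a b. dg_scale A r a * b = dg_scale A r (a * b)"
    and scale_mult_right: "\<And>r a b. a * dg_scale A r b = dg_scale A r (a * b)"
    and comp_subspace: "\<And>k. module.subspace (dg_scale A) (dg_comp A k)"
    and comp_one: "1 \<in> dg_comp A 0"
    and comp_mult: "\<And>k l a b. a \<in> dg_comp A k \<Longrightarrow> b \<in> dg_comp A l \<Longrightarrow> a * b \<in> dg_comp A (k + l)"
    and comp_direct: "\<And>a. \<exists>!f. finite {k. f k \<noteq> 0} \<and> (\<forall>k. f k \<in> dg_comp A k) \<and>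
                              a = (\<Sum>k | f k \<noteq> 0. f k)"
    and diff_add: "\<And>a b. dg_diff A (a + b) = dg_diff A a + dg_diff A b"
    and diff_scale: "\<And>r a. dg_diff A (dg_scale A r a) = dg_scale A r (dg_diff A a)"
    and diff_comp: "\<And>k a. a \<in> dg_comp A k \<Longrightarrow> dg_diff A a \<in> dg_comp A (k - 1)"
    and diff_diff: "\<And>a. dg_diff A (dg_diff A a) = 0"
    and leibniz: "\<And>k a b. a \<in> dg_comp A k \<Longrightarrow>
          dg_diff A (a * b) = dg_diff A a * b + dg_scale A (ksign k) (a * dg_diff A b)"


section \<open>Cyclic homology of a differential graded algebra\<close>

text \<open>
  The cyclic homology of \<open>A\<close> is the homology of the (direct sum) total complex of Tsygan's
  cyclic bicomplex of the cyclic module \<open>n \<mapsto> A\<^sup>\<otimes>\<^sup>n\<^sup>+\<^sup>1\<close>, whose columns \<open>c = 0, 1, 2, \<dots>\<close> are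
  alternately \<open>b\<close> (even \<open>c\<close>) and \<open>-b'\<close> (odd \<open>c\<close>) and whose rows are alternately \<open>1 - t\<close>
  (out of odd \<open>c\<close>) and \<open>N = 1 + t + \<dots> + t\<^sup>n\<close> (out of even \<open>c > 0\<close>), the internal
  differential being added with the sign \<open>(-1)\<^sup>c\<^sup>+\<^sup>n\<close>.

  A word \<open>[(k\<^sub>0, a\<^sub>0), \<dots>, (k\<^sub>n, a\<^sub>n)]\<close> with \<open>a\<^sub>i\<close> homogeneous of degree \<open>k\<^sub>i\<close> stands for the
  tensor \<open>a\<^sub>0 \<otimes> \<dots> \<otimes> a\<^sub>n\<close>.  Degrees are recorded since the zero element is homogeneous of every
  degree.  The tensor powers are presented as the free module on words modulo the multilinearity
  relations, and operators on tensors are given by their values on words.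
\<close>

type_synonym 'a word = "(int \<times> 'a) list"

definition word_degree :: "'a word \<Rightarrow> int" where
  "word_degree w = sum_list (map fst w)"

definition face :: "nat \<Rightarrow> 'a::ring_1 word \<Rightarrow> 'a word" where
  "face i w =
     take i w @ [(fst (w ! i) + fst (w ! Suc i), snd (w ! i) * snd (w ! Suc i))] @ drop (i + 2) w"

definition rot :: "'a word \<Rightarrow> 'a word" where
  "rot w = last w # butlast w"

text \<open>The Koszul sign of moving the last tensor factor to the front.\<close>

definition rot_sign :: "'a word \<Rightarrow> 'r::comm_ring_1" where
  "rot_sign w = ksign (fst (last w) * word_degree (butlast w))"

definition bar_b' :: "'a::ring_1 word \<Rightarrow> ('a word \<Rightarrow>\<^sub>0 'r::comm_ring_1)" where
  "bar_b' w = (\<Sum>i<length w - 1. free_scale ((- 1) ^ i) (gen (face i w)))"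

definition hoch_b :: "'a::ring_1 word \<Rightarrow> ('a word \<Rightarrow>\<^sub>0 'r::comm_ring_1)" where
  "hoch_b w = bar_b' w +
     (if length w \<le> 1 then 0
      else free_scale ((- 1) ^ (length w - 1) * rot_sign w) (gen (face 0 (rot w))))"

definition cyc_t :: "'a word \<Rightarrow> ('a word \<Rightarrow>\<^sub>0 'r::comm_ring_1)" where
  "cyc_t w = free_scale ((- 1) ^ (length w - 1) * rot_sign w) (gen (rot w))"

definition norm_N :: "'a word \<Rightarrow> ('a word \<Rightarrow>\<^sub>0 'r::comm_ring_1)" where
  "norm_N w = (\<Sum>j<length w. (linear_ext cyc_t ^^ j) (gen w))"

definition int_diff ::
  "('r::comm_ring_1, 'a::ring_1) dga \<Rightarrow> 'a word \<Rightarrow> ('a word \<Rightarrow>\<^sub>0 'r)" where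
  "int_diff A w =
     (\<Sum>i<length w. free_scale (ksign (word_degree (take i w)))
        (gen (w[i := (fst (w ! i) - 1, dg_diff A (snd (w ! i)))])))"

text \<open>Chains of the total complex: linear combinations of pairs of a column and a word.\<close>

type_synonym ('a, 'r) chain = "(nat \<times> 'a word) \<Rightarrow>\<^sub>0 'r"

definition in_column :: "nat \<Rightarrow> ('a word \<Rightarrow>\<^sub>0 'r::comm_ring_1) \<Rightarrow> ('a, 'r) chain" where
  "in_column c = linear_ext (\<lambda>w. gen (c, w))"

definition total_diff_gen ::
  "('r::comm_ring_1, 'a::ring_1) dga \<Rightarrow> nat \<times> 'a word \<Rightarrow> ('a, 'r) chain" where
  "total_diff_gen A = (\<lambda>(c, w).
     in_column c (if even c then hoch_b w else - bar_b' w) +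
     (if c = 0 then 0
      else in_column (c - 1) (if odd c then gen w - cyc_t w else norm_N w)) +
     in_column c (free_scale ((- 1) ^ (c + (length w - 1))) (int_diff A w)))"

definition total_diff ::
  "('r::comm_ring_1, 'a::ring_1) dga \<Rightarrow> ('a, 'r) chain \<Rightarrow> ('a, 'r) chain" where
  "total_diff A = linear_ext (total_diff_gen A)"

definition chain_gens :: "('r::comm_ring_1, 'a::ring_1) dga \<Rightarrow> int \<Rightarrow> (nat \<times> 'a word) set" where
  "chain_gens A i =
     {(c, w). w \<noteq> [] \<and> (\<forall>(k, a)\<in>set w. a \<in> dg_comp A k) \<and>
              int c + (int (length w) - 1) + word_degree w = i}"

definition free_chains :: "('r::comm_ring_1, 'a::ring_1) dga \<Rightarrow> int \<Rightarrow> ('a, 'r) chain set" where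
  "free_chains A i = {x. Poly_Mapping.keys x \<subseteq> chain_gens A i}"

definition add_relations :: "('r::comm_ring_1, 'a::ring_1) dga \<Rightarrow> int \<Rightarrow> ('a, 'r) chain set" where
  "add_relations A i =
     {gen (c, u @ (k, a + a') # v) - gen (c, u @ (k, a) # v) - gen (c, u @ (k, a') # v) | c u k a a' v.
        (c, u @ (k, a) # v) \<in> chain_gens A i \<and> (c, u @ (k, a') # v) \<in> chain_gens A i}"

definition scale_relations :: "('r::comm_ring_1, 'a::ring_1) dga \<Rightarrow> int \<Rightarrow> ('a, 'r) chain set" where
  "scale_relations A i =
     {gen (c, u @ (k, dg_scale A r a) # v) - free_scale r (gen (c, u @ (k, a) # v)) | c u k r a v.
        (c, u @ (k, a) # v) \<in> chain_gens A i}"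

definition tensor_relations :: "('r::comm_ring_1, 'a::ring_1) dga \<Rightarrow> int \<Rightarrow> ('a, 'r) chain set" where
  "tensor_relations A i = module.span free_scale (add_relations A i \<union> scale_relations A i)"

text \<open>The degree \<open>i\<close> part of the total complex is \<open>free_chains A i / tensor_relations A i\<close>.  Its
  cycles and boundaries are represented by their preimages in \<open>free_chains A i\<close>.\<close>

definition cycles :: "('r::comm_ring_1, 'a::ring_1) dga \<Rightarrow> int \<Rightarrow> ('a, 'r) chain set" where
  "cycles A i = {x \<in> free_chains A i. total_diff A x \<in> tensor_relations A (i - 1)}"

definition boundaries :: "('r::comm_ring_1, 'a::ring_1) dga \<Rightarrow> int \<Rightarrow> ('a, 'r) chain set" where
  "boundaries A i = total_diff A ` free_chains A (i + 1) + tensor_relations A i"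

definition HC ::
  "int \<Rightarrow> ('r::comm_ring_1, 'a::ring_1) dga \<Rightarrow> ('r, ('a, 'r) chain set) rmodule" where
  "HC i A = quotient_module free_scale (cycles A i) (boundaries A i)"


section \<open>The algebra \<open>R//p\<close>\<close>

text \<open>The polynomial type supplies the underlying algebra \<open>R[x]\<close>; the degree of \<open>x\<close> is \<open>1\<close>, so
  although \<open>R[x]\<close> is commutative it is not graded commutative.\<close>

definition dquot_diff :: "'r::comm_ring_1 \<Rightarrow> 'r poly \<Rightarrow> 'r poly" where
  "dquot_diff p f = (\<Sum>n | n \<le> degree f \<and> odd n. monom (p * coeff f n) (n - 1))"

definition dquot :: "'r::comm_ring_1 \<Rightarrow> ('r, 'r poly) dga" where
  "dquot p =
     \<lparr>dg_scale = smult,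
      dg_comp = (\<lambda>k. if k < 0 then {0} else range (\<lambda>r. monom r (nat k))),
      dg_diff = dquot_diff p\<rparr>"

lemma coeff_dquot_diff:
  "coeff (dquot_diff p f) m = (if even m then p * coeff f (Suc m) else 0)"
proof -
  have "coeff (dquot_diff p f) m =
      (\<Sum>n | n \<le> degree f \<and> odd n. if n = Suc m then p * coeff f n else 0)"
    unfolding dquot_diff_def coeff_sum
    by (rule sum.cong) (auto elim: oddE)
  also have "\<dots> = (if Suc m \<le> degree f \<and> odd (Suc m) then p * coeff f (Suc m) else 0)"
    by (subst sum.delta) auto
  also have "\<dots> = (if even m then p * coeff f (Suc m) else 0)"
    by (auto simp: coeff_eq_0)
  finally show ?thesis .
qed

lemma dquot_diff_x: "dquot_diff p (monom 1 1) = [:p:]"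
  by (rule poly_eqI) (auto simp: coeff_dquot_diff coeff_pCons split: nat.split)

lemma dquot_comp_iff:
  "f \<in> dg_comp (dquot p) k \<longleftrightarrow> (\<forall>m. int m \<noteq> k \<longrightarrow> coeff f m = 0)"
proof (cases "k < 0")
  case True
  then have "int m \<noteq> k" for m by linarith
  then have "(\<forall>m. int m \<noteq> k \<longrightarrow> coeff f m = 0) \<longleftrightarrow> f = 0"
    unfolding poly_eq_iff by simp
  moreover have "f \<in> dg_comp (dquot p) k \<longleftrightarrow> f = 0"
    using True by (simp add: dquot_def)
  ultimately show ?thesis by blast
next
  case False
  then have comp: "dg_comp (dquot p) k = range (\<lambda>r. monom r (nat k))"
    by (simp add: dquot_def)
  have k: "int m = k \<longleftrightarrow> nat k = m" for m
    using False by linarith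
  show ?thesis
  proof
    assume "f \<in> dg_comp (dquot p) k"
    then obtain r where "f = monom r (nat k)"
      unfolding comp by blast
    then show "\<forall>m. int m \<noteq> k \<longrightarrow> coeff f m = 0"
      unfolding k by simp
  next
    assume "\<forall>m. int m \<noteq> k \<longrightarrow> coeff f m = 0"
    then have "f = monom (coeff f (nat k)) (nat k)"
      unfolding k by (intro poly_eqI) simp
    then show "f \<in> dg_comp (dquot p) k"
      unfolding comp by (rule range_eqI)
  qed
qed

lemma dg_algebra_dquot: "dg_algebra (dquot p)"
proof (rule dg_algebra.intro)
  show "module (dg_scale (dquot p))"
    by (unfold_locales) (auto simp: dquot_def smult_add_left smult_add_right)
  show "\<exists>!f. finite {k. f k \<noteq> 0} \<and> (\<forall>k. f k \<in> dg_comp (dquot p) k) \<and>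
         a = (\<Sum>k | f k \<noteq> 0. f k)" for a
  proof (rule ex1I)
    define h where "h = (\<lambda>k::int. if k < 0 then 0 else monom (coeff a (nat k)) (nat k))"
    have sub: "{k. h k \<noteq> 0} \<subseteq> int ` {..degree a}"
    proof
      fix k assume "k \<in> {k. h k \<noteq> 0}"
      then have "k \<ge> 0" "coeff a (nat k) \<noteq> 0"
        by (auto simp: h_def split: if_splits)
      then show "k \<in> int ` {..degree a}"
        by (intro image_eqI[of _ _ "nat k"]) (auto intro: le_degree)
    qed
    have fin: "finite {k. h k \<noteq> 0}"
      using sub finite_subset by blast
    have "(\<Sum>k | h k \<noteq> 0. h k) = (\<Sum>k\<in>int ` {..degree a}. h k)"
      by (rule sum.mono_neutral_left) (use sub in auto)
    also have "\<dots> = (\<Sum>n\<le>degree a. monom (coeff a n) n)"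
      by (subst sum.reindex) (auto simp: h_def)
    also have "\<dots> = a"
      by (rule poly_as_sum_of_monoms)
    finally show "finite {k. h k \<noteq> 0} \<and> (\<forall>k. h k \<in> dg_comp (dquot p) k) \<and>
         a = (\<Sum>k | h k \<noteq> 0. h k)"
      using fin by (auto simp: h_def dquot_def)
    fix f assume f: "finite {k. f k \<noteq> 0} \<and> (\<forall>k. f k \<in> dg_comp (dquot p) k) \<and>
         a = (\<Sum>k | f k \<noteq> 0. f k)"
    show "f = h"
    proof
      fix k
      have cf: "coeff (f l) (nat k) = (if l = k then coeff (f k) (nat k) else 0)" if "k \<ge> 0" for l
      proof (cases "l < 0")
        case True
        then have "f l = 0" using f by (auto simp: dquot_def dest!: spec[of _ l])
        then show ?thesis using True that by auto
      next
        case False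
        then obtain r where "f l = monom r (nat l)"
          using f by (auto simp: dquot_def dest!: spec[of _ l])
        then show ?thesis using False that by auto
      qed
      show "f k = h k"
      proof (cases "k < 0")
        case True
        then show ?thesis using f by (auto simp: dquot_def h_def dest!: spec[of _ k])
      next
        case False
        obtain r where r: "f k = monom r (nat k)"
          using f False by (auto simp: dquot_def dest!: spec[of _ k])
        have "coeff a (nat k) = (\<Sum>l | f l \<noteq> 0. coeff (f l) (nat k))"
          using f by (metis coeff_sum)
        also have "\<dots> = (\<Sum>l | f l \<noteq> 0. if l = k then coeff (f k) (nat k) else 0)"
          using False cf by (intro sum.cong) auto
        also have "\<dots> = coeff (f k) (nat k)"
          using f by (subst sum.delta) auto
        finally show ?thesis using False r by (simp add: h_def)
      qed
    qed
  qed
  show "dg_diff (dquot p) (a * b) = dg_diff (dquot p) a * b +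
      dg_scale (dquot p) (ksign k) (a * dg_diff (dquot p) b)"
    if "a \<in> dg_comp (dquot p) k" for k a b
  proof (cases "k < 0")
    case True
    then have "a = 0" using that by (auto simp: dquot_def)
    then show ?thesis by (simp add: dquot_def dquot_diff_def)
  next
    case False
    define n where "n = nat k"
    have "a \<in> range (\<lambda>r. monom r n)"
      using that False by (simp add: dquot_def n_def)
    then obtain r where a: "a = monom r n"
      by blast
    have d: "dquot_diff p a = (if odd n then monom (p * r) (n - 1) else 0)"
      by (rule poly_eqI) (auto simp: a coeff_dquot_diff elim: oddE)
    have k: "even k \<longleftrightarrow> even n"
      using False by (simp add: n_def even_nat_iff)
    have "dquot_diff p (a * b) = dquot_diff p a * b + smult (ksign k) (a * dquot_diff p b)"
    proof (rule poly_eqI)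
      fix m
      have L: "coeff (dquot_diff p (a * b)) m =
          (if even m \<and> n \<le> Suc m then p * (r * coeff b (Suc m - n)) else 0)"
        by (simp add: a coeff_dquot_diff coeff_monom_mult)
      have R1: "coeff (dquot_diff p a * b) m =
          (if odd n \<and> n - 1 \<le> m then p * r * coeff b (m - (n - 1)) else 0)"
        by (simp add: d coeff_monom_mult)
      have R2: "coeff (a * dquot_diff p b) m =
          (if n \<le> m \<and> even (m - n) then r * (p * coeff b (Suc (m - n))) else 0)"
        by (simp add: a coeff_monom_mult coeff_dquot_diff)
      consider "n \<le> m" | "n = Suc m" | "Suc m < n"
        by linarith
      then show "coeff (dquot_diff p (a * b)) m =
          coeff (dquot_diff p a * b + smult (ksign k) (a * dquot_diff p b)) m"
      proof cases
        case 1
        then have "Suc m - n = Suc (m - n)" "m - (n - 1) = (if n = 0 then m else Suc (m - n))"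
            "even (m - n) \<longleftrightarrow> (even m \<longleftrightarrow> even n)"
          by auto
        then show ?thesis
          unfolding coeff_add coeff_smult L R1 R2 using 1 k
          by (auto simp: ksign_def algebra_simps)
      next
        case 2
        then show ?thesis
          unfolding coeff_add coeff_smult L R1 R2 by (simp add: algebra_simps)
      next
        case 3
        then show ?thesis
          unfolding coeff_add coeff_smult L R1 R2 by auto
      qed
    qed
    then show ?thesis by (simp add: dquot_def)
  qed
  have mod: "module (smult :: 'a \<Rightarrow> 'a poly \<Rightarrow> 'a poly)"
    by unfold_locales (auto simp: smult_add_left smult_add_right)
  show "module.subspace (dg_scale (dquot p)) (dg_comp (dquot p) k)" for k
  proof -
    have scale: "dg_scale (dquot p) = smult" by (simp add: dquot_def)
    show ?thesis
      unfolding scale module.subspace_def[OF mod] by (auto simp: dquot_comp_iff)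
  qed
  show "a * b \<in> dg_comp (dquot p) (k + l)"
    if "a \<in> dg_comp (dquot p) k" "b \<in> dg_comp (dquot p) l" for k l a b
    unfolding dquot_comp_iff
  proof (intro allI impI)
    fix m assume m: "int m \<noteq> k + l"
    have "coeff a i * coeff b (m - i) = 0" if "i \<le> m" for i
    proof (cases "int i = k")
      case True
      then have "int (m - i) \<noteq> l" using m \<open>i \<le> m\<close> by auto
      then show ?thesis using \<open>b \<in> _\<close> by (simp add: dquot_comp_iff)
    next
      case False
      then show ?thesis using \<open>a \<in> _\<close> by (simp add: dquot_comp_iff)
    qed
    then show "coeff (a * b) m = 0" by (simp add: coeff_mult)
  qed
  show "dg_diff (dquot p) a \<in> dg_comp (dquot p) (k - 1)"
    if "a \<in> dg_comp (dquot p) k" for k a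
    unfolding dquot_comp_iff
  proof (intro allI impI)
    fix m assume "int m \<noteq> k - 1"
    then have "int (Suc m) \<noteq> k" by linarith
    then have "coeff a (Suc m) = 0" using that unfolding dquot_comp_iff by blast
    then show "coeff (dg_diff (dquot p) a) m = 0" by (simp add: dquot_def coeff_dquot_diff)
  qed
  show "(1 :: 'a poly) \<in> dg_comp (dquot p) 0"
    unfolding dquot_comp_iff by auto
qed (auto simp: dquot_def coeff_dquot_diff poly_eq_iff distrib_left)


section \<open>Localized integers and valuations\<close>

definition Z_loc :: "nat \<Rightarrow> rat set" where
  "Z_loc p = {of_int a / of_int b | a b. b \<noteq> 0 \<and> \<not> int p dvd b}"

text \<open>\<open>\<phi>\<close> (only its values on \<open>Z_loc p\<close> matter) is the structure map of a \<open>Z_loc p\<close>-algebra.\<close>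

definition Z_loc_algebra :: "nat \<Rightarrow> (rat \<Rightarrow> 'r::comm_ring_1) \<Rightarrow> bool" where
  "Z_loc_algebra p \<phi> \<longleftrightarrow>
     \<phi> 1 = 1 \<and>
     (\<forall>x\<in>Z_loc p. \<forall>y\<in>Z_loc p. \<phi> (x + y) = \<phi> x + \<phi> y \<and> \<phi> (x * y) = \<phi> x * \<phi> y)"

definition torsion_free :: "'r::comm_ring_1 \<Rightarrow> bool" where
  "torsion_free c \<longleftrightarrow> inj (\<lambda>r. c * r)"

definition padic_val :: "nat \<Rightarrow> rat \<Rightarrow> int" where
  "padic_val p q = (case quotient_of q of (a, b) \<Rightarrow>
     int (multiplicity (int p) a) - int (multiplicity (int p) b))"

text \<open>Only the values at odd indices are meaningful.\<close>

fun A_seq :: "nat \<Rightarrow> nat \<Rightarrow> rat" where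
  "A_seq p 0 = 0"
| "A_seq p (Suc 0) = of_nat p"
| "A_seq p (Suc (Suc j)) = (of_nat p)\<^sup>2 * A_seq p j / of_nat (Suc (Suc j))"

text \<open>For odd \<open>j\<close> and an odd prime \<open>p\<close> the valuation is nonnegative, so \<open>nat\<close> loses nothing.\<close>

definition a_exp :: "nat \<Rightarrow> nat \<Rightarrow> nat" where
  "a_exp p j = nat (padic_val p (A_seq p j))"

end

theory Submission
  imports Defs
begin

text \<open>
  The idea is that \<open>A = R[x]\<close> is the tensor algebra on one generator of degree \<open>1\<close>, so that its
  cyclic homology is computed by a small complex, which can be diagonalized by an exponential.
  Write \<open>q\<close> for the image of \<open>p\<close> in \<open>R\<close>.

  The tensor powers of \<open>A\<close> are free on the tensors \<open>x^m\<^sub>0 \<otimes> \<dots> \<otimes> x^m\<^sub>n\<close>, so a chain, modulo the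
  multilinearity relations, is determined by its pairings with all functions of a column and a list
  of exponents (\<open>tensor_relations_iff\<close>). The total differential then becomes its transpose
  \<open>cotot\<close>, acting on functions, and every identity between operators is a pointwise identity of
  functions, free of quotients.

  The small complex has generators \<open>u\<^bsub>n,s\<^esub>\<close> of degree \<open>n + s\<close>: \<open>x\<^sup>n\<close> in column \<open>s\<close> if \<open>s\<close> is even, and
  the class of the noncommutative differential form \<open>x\<^bsup>n-1\<^esup> dx\<close> modulo graded commutators in column
  \<open>s - 1\<close> if \<open>s\<close> is odd (so \<open>u\<^bsub>0,s\<^esub> = 0\<close> for odd \<open>s\<close>). Its differential is
  \<open>d u\<^bsub>n,s\<^esub> = n u\<^bsub>n,s-1\<^esub> + q u\<^bsub>n-1,s\<^esub>\<close> for odd \<open>n\<close> and even \<open>s\<close>, without the first summand if \<open>s = 0\<close>;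
  \<open>d u\<^bsub>n,s\<^esub> = 2 u\<^bsub>n,s-1\<^esub> - q u\<^bsub>n-1,s\<^esub>\<close> for even \<open>n\<close> and odd \<open>s\<close>; and \<open>0\<close> otherwise.
  The projection onto it is a chain map (\<open>cotot_small_coord\<close>). Its kernel is acyclic
  (\<open>small_coord_kernel_acyclic\<close>): odd columns are contracted by \<open>1 \<otimes> -\<close>, even columns by the
  contraction that a tensor algebra carries, and the errors made on the way lie in lower columns or
  have lower weight in \<open>x\<close>.

  Multiplication by \<open>q\<close> is injective, hence so is the small differential in odd degrees, and the odd
  homology vanishes (\<open>odd_cycle_in_boundaries\<close>). In degree \<open>2N\<close> the invertibility of \<open>2\<close>
  allows the generators with even \<open>n > 0\<close> to be eliminated. With \<open>\<kappa> = q\<^sup>2/2\<close> there remain generators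
  \<open>e\<close> (of weight \<open>0\<close>) and \<open>e\<^sub>j\<close> (of weight \<open>2j + 1\<close>, for \<open>j < N\<close>), and the relations
  \<open>q e + e\<^sub>0\<close>, \<open>(2j + 1) e\<^sub>j + \<kappa> e\<^bsub>j-1\<^esub>\<close> for \<open>j > 0\<close>, and \<open>\<kappa> e\<^bsub>N-1\<^esub>\<close> (\<open>even_boundaries_iff\<close>).
  For \<open>N = 0\<close> this is \<open>R/q\<close>.

  Read \<open>e\<^sub>j\<close> as \<open>y\<^bsup>2j+1\<^esup>\<close>, with negative powers of \<open>y\<close> set to zero. Modulo \<open>e\<close>, all relations
  but the last are the images of the monomials under \<open>y d/dy + \<kappa> y\<^bsup>-2\<^esup>\<close>. Multiplication by
  \<open>exp (- \<kappa> y\<^bsup>-2\<^esup> / 2)\<close> conjugates this operator into \<open>y d/dy\<close>, which is diagonal. The coefficients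
  \<open>(- \<kappa>/2)\<^sup>k / k!\<close> lie in \<open>\<int>\<close> localized at \<open>p\<close> because \<open>p\<^sup>k / k!\<close> does. The generator \<open>e\<close> is split
  off by the numbers \<open>A\<^sub>j\<close>, up to powers of \<open>2\<close> and signs. With \<open>i = 2N\<close>, the last relation turns into
  \<open>p\<^sup>2 A\<^bsub>i-1\<^esub> e\<close> up to a unit, provided that \<open>i - 1 - 2k\<close> divides \<open>\<kappa> (\<kappa>/2)\<^sup>k / k!\<close> for all \<open>k < N\<close>
  (\<open>HC_even_iso\<close>). For \<open>i - 1 = (p\<^sup>a \<plusminus> 1)/2\<close> this holds because a power of \<open>p\<close> that divides
  \<open>i - 1 - 2k\<close> also divides \<open>4k \<minusplus> 1\<close>, hence is small (\<open>power_prime_not_dvd\<close>).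
\<close>

section \<open>Transposed cyclic operators\<close>

text \<open>
  The tensor \<open>x^m\<^sub>0 \<otimes> \<dots> \<otimes> x^m\<^sub>n\<close> is recorded as the list of its exponents. The operators \<open>cocyc\<close>,
  \<open>cobar\<close>, \<open>cohoch\<close>, \<open>conorm\<close> and \<open>codiff\<close> send a function \<open>F\<close> on lists to its composite with
  \<open>t\<close>, \<open>b'\<close>, \<open>b\<close>, \<open>N\<close> and the internal differential. Transposition reverses the order of composition.
\<close>

definition merge :: "nat \<Rightarrow> nat list \<Rightarrow> nat list" where
  "merge i ms = take i ms @ [ms ! i + ms ! Suc i] @ drop (i + 2) ms"

definition cocyc :: "(nat list \<Rightarrow> 'r::comm_ring_1) \<Rightarrow> nat list \<Rightarrow> 'r" where
  "cocyc F ms = (-1) ^ (length ms - 1 + last ms * sum_list (butlast ms)) * F (last ms # butlast ms)"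

text \<open>The signed face maps. The face that wraps around is \<open>d\<^sub>0 t\<close>; with this convention the faces
  absorb all signs of \<open>b\<close>, and their relations with \<open>t\<close> are free of signs.\<close>

definition coface :: "nat \<Rightarrow> (nat list \<Rightarrow> 'r::comm_ring_1) \<Rightarrow> nat list \<Rightarrow> 'r" where
  "coface i F ms =
     (if Suc i < length ms then (-1) ^ i * F (merge i ms) else cocyc (\<lambda>u. F (merge 0 u)) ms)"

definition cobar :: "(nat list \<Rightarrow> 'r::comm_ring_1) \<Rightarrow> nat list \<Rightarrow> 'r" where
  "cobar F ms = (\<Sum>i<length ms - 1. coface i F ms)"

definition cohoch :: "(nat list \<Rightarrow> 'r::comm_ring_1) \<Rightarrow> nat list \<Rightarrow> 'r" where
  "cohoch F ms = (if length ms \<le> 1 then 0 else \<Sum>i<length ms. coface i F ms)"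

definition conorm :: "(nat list \<Rightarrow> 'r::comm_ring_1) \<Rightarrow> nat list \<Rightarrow> 'r" where
  "conorm F ms = (\<Sum>j<length ms. (cocyc ^^ j) F ms)"

definition codiff :: "'r::comm_ring_1 \<Rightarrow> (nat list \<Rightarrow> 'r) \<Rightarrow> nat list \<Rightarrow> 'r" where
  "codiff q F ms = (\<Sum>i<length ms. (-1) ^ sum_list (take i ms) *
     (if odd (ms ! i) then q * F (ms[i := ms ! i - 1]) else 0))"

lemma merge_0 [simp]: "merge 0 (a # b # w) = (a + b) # w"
  by (simp add: merge_def)

lemma merge_Suc [simp]: "merge (Suc i) (a # w) = a # merge i w"
  by (simp add: merge_def)

lemma length_merge [simp]: "Suc i < length ms \<Longrightarrow> length (merge i ms) = length ms - 1"
  by (simp add: merge_def)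

lemma sum_list_merge [simp]: "Suc i < length ms \<Longrightarrow> sum_list (merge i ms) = sum_list ms"
proof (induction i arbitrary: ms)
  case 0
  then obtain a b w where "ms = a # b # w"
    by (cases ms rule: remdups_adj.cases) auto
  then show ?case by simp
next
  case (Suc i)
  then obtain a w where "ms = a # w" by (cases ms) auto
  with Suc show ?case by simp
qed

lemma merge_snoc: "Suc i < length v \<Longrightarrow> merge i (v @ u) = merge i v @ u"
  by (simp add: merge_def nth_append)

lemma merge_merge:
  "i < j \<Longrightarrow> Suc j < length ms \<Longrightarrow> merge i (merge j ms) = merge (j - 1) (merge i ms)"
proof (induction i arbitrary: j ms)
  case 0
  then obtain a w j' where "ms = a # w" "j = Suc j'" by (cases ms; cases j) auto
  moreover from this 0 obtain b w' where "w = b # w'" by (cases w) auto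
  moreover from calculation 0 obtain c w'' where "w' = c # w''" by (cases w') auto
  ultimately show ?case by (cases j') (auto simp: add.assoc)
next
  case (Suc i)
  then obtain a w j' where "ms = a # w" "j = Suc j'" by (cases ms; cases j) auto
  moreover from this Suc obtain k where "j' = Suc k" by (cases j') auto
  ultimately show ?case using Suc by auto
qed

lemma cocyc_cong:
  assumes "\<And>u. length u = length ms \<Longrightarrow> sum_list u = sum_list ms \<Longrightarrow> F u = G u" "ms \<noteq> []"
  shows "cocyc F ms = cocyc G ms"
proof -
  obtain u m where "ms = u @ [m]" using assms(2) by (metis rev_exhaust)
  then show ?thesis using assms(1)[of "m # u"] by (simp add: cocyc_def)
qed

lemma cocyc_snoc: "cocyc F (u @ [m]) = (-1) ^ (length u + m * sum_list u) * F (m # u)"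
  by (simp add: cocyc_def)

lemma cocyc_linear:
  "cocyc (\<lambda>u. F u + G u) ms = cocyc F ms + cocyc G ms"
  "cocyc (\<lambda>u. F u - G u) ms = cocyc F ms - cocyc G ms"
  "cocyc (\<lambda>u. a * F u) ms = a * cocyc F ms"
  "cocyc (\<lambda>u. - F u) ms = - cocyc F ms"
  "cocyc (\<lambda>u. 0) ms = (0::'r::comm_ring_1)"
  "cocyc (\<lambda>u. \<Sum>i\<in>I. f i u) ms = (\<Sum>i\<in>I. cocyc (f i) ms)"
  for F :: "nat list \<Rightarrow> 'r::comm_ring_1"
  by (auto simp: cocyc_def algebra_simps sum_distrib_left sum_distrib_right)

lemma cocyc_linear_fun:
  "cocyc (\<lambda>u. F u + G u) = (\<lambda>ms. cocyc F ms + cocyc G ms)"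
  "cocyc (\<lambda>u. F u - G u) = (\<lambda>ms. cocyc F ms - cocyc G ms)"
  "cocyc (\<lambda>u. a * F u) = (\<lambda>ms. a * cocyc F ms)"
  "cocyc (\<lambda>u. - F u) = (\<lambda>ms. - cocyc F ms)"
  "cocyc (\<lambda>u. 0) = (\<lambda>ms. 0::'r::comm_ring_1)"
  "cocyc (\<lambda>u. \<Sum>i\<in>I. f i u) = (\<lambda>ms. \<Sum>i\<in>I. cocyc (f i) ms)"
  for F :: "nat list \<Rightarrow> 'r::comm_ring_1"
  by (rule ext, rule cocyc_linear)+

lemma minus_one_power_cong: "even a = even b \<Longrightarrow> (-1 :: 'r::ring_1) ^ a = (-1) ^ b"
  by (metis minus_one_power_iff)

text \<open>\<open>d\<^bsub>i+1\<^esub> t = t d\<^sub>i\<close>: after a rotation the pair to be merged sits one place further. Koszul signs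
  meet only when the last factor takes part in the merge; there they agree by parity.\<close>

lemma coface_cocyc:
  assumes "Suc i < length ms"
  shows "cocyc (coface (Suc i) F) ms = coface i (cocyc F) ms"
proof -
  obtain u m where ms: "ms = u @ [m]" using assms by (metis list.size(3) not_less_zero rev_exhaust)
  show ?thesis
  proof (cases "Suc (Suc i) < length ms")
    case True
    then have "Suc i < length u" by (simp add: ms)
    moreover have "merge i u @ [m] = merge i (u @ [m])" using \<open>Suc i < length u\<close> by (simp add: merge_snoc)
    moreover obtain l where "length u = Suc l" using \<open>Suc i < length u\<close> by (cases "length u") auto
    ultimately show ?thesis using assms
      by (simp add: ms coface_def cocyc_snoc merge_snoc algebra_simps)
  next
    case False
    then have l: "length u = Suc i" using assms by (simp add: ms)
    then obtain v k where u: "u = v @ [k]" by (metis length_0_conv nat.distinct(1) rev_exhaust)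
    have lv: "length v = i" using l u by simp
    have mg: "merge i (v @ [k, m]) = v @ [k + m]" using lv by (simp add: merge_def nth_append)
    have cocyc_snoc2: "cocyc G (v @ [k, m]) = (-1) ^ (Suc i + m * (sum_list v + k)) * G (m # v @ [k])" for G :: "nat list \<Rightarrow> 'a"
      using cocyc_snoc[of G "v @ [k]" m] lv by simp
    have cocyc_snoc3: "cocyc G (m # v @ [k]) = (-1) ^ (Suc i + k * (m + sum_list v)) * G (k # m # v)" for G :: "nat list \<Rightarrow> 'a"
      using cocyc_snoc[of G "m # v" k] lv by simp
    have "cocyc (coface (Suc i) F) ms =
      (-1) ^ (Suc i + m * (sum_list v + k)) * ((-1) ^ (Suc i + k * (m + sum_list v)) * F ((k + m) # v))"
      using lv cocyc_snoc2 cocyc_snoc3 by (simp add: ms u coface_def)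
    moreover have "coface i (cocyc F) ms =
      (-1) ^ i * ((-1) ^ (i + (k + m) * sum_list v) * F ((k + m) # v))"
      using lv mg cocyc_snoc[of F v "k + m"] by (simp add: ms u coface_def)
    moreover have "(-1::'a) ^ (Suc i + m * (sum_list v + k)) * (-1) ^ (Suc i + k * (m + sum_list v))
       = (-1) ^ i * (-1) ^ (i + (k + m) * sum_list v)"
      unfolding power_add[symmetric] by (rule minus_one_power_cong) auto
    ultimately show ?thesis by (metis mult.assoc)
  qed
qed

lemma coface_last: "Suc n = length ms \<Longrightarrow> coface n F ms = cocyc (coface 0 F) ms" if "length ms \<ge> 2"
proof -
  assume n: "Suc n = length ms"
  show ?thesis unfolding coface_def[of n]
    using n that by (auto intro!: cocyc_cong simp: coface_def)
qed

lemma coface_linear: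
  "coface i (\<lambda>u. F u + G u) ms = coface i F ms + coface i G ms"
  "coface i (\<lambda>u. F u - G u) ms = coface i F ms - coface i G ms"
  "coface i (\<lambda>u. a * F u) ms = a * coface i F ms"
  "coface i (\<lambda>u. - F u) ms = - coface i F ms"
  "coface i (\<lambda>u. 0) ms = (0::'r::comm_ring_1)"
  "coface i (\<lambda>u. \<Sum>k\<in>I. f k u) ms = (\<Sum>k\<in>I. coface i (f k) ms)"
  for F :: "nat list \<Rightarrow> 'r::comm_ring_1"
  by (auto simp: coface_def cocyc_linear algebra_simps sum_distrib_left sum_distrib_right)

lemma coface_cong:
  assumes "length ms \<ge> 2"
    "\<And>u. length u = length ms - 1 \<Longrightarrow> sum_list u = sum_list ms \<Longrightarrow> F u = G u"
  shows "coface i F ms = coface i G ms"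
  unfolding coface_def using assms by (auto intro!: cocyc_cong)

text \<open>The simplicial identities for signed faces. Those that involve the wrapping face follow from
  the inner ones, because \<open>coface_cocyc\<close> carries rotations past faces.\<close>

lemma coface_coface:
  assumes "i < j" "j < length ms" "length ms \<ge> 3"
  shows "coface j (coface i F) ms = - coface i (coface (j - 1) F) ms"
proof -
  have inner: "coface i (coface j F) ms = - coface (Suc j) (coface i F) ms"
    if "i \<le> j" "Suc (Suc j) < length ms" for i j F and ms :: "nat list"
    using that merge_merge[of i "Suc j" ms] by (auto simp: coface_def)
  show ?thesis
  proof (cases "Suc j < length ms")
    case True
    then show ?thesis using inner[of i "j - 1" ms F] assms by simp
  next
    case False
    define n where "n = j"
    have n: "Suc n = length ms" using False assms by (simp add: n_def)
    have last: "coface n G ms = cocyc (coface 0 G) ms" for G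
      using coface_last[of ms n G] n assms by simp
    show ?thesis
    proof (cases "Suc i < n")
      case True
      have "coface n (coface i F) ms = cocyc (coface 0 (coface i F)) ms" by (rule last)
      also have "\<dots> = cocyc (\<lambda>u. - coface (Suc i) (coface 0 F) u) ms"
        by (rule cocyc_cong) (use inner[of 0 i _ F] True n in auto)
      also have "\<dots> = - coface i (cocyc (coface 0 F)) ms"
        using True n by (simp add: cocyc_linear coface_cocyc)
      also have "coface i (cocyc (coface 0 F)) ms = coface i (coface (n - 1) F) ms"
        by (rule coface_cong) (use assms n in \<open>auto intro!: coface_last[symmetric]\<close>)
      finally show ?thesis by (simp add: n_def)
    next
      case False
      then have i: "i = n - 1" using assms n_def by simp
      have L: "coface (n - 1) F u = cocyc (coface 0 F) u" if "length u = n" for u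
        using that assms n by (intro coface_last) auto
      have "coface n (coface i F) ms = cocyc (coface 0 (coface i F)) ms" by (rule last)
      also have "\<dots> = cocyc (coface 0 (cocyc (coface 0 F))) ms"
        unfolding i by (intro cocyc_cong coface_cong L) (use n assms in auto)
      also have "\<dots> = cocyc (cocyc (coface 1 (coface 0 F))) ms"
        by (rule cocyc_cong) (use coface_cocyc[of 0 _ "coface 0 F"] n assms in auto)
      also have "\<dots> = cocyc (cocyc (\<lambda>u. - coface 0 (coface 0 F) u)) ms"
        by (intro cocyc_cong) (use inner[of 0 0 _ F] n assms in auto)
      also have "\<dots> = - cocyc (cocyc (coface 0 (coface 0 F))) ms"
        by (simp add: cocyc_linear_fun)
      also have "cocyc (cocyc (coface 0 (coface 0 F))) ms = cocyc (coface n (coface 0 F)) ms"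
        by (intro cocyc_cong coface_last[symmetric]) (use n assms in auto)
      also have "\<dots> = coface (n - 1) (cocyc (coface 0 F)) ms"
        using coface_cocyc[of "n - 1" ms "coface 0 F"] n assms by (auto simp: Suc_diff_Suc)
      also have "\<dots> = coface (n - 1) (coface (n - 1) F) ms"
        by (intro coface_cong L[symmetric]) (use n assms in auto)
      finally show ?thesis by (simp add: i n_def)
    qed
  qed
qed

text \<open>The cancellation behind \<open>b b = 0\<close>: the terms of the double sum cancel in pairs.\<close>

lemma double_sum_antisym_zero:
  fixes f :: "nat \<Rightarrow> nat \<Rightarrow> 'r::ab_group_add"
  assumes "\<And>i j. i < j \<Longrightarrow> j \<le> m \<Longrightarrow> f j i = - f i (j - 1)"
  shows "(\<Sum>j<Suc m. \<Sum>i<m. f j i) = 0"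
  using assms
proof (induction m)
  case (Suc m)
  have "(\<Sum>j<Suc (Suc m). \<Sum>i<Suc m. f j i)
      = (\<Sum>j<Suc m. \<Sum>i<m. f j i) + (\<Sum>j<Suc m. f j m) + (\<Sum>i<Suc m. f (Suc m) i)"
    by (simp add: sum.distrib)
  also have "(\<Sum>j<Suc m. \<Sum>i<m. f j i) = 0" by (rule Suc.IH) (use Suc.prems in auto)
  also have "(\<Sum>i<Suc m. f (Suc m) i) = (\<Sum>i<Suc m. - f i m)"
    by (rule sum.cong) (use Suc.prems[of _ "Suc m"] in auto)
  finally show ?case by (simp add: sum_negf)
qed simp

lemma cobar_short [simp]: "length ms \<le> 1 \<Longrightarrow> cobar F ms = 0"
  by (simp add: cobar_def)

lemma cohoch_short [simp]: "length ms \<le> 1 \<Longrightarrow> cohoch F ms = 0"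
  by (simp add: cohoch_def)

lemma cobar_cobar: "cobar (cobar F) ms = (0::'r::comm_ring_1)"
proof (cases "length ms \<ge> 3")
  case True
  then have m: "length ms = Suc (Suc (length ms - 2))" by simp
  define m where "m = length ms - 2"
  note m = m[folded m_def]
  have "coface j (cobar F) ms = coface j (\<lambda>u. \<Sum>i<m. coface i F u) ms" for j
    by (rule coface_cong) (use m in \<open>auto simp: cobar_def\<close>)
  then have "cobar (cobar F) ms = (\<Sum>j<Suc m. coface j (\<lambda>u. \<Sum>i<m. coface i F u) ms)"
    unfolding cobar_def[of "cobar F"] m by simp
  also have "\<dots> = (\<Sum>j<Suc m. \<Sum>i<m. coface j (coface i F) ms)"
    by (simp add: coface_linear)
  also have "\<dots> = 0"
    by (rule double_sum_antisym_zero, rule coface_coface) (use m True in auto)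
  finally show ?thesis .
next
  case False
  then show ?thesis by (auto simp: cobar_def[of "cobar F"] coface_def intro!: sum.neutral)
qed

lemma cohoch_cohoch: "cohoch (cohoch F) ms = (0::'r::comm_ring_1)"
proof (cases "length ms \<ge> 3")
  case True
  then obtain m where m: "length ms = Suc m" "m \<ge> 2" by (cases "length ms") auto
  have "coface j (cohoch F) ms = coface j (\<lambda>u. \<Sum>i<m. coface i F u) ms" for j
    by (rule coface_cong) (use m in \<open>auto simp: cohoch_def\<close>)
  then have "cohoch (cohoch F) ms = (\<Sum>j<Suc m. coface j (\<lambda>u. \<Sum>i<m. coface i F u) ms)"
    using m by (simp add: cohoch_def[of "cohoch F"])
  also have "\<dots> = (\<Sum>j<Suc m. \<Sum>i<m. coface j (coface i F) ms)"
    by (simp add: coface_linear)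
  also have "\<dots> = 0"
    by (rule double_sum_antisym_zero, rule coface_coface) (use m True in auto)
  finally show ?thesis .
next
  case False
  have "coface j (cohoch F) ms = coface j (\<lambda>_. 0) ms" if "length ms \<ge> 2" for j
    by (rule coface_cong) (use that False in auto)
  then show ?thesis by (simp add: cohoch_def[of "cohoch F"] coface_linear)
qed

text \<open>The relation \<open>b (1 - t) = (1 - t) b'\<close>: by \<open>coface_cocyc\<close> all rotated faces but
  one cancel.\<close>

lemma cobar_cocyc:
  assumes "ms \<noteq> []"
  shows "cobar (\<lambda>u. F u - cocyc F u) ms = cohoch F ms - cocyc (cohoch F) ms"
proof (cases "length ms \<ge> 2")
  case True
  then obtain n where n: "length ms = Suc n" "n \<ge> 1" by (cases "length ms") auto
  have "cocyc (cohoch F) ms = cocyc (\<lambda>u. \<Sum>i<Suc n. coface i F u) ms"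
    by (rule cocyc_cong) (use n in \<open>auto simp: cohoch_def\<close>)
  also have "\<dots> = (\<Sum>i<Suc n. cocyc (coface i F) ms)"
    by (rule cocyc_linear)
  also have "\<dots> = cocyc (coface 0 F) ms + (\<Sum>i<n. cocyc (coface (Suc i) F) ms)"
    by (rule sum.lessThan_Suc_shift)
  also have "\<dots> = coface n F ms + (\<Sum>i<n. coface i (cocyc F) ms)"
    using n by (simp add: coface_last coface_cocyc)
  finally show ?thesis using n
    by (simp add: cohoch_def cobar_def coface_linear sum_subtractf)
next
  case False
  then obtain m where "ms = [m]" using assms by (cases ms; cases "tl ms") auto
  then show ?thesis by (simp add: cobar_def cohoch_def cocyc_def)
qed

lemma cocyc_pow_cong:
  assumes "\<And>u. length u = length ms \<Longrightarrow> sum_list u = sum_list ms \<Longrightarrow> F u = G u" "ms \<noteq> []"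
  shows "(cocyc ^^ j) F ms = (cocyc ^^ j) G ms"
  using assms
proof (induction j arbitrary: ms)
  case (Suc j)
  show ?case unfolding funpow.simps o_def
    by (rule cocyc_cong, rule Suc.IH) (use Suc.prems in \<open>auto simp flip: length_greater_0_conv\<close>)
qed simp

lemma cocyc_pow_linear:
  "(cocyc ^^ j) (\<lambda>u. F u - G u) ms = (cocyc ^^ j) F ms - (cocyc ^^ j) G ms"
  "(cocyc ^^ j) (\<lambda>u. F u + G u) ms = (cocyc ^^ j) F ms + (cocyc ^^ j) G ms"
  "(cocyc ^^ j) (\<lambda>u. a * F u) ms = a * (cocyc ^^ j) F ms"
  "(cocyc ^^ j) (\<lambda>u. - F u) ms = - (cocyc ^^ j) F ms"
  "(cocyc ^^ j) (\<lambda>u. \<Sum>i\<in>I. f i u) ms = (\<Sum>i\<in>I. (cocyc ^^ j) (f i) ms)"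
  "(cocyc ^^ j) (\<lambda>u. 0) ms = (0::'r::comm_ring_1)"
  for F :: "nat list \<Rightarrow> 'r::comm_ring_1"
proof -
  have f1: "(cocyc ^^ j) (\<lambda>u. F u - G u) = (\<lambda>ms. (cocyc ^^ j) F ms - (cocyc ^^ j) G ms)"
    by (induction j) (auto simp: cocyc_linear_fun)
  have f2: "(cocyc ^^ j) (\<lambda>u. F u + G u) = (\<lambda>ms. (cocyc ^^ j) F ms + (cocyc ^^ j) G ms)"
    by (induction j) (auto simp: cocyc_linear_fun)
  have f3: "(cocyc ^^ j) (\<lambda>u. a * F u) = (\<lambda>ms. a * (cocyc ^^ j) F ms)"
    by (induction j) (auto simp: cocyc_linear_fun)
  have f4: "(cocyc ^^ j) (\<lambda>u. - F u) = (\<lambda>ms. - (cocyc ^^ j) F ms)"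
    by (induction j) (auto simp: cocyc_linear_fun)
  have f5: "(cocyc ^^ j) (\<lambda>u. \<Sum>i\<in>I. f i u) = (\<lambda>ms. \<Sum>i\<in>I. (cocyc ^^ j) (f i) ms)"
    by (induction j) (auto simp: cocyc_linear_fun)
  have f6: "(cocyc ^^ j) (\<lambda>u. 0) = (\<lambda>ms. 0::'r)"
    by (induction j) (auto simp: cocyc_linear_fun)
  show "(cocyc ^^ j) (\<lambda>u. F u - G u) ms = (cocyc ^^ j) F ms - (cocyc ^^ j) G ms"
    "(cocyc ^^ j) (\<lambda>u. F u + G u) ms = (cocyc ^^ j) F ms + (cocyc ^^ j) G ms"
    "(cocyc ^^ j) (\<lambda>u. a * F u) ms = a * (cocyc ^^ j) F ms"
    "(cocyc ^^ j) (\<lambda>u. - F u) ms = - (cocyc ^^ j) F ms"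
    "(cocyc ^^ j) (\<lambda>u. \<Sum>i\<in>I. f i u) ms = (\<Sum>i\<in>I. (cocyc ^^ j) (f i) ms)"
    "(cocyc ^^ j) (\<lambda>u. 0) ms = (0::'r)"
    by (simp_all add: f1 f2 f3 f4 f5 f6)
qed

text \<open>With \<open>M\<close> the sum of all exponents, \<open>m (M - m)\<close> has the parity of \<open>m (M + 1)\<close>. So each rotated
  exponent contributes a sign that depends only on itself, the length and \<open>M\<close>, and the signs of an
  iterated rotation simply multiply.\<close>

lemma cocyc_pow_append:
  "(cocyc ^^ length v) F (u @ v) =
     (\<Prod>x\<leftarrow>v. (-1) ^ (length (u @ v) - 1 + x * Suc (sum_list (u @ v)))) * F (v @ u)"
proof (induction v arbitrary: u rule: rev_induct)
  case (snoc x v)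
  have "(cocyc ^^ length (v @ [x])) F (u @ v @ [x]) = cocyc ((cocyc ^^ length v) F) ((u @ v) @ [x])"
    by simp
  also have "\<dots> = (-1) ^ (length (u @ v) + x * sum_list (u @ v)) * (cocyc ^^ length v) F ((x # u) @ v)"
    unfolding cocyc_snoc by simp
  also have "(-1 :: 'a) ^ (length (u @ v) + x * sum_list (u @ v)) =
       (-1) ^ (length (u @ v @ [x]) - 1 + x * Suc (sum_list (u @ v @ [x])))"
    by (rule minus_one_power_cong) auto
  finally show ?case unfolding snoc.IH by (simp add: mult_ac add_ac)
qed simp

text \<open>A full rotation has the sign with exponent \<open>n (n + 1) + M (M + 1)\<close>, which is even.\<close>

lemma cocyc_period:
  assumes "ms \<noteq> []"
  shows "(cocyc ^^ length ms) F ms = F ms"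
proof -
  have *: "(\<Prod>x\<leftarrow>v. (-1::'a) ^ (a + x * b)) = (-1) ^ (length v * a + sum_list v * b)" for v a b
    by (induction v) (auto simp: power_add power_mult algebra_simps)
  have "(cocyc ^^ length ms) F ms =
      (-1) ^ (length ms * (length ms - 1) + sum_list ms * Suc (sum_list ms)) * F ms"
    using cocyc_pow_append[of ms F "[]", unfolded *] by simp
  also have "even (length ms * (length ms - 1) + sum_list ms * Suc (sum_list ms))"
    using assms by auto
  then have "(-1 :: 'a) ^ (length ms * (length ms - 1) + sum_list ms * Suc (sum_list ms)) = 1"
    by (rule neg_one_even_power)
  finally show ?thesis by simp
qed

lemma conorm_cocyc:
  assumes "ms \<noteq> []"
  shows "conorm (\<lambda>u. F u - cocyc F u) ms = 0" "conorm F ms - cocyc (conorm F) ms = 0"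
proof -
  have "(\<Sum>j<length ms. (cocyc ^^ j) F ms - (cocyc ^^ Suc j) F ms) = 0"
    using sum_lessThan_telescope'[of "\<lambda>j. (cocyc ^^ j) F ms" "length ms"] cocyc_period[OF assms, of F]
    by simp
  moreover have "(cocyc ^^ j) (\<lambda>u. F u - cocyc F u) ms = (cocyc ^^ j) F ms - (cocyc ^^ Suc j) F ms" for j
    by (simp add: cocyc_pow_linear funpow_swap1)
  moreover have "cocyc (conorm F) ms = (\<Sum>j<length ms. (cocyc ^^ Suc j) F ms)"
  proof -
    have "cocyc (conorm F) ms = cocyc (\<lambda>u. \<Sum>j<length ms. (cocyc ^^ j) F u) ms"
      by (rule cocyc_cong) (use assms in \<open>auto simp: conorm_def\<close>)
    then show ?thesis by (simp add: cocyc_linear)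
  qed
  ultimately show "conorm (\<lambda>u. F u - cocyc F u) ms = 0" "conorm F ms - cocyc (conorm F) ms = 0"
    by (simp_all add: conorm_def sum_subtractf)
qed

lemma cocyc_pow_coface:
  assumes "length ms = Suc n" "n \<ge> 1" "j \<le> i" "i \<le> n"
  shows "(cocyc ^^ j) (coface i F) ms = coface (i - j) ((cocyc ^^ j) F) ms"
  using assms
proof (induction j arbitrary: ms)
  case (Suc j)
  have "(cocyc ^^ Suc j) (coface i F) ms = cocyc (coface (i - j) ((cocyc ^^ j) F)) ms"
    by (simp, rule cocyc_cong, rule Suc.IH) (use Suc.prems in auto)
  also have "\<dots> = coface (i - Suc j) (cocyc ((cocyc ^^ j) F)) ms"
    using coface_cocyc[of "i - Suc j" ms "(cocyc ^^ j) F"] Suc.prems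
    by (auto simp add: Suc_diff_Suc)
  finally show ?case by simp
qed simp

lemma cocyc_pow_coface':
  assumes "length ms = Suc n" "n \<ge> 1" "i < j" "j \<le> n"
  shows "(cocyc ^^ j) (coface i F) ms = coface (n + 1 + i - j) ((cocyc ^^ (j - 1)) F) ms"
proof -
  define k where "k = j - Suc i"
  have j: "j = k + Suc i" using assms by (simp add: k_def)
  have "(cocyc ^^ j) (coface i F) ms = (cocyc ^^ k) (cocyc ((cocyc ^^ i) (coface i F))) ms"
    unfolding j funpow_add by simp
  also have "\<dots> = (cocyc ^^ k) (coface n ((cocyc ^^ i) F)) ms"
  proof (rule cocyc_pow_cong)
    fix u :: "nat list" assume u: "length u = length ms"
    have "cocyc ((cocyc ^^ i) (coface i F)) u = cocyc (coface 0 ((cocyc ^^ i) F)) u"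
      by (rule cocyc_cong) (use u assms cocyc_pow_coface[of _ n i i F] in auto)
    then show "cocyc ((cocyc ^^ i) (coface i F)) u = coface n ((cocyc ^^ i) F) u"
      using u assms by (simp add: coface_last)
  qed (use assms in auto)
  also have "\<dots> = coface (n - k) ((cocyc ^^ k) ((cocyc ^^ i) F)) ms"
    by (rule cocyc_pow_coface) (use assms j in auto)
  finally show ?thesis using assms by (simp add: j funpow_add)
qed

text \<open>The relation \<open>b' N = N b\<close>. By the two lemmas above each \<open>d\<^sub>i t\<^sup>j\<close> is some \<open>t\<^sup>k d\<^sub>l\<close>, and every pair
  \<open>(k, l)\<close> occurs exactly once.\<close>

lemma conorm_cohoch:
  assumes "ms \<noteq> []"
  shows "cohoch (conorm F) ms = conorm (cobar F) ms"
proof (cases "length ms \<ge> 2")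
  case True
  then obtain n where n: "length ms = Suc n" "n \<ge> 1" by (cases "length ms") auto
  have "coface l (conorm F) ms = coface l (\<lambda>u. \<Sum>k<n. (cocyc ^^ k) F u) ms" for l
    by (rule coface_cong) (use n in \<open>auto simp: conorm_def\<close>)
  then have "cohoch (conorm F) ms = (\<Sum>l<Suc n. coface l (\<lambda>u. \<Sum>k<n. (cocyc ^^ k) F u) ms)"
    using n by (simp add: cohoch_def)
  also have "\<dots> = (\<Sum>(l, k)\<in>{..<Suc n} \<times> {..<n}. coface l ((cocyc ^^ k) F) ms)"
    by (simp add: coface_linear sum.cartesian_product)
  also have "\<dots> = (\<Sum>(j, i)\<in>{..<Suc n} \<times> {..<n}. (cocyc ^^ j) (coface i F) ms)"
  proof (rule sum.reindex_bij_witness[where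
      i = "\<lambda>(j, i). if j \<le> i then (i - j, j) else (n + 1 + i - j, j - 1)" and
      j = "\<lambda>(l, k). if k + l < n then (k, k + l) else (k + 1, l + k - n)"])
    fix a assume "a \<in> {..<Suc n} \<times> {..<n}"
    then show "(case case a of (l, k) \<Rightarrow> if k + l < n then (k, k + l) else (k + 1, l + k - n) of
          (j, i) \<Rightarrow> (cocyc ^^ j) (coface i F) ms) = (case a of (l, k) \<Rightarrow> coface l ((cocyc ^^ k) F) ms)"
      using n by (auto simp: cocyc_pow_coface[of ms n] cocyc_pow_coface'[of ms n] simp del: funpow.simps split: prod.splits)
  qed (auto split: if_splits)
  also have "\<dots> = (\<Sum>j<Suc n. (cocyc ^^ j) (\<lambda>u. \<Sum>i<n. coface i F u) ms)"
    by (simp add: cocyc_pow_linear sum.cartesian_product)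
  also have "\<dots> = conorm (cobar F) ms"
    unfolding conorm_def n
    by (intro sum.cong refl cocyc_pow_cong) (use n in \<open>auto simp: cobar_def\<close>)
  finally show ?thesis .
next
  case False
  then obtain m where "ms = [m]" using assms by (cases ms; cases "tl ms") auto
  then show ?thesis by (simp add: cobar_def cohoch_def conorm_def)
qed

lemma codiff_Nil [simp]: "codiff q F [] = 0"
  by (simp add: codiff_def)

lemma codiff_Cons:
  "codiff q F (a # w) =
     (if odd a then q * F ((a - 1) # w) else 0) + (-1) ^ a * codiff q (\<lambda>u. F (a # u)) w"
  unfolding codiff_def by (simp add: sum.lessThan_Suc_shift sum_distrib_left power_add mult.assoc del: sum.lessThan_Suc cong: if_cong)

lemma codiff_snoc:
  "codiff q F (w @ [a]) =
     codiff q (\<lambda>u. F (u @ [a])) w + (-1) ^ sum_list w * (if odd a then q * F (w @ [a - 1]) else 0)"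
proof -
  have "codiff q F (w @ [a]) = (\<Sum>i<length w. (-1) ^ sum_list (take i (w @ [a])) *
     (if odd ((w @ [a]) ! i) then q * F ((w @ [a])[i := (w @ [a]) ! i - 1]) else 0)) +
     (-1) ^ sum_list w * (if odd a then q * F (w @ [a - 1]) else 0)"
    by (simp add: codiff_def)
  also have "(\<Sum>i<length w. (-1) ^ sum_list (take i (w @ [a])) *
     (if odd ((w @ [a]) ! i) then q * F ((w @ [a])[i := (w @ [a]) ! i - 1]) else 0)) =
     codiff q (\<lambda>u. F (u @ [a])) w"
    unfolding codiff_def by (rule sum.cong) (auto simp: nth_append list_update_append)
  finally show ?thesis .
qed

lemma codiff_cong:
  assumes "\<And>u. length u = length ms \<Longrightarrow> Suc (sum_list u) = sum_list ms \<Longrightarrow> F u = G u"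
  shows "codiff q F ms = codiff q G ms"
  using assms
proof (induction ms arbitrary: F G)
  case (Cons a w)
  have "codiff q (\<lambda>u. F (a # u)) w = codiff q (\<lambda>u. G (a # u)) w"
    by (rule Cons.IH) (use Cons.prems in auto)
  moreover have "odd a \<Longrightarrow> F ((a - 1) # w) = G ((a - 1) # w)"
    using Cons.prems[of "(a - 1) # w"] by (auto elim: oddE)
  ultimately show ?case by (simp add: codiff_Cons)
qed simp

lemma codiff_linear:
  "codiff q (\<lambda>u. F u + G u) ms = codiff q F ms + codiff q G ms"
  "codiff q (\<lambda>u. F u - G u) ms = codiff q F ms - codiff q G ms"
  "codiff q (\<lambda>u. a * F u) ms = a * codiff q F ms"
  "codiff q (\<lambda>u. - F u) ms = - codiff q F ms"
  "codiff q (\<lambda>u. 0) ms = (0::'r::comm_ring_1)"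
  "codiff q (\<lambda>u. \<Sum>i\<in>I. f i u) ms = (\<Sum>i\<in>I. codiff q (f i) ms)"
  for F :: "nat list \<Rightarrow> 'r::comm_ring_1"
proof -
  show add: "codiff q (\<lambda>u. F u + G u) ms = codiff q F ms + codiff q G ms" for F G :: "nat list \<Rightarrow> 'r::comm_ring_1"
    unfolding codiff_def sum.distrib[symmetric] by (rule sum.cong) (auto simp: algebra_simps)
  show mult: "codiff q (\<lambda>u. a * F u) ms = a * codiff q F ms" for a and F :: "nat list \<Rightarrow> 'r::comm_ring_1"
    unfolding codiff_def sum_distrib_left by (rule sum.cong) (auto simp: algebra_simps)
  show neg: "codiff q (\<lambda>u. - F u) ms = - codiff q F ms" for F :: "nat list \<Rightarrow> 'r::comm_ring_1"
    using mult[of "-1" F] by simp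
  show "codiff q (\<lambda>u. F u - G u) ms = codiff q F ms - codiff q G ms"
    using add[of F "\<lambda>u. - G u"] neg[of G] by simp
  show 0: "codiff q (\<lambda>u. 0) ms = (0::'r::comm_ring_1)"
    unfolding codiff_def by (rule sum.neutral) auto
  show "codiff q (\<lambda>u. \<Sum>i\<in>I. f i u) ms = (\<Sum>i\<in>I. codiff q (f i) ms)"
    by (induction I rule: infinite_finite_induct) (simp_all add: 0 add)
qed

lemma codiff_codiff: "codiff q (codiff q F) ms = 0"
proof (induction ms arbitrary: F)
  case (Cons a w)
  have "codiff q (\<lambda>u. codiff q F (a # u)) w =
      (if odd a then q * codiff q (\<lambda>u. F ((a - 1) # u)) w else 0)"
    by (auto simp: codiff_Cons codiff_linear Cons.IH)
  then show ?case
    unfolding codiff_Cons[of q "codiff q F"] by (auto simp: codiff_Cons elim!: oddE)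
qed simp

text \<open>The graded Leibniz rule for a single product; if both exponents are odd, its two terms cancel.\<close>

lemma codiff_merge:
  "Suc i < length ms \<Longrightarrow> codiff q F (merge i ms) = codiff q (\<lambda>u. F (merge i u)) ms"
proof (induction i arbitrary: ms F)
  case 0
  then obtain a b w where ms: "ms = a # b # w"
    by (cases ms rule: remdups_adj.cases) auto
  show ?case
    by (auto simp: ms codiff_Cons power_add mult.assoc elim!: oddE evenE)
next
  case (Suc i)
  then obtain a w where "ms = a # w" by (cases ms) auto
  with Suc show ?case by (simp add: codiff_Cons)
qed

lemma codiff_cocyc:
  assumes "ms \<noteq> []"
  shows "codiff q (cocyc F) ms = cocyc (codiff q F) ms"
proof -
  obtain w a where ms: "ms = w @ [a]" using assms by (metis rev_exhaust)
  have "codiff q (\<lambda>u. cocyc F (u @ [a])) w =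
      codiff q (\<lambda>u. (-1) ^ (length w + a * (sum_list w - 1)) * F (a # u)) w"
    unfolding cocyc_snoc by (rule codiff_cong) (metis diff_Suc_1)
  also have "\<dots> = (-1) ^ (length w + a * sum_list w) * ((-1) ^ a * codiff q (\<lambda>u. F (a # u)) w)"
  proof (cases "sum_list w = 0")
    case True
    then have "codiff q (\<lambda>u. F (a # u)) w = codiff q (\<lambda>u. 0) w" by (intro codiff_cong) (metis True nat.distinct(1))
    then show ?thesis by (simp add: codiff_linear)
  next
    case False
    then obtain s where s: "sum_list w = Suc s" by (cases "sum_list w") auto
    have e: "(-1 :: 'a) ^ (length w + a * s) = (-1) ^ (length w + a * Suc s) * (-1) ^ a"
      unfolding power_add[symmetric] by (rule minus_one_power_cong) auto
    show ?thesis by (simp only: codiff_linear s diff_Suc_1 e mult.assoc)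
  qed
  finally have *: "codiff q (\<lambda>u. cocyc F (u @ [a])) w =
     (-1) ^ (length w + a * sum_list w) * ((-1) ^ a * codiff q (\<lambda>u. F (a # u)) w)" .
  show ?thesis
  proof (cases "odd a")
    case True
    then obtain b where a: "a = Suc b" by (cases a) auto
    show ?thesis
      unfolding ms codiff_snoc * unfolding cocyc_snoc codiff_Cons using True
      by (simp add: a algebra_simps power_add)
  next
    case False
    then show ?thesis
      unfolding ms codiff_snoc * unfolding cocyc_snoc codiff_Cons by simp
  qed
qed

lemma codiff_coface:
  assumes "length ms \<ge> 2"
  shows "codiff q (coface i F) ms = coface i (codiff q F) ms"
proof (cases "Suc i < length ms")
  case True
  have "codiff q (coface i F) ms = codiff q (\<lambda>u. (-1) ^ i * F (merge i u)) ms"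
    by (rule codiff_cong) (use True in \<open>auto simp: coface_def\<close>)
  then show ?thesis using True by (simp add: codiff_linear coface_def codiff_merge)
next
  case False
  have "codiff q (coface i F) ms = codiff q (cocyc (\<lambda>u. F (merge 0 u))) ms"
    by (rule codiff_cong) (use False in \<open>auto simp: coface_def\<close>)
  also have "\<dots> = cocyc (codiff q (\<lambda>u. F (merge 0 u))) ms"
    using assms by (intro codiff_cocyc) auto
  also have "\<dots> = cocyc (\<lambda>u. codiff q F (merge 0 u)) ms"
    by (intro cocyc_cong codiff_merge[symmetric]) (use assms in auto)
  finally show ?thesis using False by (simp add: coface_def)
qed

lemma codiff_cobar: "codiff q (cobar F) ms = cobar (codiff q F) ms"
proof -
  have "codiff q (cobar F) ms = codiff q (\<lambda>u. \<Sum>i<length ms - 1. coface i F u) ms"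
    by (rule codiff_cong) (auto simp: cobar_def)
  then show ?thesis by (cases "length ms \<ge> 2") (auto simp: codiff_linear cobar_def codiff_coface)
qed

lemma codiff_cohoch: "codiff q (cohoch F) ms = cohoch (codiff q F) ms"
proof (cases "length ms \<ge> 2")
  case True
  have "codiff q (cohoch F) ms = codiff q (\<lambda>u. \<Sum>i<length ms. coface i F u) ms"
    by (rule codiff_cong) (use True in \<open>auto simp: cohoch_def\<close>)
  then show ?thesis using True by (auto simp: codiff_linear cohoch_def codiff_coface)
next
  case False
  have "codiff q (cohoch F) ms = codiff q (\<lambda>u. 0) ms"
    by (rule codiff_cong) (use False in \<open>auto simp: cohoch_def\<close>)
  then show ?thesis using False by (auto simp: codiff_linear cohoch_def)
qed

lemma codiff_cocyc_pow:
  assumes "ms \<noteq> []"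
  shows "codiff q ((cocyc ^^ j) F) ms = (cocyc ^^ j) (codiff q F) ms"
  using assms
proof (induction j arbitrary: ms)
  case (Suc j)
  show ?case using Suc.prems by (simp add: codiff_cocyc) 
     (rule cocyc_cong, rule Suc.IH; auto simp flip: length_greater_0_conv)
qed simp

lemma codiff_conorm:
  assumes "ms \<noteq> []"
  shows "codiff q (conorm F) ms = conorm (codiff q F) ms"
proof -
  have "codiff q (conorm F) ms = codiff q (\<lambda>u. \<Sum>i<length ms. (cocyc ^^ i) F u) ms"
    by (rule codiff_cong) (auto simp: conorm_def)
  then show ?thesis using assms by (auto simp: codiff_linear conorm_def codiff_cocyc_pow)
qed

section \<open>The transposed total differential\<close>

lemma cobar_cong:
  assumes "\<And>u. u \<noteq> [] \<Longrightarrow> Suc (length u) = length ms \<Longrightarrow> sum_list u = sum_list ms \<Longrightarrow> F u = G u"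
  shows "cobar F ms = cobar G ms"
proof (cases "length ms \<ge> 2")
  case True
  have "coface i F ms = coface i G ms" for i
    by (rule coface_cong) (use assms True in \<open>auto simp flip: length_greater_0_conv\<close>)
  then show ?thesis by (simp add: cobar_def)
qed auto

lemma cohoch_cong:
  assumes "\<And>u. u \<noteq> [] \<Longrightarrow> Suc (length u) = length ms \<Longrightarrow> sum_list u = sum_list ms \<Longrightarrow> F u = G u"
  shows "cohoch F ms = cohoch G ms"
proof (cases "length ms \<ge> 2")
  case True
  have "coface i F ms = coface i G ms" for i
    by (rule coface_cong) (use assms True in \<open>auto simp flip: length_greater_0_conv\<close>)
  then show ?thesis by (simp add: cohoch_def)
qed auto

lemma conorm_cong:
  assumes "\<And>u. length u = length ms \<Longrightarrow> sum_list u = sum_list ms \<Longrightarrow> F u = G u"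
  shows "conorm F ms = conorm G ms"
proof (cases "ms = []")
  case False
  have "(cocyc ^^ j) F ms = (cocyc ^^ j) G ms" for j
    by (rule cocyc_pow_cong) (use assms False in auto)
  then show ?thesis by (simp add: conorm_def)
qed (simp add: conorm_def)

lemma cobar_linear:
  "cobar (\<lambda>u. F u + G u) ms = cobar F ms + cobar G ms"
  "cobar (\<lambda>u. F u - G u) ms = cobar F ms - cobar G ms"
  "cobar (\<lambda>u. a * F u) ms = a * cobar F ms"
  "cobar (\<lambda>u. - F u) ms = - cobar F ms"
  "cobar (\<lambda>u. 0) ms = (0::'r::comm_ring_1)"
  "cobar (\<lambda>u. \<Sum>i\<in>I. f i u) ms = (\<Sum>i\<in>I. cobar (f i) ms)"
  for F :: "nat list \<Rightarrow> 'r::comm_ring_1"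
  unfolding cobar_def coface_linear
  by (auto simp: sum.distrib sum_subtractf sum_distrib_left sum_negf intro: sum.swap)

lemma cohoch_linear:
  "cohoch (\<lambda>u. F u + G u) ms = cohoch F ms + cohoch G ms"
  "cohoch (\<lambda>u. F u - G u) ms = cohoch F ms - cohoch G ms"
  "cohoch (\<lambda>u. a * F u) ms = a * cohoch F ms"
  "cohoch (\<lambda>u. - F u) ms = - cohoch F ms"
  "cohoch (\<lambda>u. 0) ms = (0::'r::comm_ring_1)"
  for F :: "nat list \<Rightarrow> 'r::comm_ring_1"
  unfolding cohoch_def coface_linear
  by (auto simp: sum.distrib sum_subtractf sum_distrib_left sum_negf)

lemma conorm_linear:
  "conorm (\<lambda>u. F u + G u) ms = conorm F ms + conorm G ms"
  "conorm (\<lambda>u. F u - G u) ms = conorm F ms - conorm G ms"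
  "conorm (\<lambda>u. a * F u) ms = a * conorm F ms"
  "conorm (\<lambda>u. - F u) ms = - conorm F ms"
  "conorm (\<lambda>u. 0) ms = (0::'r::comm_ring_1)"
  for F :: "nat list \<Rightarrow> 'r::comm_ring_1"
  unfolding conorm_def cocyc_pow_linear
  by (auto simp: sum.distrib sum_subtractf sum_distrib_left sum_negf)

definition cotot :: "'r::comm_ring_1 \<Rightarrow> (nat \<Rightarrow> nat list \<Rightarrow> 'r) \<Rightarrow> nat \<Rightarrow> nat list \<Rightarrow> 'r" where
  "cotot q \<phi> c ms =
     (if even c then cohoch (\<phi> c) ms else - cobar (\<phi> c) ms) +
     (if c = 0 then 0
      else if odd c then \<phi> (c - 1) ms - cocyc (\<phi> (c - 1)) ms else conorm (\<phi> (c - 1)) ms) +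
     (-1) ^ (c + (length ms - 1)) * codiff q (\<phi> c) ms"

lemma cotot_cong:
  assumes ms: "ms \<noteq> []"
    and same: "\<And>u. u \<noteq> [] \<Longrightarrow> Suc (length u) = length ms \<and> sum_list u = sum_list ms \<or>
        length u = length ms \<and> Suc (sum_list u) = sum_list ms \<Longrightarrow> \<phi> c u = \<phi>' c u"
    and previous: "\<And>u. c > 0 \<Longrightarrow> u \<noteq> [] \<Longrightarrow> length u = length ms \<Longrightarrow> sum_list u = sum_list ms \<Longrightarrow>
        \<phi> (c - 1) u = \<phi>' (c - 1) u"
  shows "cotot q \<phi> c ms = cotot q \<phi>' c ms"
proof -
  have ne: "u \<noteq> []" if "length u = length ms" for u :: "nat list"
    using that ms by auto
  have "cohoch (\<phi> c) ms = cohoch (\<phi>' c) ms"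
    by (rule cohoch_cong) (use same in auto)
  moreover have "cobar (\<phi> c) ms = cobar (\<phi>' c) ms"
    by (rule cobar_cong) (use same in auto)
  moreover have "codiff q (\<phi> c) ms = codiff q (\<phi>' c) ms"
    by (rule codiff_cong) (use same ne in blast)
  moreover have "conorm (\<phi> (c - 1)) ms = conorm (\<phi>' (c - 1)) ms" if "c > 0"
    by (rule conorm_cong) (use previous ne that in blast)
  moreover have "cocyc (\<phi> (c - 1)) ms = cocyc (\<phi>' (c - 1)) ms" if "c > 0"
    by (rule cocyc_cong) (use previous ne that ms in blast)+
  moreover have "\<phi> (c - 1) ms = \<phi>' (c - 1) ms" if "c > 0"
    by (rule previous) (use that ms in auto)
  ultimately show ?thesis by (cases "c = 0") (simp_all add: cotot_def)
qed

lemma cotot_zero: "cotot q (\<lambda>_ _. 0) c ms = 0"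
  by (simp add: cotot_def cohoch_linear cobar_linear conorm_linear cocyc_linear codiff_linear)

text \<open>The transpose of \<open>D D = 0\<close>. The internal differential commutes with all cyclic operators, so
  its sign \<open>(-1)\<^bsup>c+n\<^esup>\<close>, which changes whenever one of them is applied, makes the mixed terms cancel.\<close>

lemma cotot_cotot:
  assumes ms: "ms \<noteq> []"
  shows "cotot q (cotot q \<phi>) c ms = 0"
proof -
  define s :: 'a where "s = (-1) ^ (c + (length ms - 1))"
  define \<rho> where "\<rho> = (\<lambda>u. if c = 0 then 0 else if odd c then \<phi> (c - 1) u - cocyc (\<phi> (c - 1)) u
     else conorm (\<phi> (c - 1)) u)"
  have ss: "s * s = 1" by (simp add: s_def flip: power_add)
  have sgn: "(-1) ^ (c + (length u - 1)) = - s" if "u \<noteq> []" "Suc (length u) = length ms" for u :: "nat list"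
    using that unfolding s_def
    by (cases "length u") (auto simp flip: that(2))
  have cd: "codiff q (cotot q \<phi> c) ms = codiff q (\<lambda>u. (if even c then cohoch (\<phi> c) u else - cobar (\<phi> c) u) + \<rho> u) ms"
  proof -
    have "codiff q (cotot q \<phi> c) ms =
       codiff q (\<lambda>u. ((if even c then cohoch (\<phi> c) u else - cobar (\<phi> c) u) + \<rho> u) + s * codiff q (\<phi> c) u) ms"
      by (rule codiff_cong) (auto simp: cotot_def s_def \<rho>_def)
    then show ?thesis by (simp only: codiff_linear codiff_codiff mult_zero_right add_0_right)
  qed
  show ?thesis
  proof (cases "even c")
    case True
    have "cohoch (cotot q \<phi> c) ms = cohoch (\<lambda>u. cohoch (\<phi> c) u + \<rho> u + (- s) * codiff q (\<phi> c) u) ms"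
      by (rule cohoch_cong) (use True sgn in \<open>simp add: cotot_def \<rho>_def\<close>)
    then have 1: "cohoch (cotot q \<phi> c) ms = cohoch \<rho> ms - s * cohoch (codiff q (\<phi> c)) ms"
      by (simp only: cohoch_linear cohoch_cohoch) simp
    have 2: "codiff q (cotot q \<phi> c) ms = cohoch (codiff q (\<phi> c)) ms + codiff q \<rho> ms"
      unfolding cd using True by (simp add: codiff_linear codiff_cohoch)
    have 3: "conorm (cotot q \<phi> (c - 1)) ms =
        - cohoch (conorm (\<phi> (c - 1))) ms - s * codiff q (conorm (\<phi> (c - 1))) ms" if "c \<noteq> 0"
    proof -
      have "conorm (cotot q \<phi> (c - 1)) ms =
         conorm (\<lambda>u. - cobar (\<phi> (c - 1)) u + (\<phi> (c - 2) u - cocyc (\<phi> (c - 2)) u) + (- s) * codiff q (\<phi> (c - 1)) u) ms"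
      proof (rule conorm_cong)
        fix u :: "nat list" assume u: "length u = length ms"
        from that True obtain k where "c = Suc (Suc k)" "even k"
          by (cases c rule: nat.exhaust[case_names 0 Suc]) (auto elim!: oddE)
        then show "cotot q \<phi> (c - 1) u = - cobar (\<phi> (c - 1)) u +
            (\<phi> (c - 2) u - cocyc (\<phi> (c - 2)) u) + (- s) * codiff q (\<phi> (c - 1)) u"
          using u by (simp add: cotot_def s_def)
      qed
      then show ?thesis
        unfolding conorm_linear(1) conorm_linear(3) conorm_linear(4) conorm_cocyc(1)[OF ms]
        by (simp add: conorm_cohoch[OF ms] codiff_conorm[OF ms])
    qed
    have "cotot q (cotot q \<phi>) c ms = cohoch (cotot q \<phi> c) ms +
       (if c = 0 then 0 else conorm (cotot q \<phi> (c - 1)) ms) + s * codiff q (cotot q \<phi> c) ms"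
      using True by (simp add: cotot_def[of q "cotot q \<phi>"] s_def)
    then show ?thesis
      using 3 True by (auto simp: 1 2 \<rho>_def[abs_def] cohoch_linear codiff_linear algebra_simps)
  next
    case False
    have "cobar (cotot q \<phi> c) ms = cobar (\<lambda>u. - cobar (\<phi> c) u + \<rho> u + (- s) * codiff q (\<phi> c) u) ms"
      by (rule cobar_cong) (use False sgn in \<open>simp add: cotot_def \<rho>_def\<close>)
    then have 1: "cobar (cotot q \<phi> c) ms = cobar \<rho> ms - s * cobar (codiff q (\<phi> c)) ms"
      by (simp only: cobar_linear cobar_cobar) simp
    have 2: "codiff q (cotot q \<phi> c) ms = - cobar (codiff q (\<phi> c)) ms + codiff q \<rho> ms"
      unfolding cd using False by (simp add: codiff_linear codiff_cobar)
    have c: "c \<noteq> 0" using False by (metis even_zero)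
    define \<sigma> where "\<sigma> = (\<lambda>u. if c = 1 then 0 else conorm (\<phi> (c - 2)) u)"
    have \<sigma>: "cocyc \<sigma> ms = \<sigma> ms"
      using conorm_cocyc(2)[OF ms, of "\<phi> (c - 2)"] by (auto simp: \<sigma>_def[abs_def] cocyc_linear)
    have X: "cotot q \<phi> (c - 1) u = cohoch (\<phi> (c - 1)) u + \<sigma> u + (- s) * codiff q (\<phi> (c - 1)) u"
      if "length u = length ms" for u
    proof -
      from False obtain k where k: "c = Suc k" "even k" by (cases c) auto
      show ?thesis using that k by (cases k) (auto simp: cotot_def s_def \<sigma>_def)
    qed
    have 3: "cotot q \<phi> (c - 1) ms - cocyc (cotot q \<phi> (c - 1)) ms =
        (cohoch (\<phi> (c - 1)) ms - cocyc (cohoch (\<phi> (c - 1))) ms)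
        - s * (codiff q (\<phi> (c - 1)) ms - codiff q (cocyc (\<phi> (c - 1))) ms)"
    proof -
      have "cocyc (cotot q \<phi> (c - 1)) ms =
         cocyc (\<lambda>u. cohoch (\<phi> (c - 1)) u + \<sigma> u + (- s) * codiff q (\<phi> (c - 1)) u) ms"
        by (rule cocyc_cong) (use ms X in auto)
      then show ?thesis
        unfolding cocyc_linear \<sigma> X[OF refl] by (simp add: codiff_cocyc[OF ms] algebra_simps)
    qed
    have "cotot q (cotot q \<phi>) c ms = - cobar (cotot q \<phi> c) ms +
       (cotot q \<phi> (c - 1) ms - cocyc (cotot q \<phi> (c - 1)) ms) + s * codiff q (cotot q \<phi> c) ms"
      using False c by (simp add: cotot_def[of q "cotot q \<phi>"] s_def)
    moreover have "\<rho> = (\<lambda>u. \<phi> (c - 1) u - cocyc (\<phi> (c - 1)) u)"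
      using False c by (auto simp: \<rho>_def)
    ultimately show ?thesis
      unfolding 1 2 3 by (simp add: cobar_cocyc[OF ms] codiff_linear algebra_simps)
  qed
qed

section \<open>A contraction of the Hochschild complex of a tensor algebra\<close>

text \<open>Multiplication of the first tensor factor by \<open>x\<^sup>r\<close>.\<close>

definition add_head :: "nat \<Rightarrow> nat list \<Rightarrow> nat list" where
  "add_head r v = (hd v + r) # tl v"

lemma add_head_Cons [simp]: "add_head r (a # v) = (a + r) # v"
  by (simp add: add_head_def)

lemma add_head_add: "v \<noteq> [] \<Longrightarrow> add_head r (add_head s v) = add_head (s + r) v"
  by (cases v) (auto simp: add.assoc)

lemma length_add_head [simp]: "v \<noteq> [] \<Longrightarrow> length (add_head r v) = length v"
  by (cases v) auto

lemma sum_list_add_head [simp]: "v \<noteq> [] \<Longrightarrow> sum_list (add_head r v) = sum_list v + r"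
  by (cases v) auto

lemma add_head_append [simp]: "v \<noteq> [] \<Longrightarrow> add_head r (v @ u) = add_head r v @ u"
  by (cases v) auto

lemma add_head_not_Nil [simp]: "add_head r v \<noteq> []"
  by (simp add: add_head_def)

lemma add_head_0 [simp]: "v \<noteq> [] \<Longrightarrow> add_head 0 v = v"
  by (cases v) auto

lemma merge_add_head: "Suc i < length v \<Longrightarrow> merge i (add_head r v) = add_head r (merge i v)"
  by (cases v rule: remdups_adj.cases; cases i) auto

lemma cobar_add_head: "v \<noteq> [] \<Longrightarrow> cobar (\<lambda>u. F (add_head r u)) v = cobar F (add_head r v)"
  by (auto simp: cobar_def coface_def merge_add_head intro!: sum.cong)

text \<open>The transpose of the contraction given by the universal derivation of a tensor algebra: the last
  factor \<open>x\<^sup>m\<close> is split as \<open>x\<^sup>k x x\<^sup>r\<close> in all possible ways, and \<open>x\<^sup>r\<close> is moved around to the front. The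
  final summand deals with degenerate tensors, since the complex is not normalized.\<close>

definition cohom :: "(nat list \<Rightarrow> 'r::comm_ring_1) \<Rightarrow> nat list \<Rightarrow> 'r" where
  "cohom F w =
     (let v = butlast w; m = last w; \<epsilon> = (-1) ^ Suc (sum_list w) in
      if length w \<le> 1 then 0
      else (-1) ^ length v *
        ((\<Sum>r<m. \<epsilon> ^ r * F (add_head r v @ [m - 1 - r, 1])) - \<epsilon> ^ m * F (add_head m v @ [0, 0])))"

lemma cohom_snoc:
  "v \<noteq> [] \<Longrightarrow> cohom F (v @ [m]) = (-1) ^ length v *
        ((\<Sum>r<m. ((-1) ^ Suc (sum_list v + m)) ^ r * F (add_head r v @ [m - 1 - r, 1]))
          - ((-1) ^ Suc (sum_list v + m)) ^ m * F (add_head m v @ [0, 0]))"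
  by (simp add: cohom_def Let_def)

lemma cobar_snoc:
  assumes "v \<noteq> []"
  shows "cobar F (v @ [m]) =
     cobar (\<lambda>u. F (u @ [m])) v + (-1) ^ (length v - 1) * F (butlast v @ [last v + m])"
proof -
  obtain u l where v: "v = u @ [l]" using assms by (metis rev_exhaust)
  have "cobar (\<lambda>u. F (u @ [m])) v = (\<Sum>i<length u. coface i F (v @ [m]))"
    unfolding cobar_def by (rule sum.cong) (auto simp: v coface_def merge_snoc[of _ "u @ [l]" "[m]", simplified])
  moreover have "coface (length u) F (v @ [m]) = (-1) ^ length u * F (u @ [l + m])"
    by (simp add: v coface_def merge_def nth_append)
  ultimately show ?thesis by (simp add: cobar_def v)
qed

lemma cohoch_snoc:
  assumes "v \<noteq> []"
  shows "cohoch F (v @ [m]) =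
     cobar (\<lambda>u. F (u @ [m])) v + (-1) ^ (length v - 1) * F (butlast v @ [last v + m]) +
     (-1) ^ (length v + m * sum_list v) * F (add_head m v)"
proof -
  obtain a u where v: "v = a # u" using assms by (cases v) auto
  have "cohoch F (v @ [m]) = cobar F (v @ [m]) + coface (length v) F (v @ [m])"
    using assms by (simp add: cohoch_def cobar_def)
  also have "coface (length v) F (v @ [m]) = (-1) ^ (length v + m * sum_list v) * F (add_head m v)"
    unfolding coface_def cocyc_snoc by (simp add: v add.commute)
  finally show ?thesis using assms by (simp add: cobar_snoc)
qed

text \<open>The two outermost faces of \<open>b h\<close> telescope over the splittings of the last factor, and of these
  only the original tensor survives. The faces that do not touch the split factor, and the one
  that merges it with its neighbour, remain.\<close>

lemma cohom_cohoch:
  fixes F :: "nat list \<Rightarrow> 'r::comm_ring_1"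
  assumes v: "v \<noteq> []" and \<epsilon>: "\<epsilon> = (-1) ^ Suc (sum_list v + m)"
  shows "cohom (cohoch F) (v @ [m]) = F (v @ [m])
     + (-1) ^ length v * ((\<Sum>r<m. \<epsilon> ^ r * cobar (\<lambda>u. F (add_head r u @ [m - 1 - r, 1])) v)
          - \<epsilon> ^ m * cobar (\<lambda>u. F (add_head m u @ [0, 0])) v)
     - (\<Sum>r<m. \<epsilon> ^ r * F (butlast (add_head r v) @ [last (add_head r v) + (m - 1 - r), 1]))"
proof -
  define s :: 'r where "s = (-1) ^ length v"
  have ss: "s * s = 1" by (simp add: s_def flip: power_add)
  have s1: "(-1 :: 'r) ^ (length v - 1) = - s" using v by (cases v) (auto simp: s_def)
  have B: "cohoch F (add_head r v @ [m - 1 - r, 1]) =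
      cobar (\<lambda>u. F (add_head r u @ [m - 1 - r, 1])) v
      - s * F (butlast (add_head r v) @ [last (add_head r v) + (m - 1 - r), 1])
      + s * (F (add_head r v @ [m - r]) - \<epsilon> * F (add_head (Suc r) v @ [m - Suc r]))"
    if "r < m" for r
  proof -
    have e: "(-1 :: 'r) ^ (length v + 1 + 1 * (sum_list v + r + (m - 1 - r))) = - (s * \<epsilon>)"
      using that by (simp add: s_def \<epsilon> power_add)
    have "cohoch F ((add_head r v @ [m - 1 - r]) @ [1]) =
        cobar (\<lambda>u. F (u @ [1])) (add_head r v @ [m - 1 - r]) + s * F (add_head r v @ [m - 1 - r + 1])
        + (-1) ^ (length v + 1 + 1 * (sum_list v + r + (m - 1 - r))) * F (add_head 1 (add_head r v @ [m - 1 - r]))"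
      using v by (subst cohoch_snoc) (simp_all add: s_def)
    also have "cobar (\<lambda>u. F (u @ [1])) (add_head r v @ [m - 1 - r]) =
       cobar (\<lambda>u. F (add_head r u @ [m - 1 - r, 1])) v
      - s * F (butlast (add_head r v) @ [last (add_head r v) + (m - 1 - r), 1])"
      using v s1 by (subst cobar_snoc) (simp_all add: cobar_add_head[of v "\<lambda>u. F (u @ [m - 1 - r, 1])" r, simplified])
    finally show ?thesis
      unfolding e using that v by (simp add: add_head_add Suc_diff_Suc algebra_simps)
  qed
  have B': "cohoch F (add_head m v @ [0, 0]) =
      cobar (\<lambda>u. F (add_head m u @ [0, 0])) v - s * F (add_head m v @ [0])"
  proof -
    have "cohoch F ((add_head m v @ [0]) @ [0]) = cobar (\<lambda>u. F (u @ [0])) (add_head m v @ [0])"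
      using v by (subst cohoch_snoc) (simp_all add: s_def)
    also have "\<dots> = cobar (\<lambda>u. F (add_head m u @ [0, 0])) v - s * F (add_head m v @ [0])"
      using v s1 by (subst cobar_snoc) (simp_all add: cobar_add_head[of v "\<lambda>u. F (u @ [0, 0])" m])
    finally show ?thesis by simp
  qed
  \<comment> \<open>The wrapping face of the splitting \<open>r\<close> is the merge of the last two factors of the splitting \<open>r + 1\<close>.\<close>
  have tel: "(\<Sum>r<m. \<epsilon> ^ r * (F (add_head r v @ [m - r]) - \<epsilon> * F (add_head (Suc r) v @ [m - Suc r])))
     = F (v @ [m]) - \<epsilon> ^ m * F (add_head m v @ [0])"
    using sum_lessThan_telescope'[of "\<lambda>r. \<epsilon> ^ r * F (add_head r v @ [m - r])" m] v
    by (simp add: algebra_simps)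
  have "cohom (cohoch F) (v @ [m]) =
     s * ((\<Sum>r<m. \<epsilon> ^ r * cohoch F (add_head r v @ [m - 1 - r, 1])) - \<epsilon> ^ m * cohoch F (add_head m v @ [0, 0]))"
    using v by (simp add: cohom_snoc \<epsilon> s_def)
  also have "(\<Sum>r<m. \<epsilon> ^ r * cohoch F (add_head r v @ [m - 1 - r, 1])) =
     (\<Sum>r<m. \<epsilon> ^ r * cobar (\<lambda>u. F (add_head r u @ [m - 1 - r, 1])) v)
     - s * (\<Sum>r<m. \<epsilon> ^ r * F (butlast (add_head r v) @ [last (add_head r v) + (m - 1 - r), 1]))
     + s * (\<Sum>r<m. \<epsilon> ^ r * (F (add_head r v @ [m - r]) - \<epsilon> * F (add_head (Suc r) v @ [m - Suc r])))"
    unfolding sum_distrib_left sum.distrib[symmetric] sum_subtractf[symmetric]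
    by (rule sum.cong[OF refl], subst B) (auto simp: algebra_simps)
  finally show ?thesis
    unfolding B' tel s_def[symmetric] using ss by (simp add: algebra_simps flip: mult.assoc)
qed

lemma sum_lessThan_add:
  fixes f :: "nat \<Rightarrow> 'b::comm_monoid_add"
  shows "(\<Sum>r<m + l. f r) = (\<Sum>r<m. f r) + (\<Sum>r<l. f (m + r))"
  by (induction l) (auto simp: add.assoc)

text \<open>\<open>b h + h b = 1\<close> on tensors of at least three factors: the terms left over by
  \<open>cohom_cohoch\<close> are cancelled by \<open>h b\<close>, once a splitting of a product \<open>x\<^sup>l x\<^sup>m\<close> is sorted by the factor
  in which it takes place.\<close>

lemma cohom_homotopy:
  fixes F :: "nat list \<Rightarrow> 'r::comm_ring_1"
  assumes "length w \<ge> 3"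
  shows "cohom (cohoch F) w + cohoch (cohom F) w = F w"
proof -
  obtain v' l m where w: "w = (v' @ [l]) @ [m]" and v': "v' \<noteq> []"
  proof -
    obtain v m where 1: "w = v @ [m]" using assms by (cases w rule: rev_cases) auto
    then obtain v' l where 2: "v = v' @ [l]" using assms by (cases v rule: rev_cases) auto
    show thesis by (rule that[of v' l m]) (use 1 2 assms in auto)
  qed
  define v where "v = v' @ [l]"
  define \<epsilon> :: 'r where "\<epsilon> = (-1) ^ Suc (sum_list v + m)"
  define s :: 'r where "s = (-1) ^ length v"
  have ss: "s * s = 1" by (simp add: s_def flip: power_add)
  have v: "v \<noteq> []" by (simp add: v_def)
  have s1: "(-1 :: 'r) ^ (length v - 1) = - s" using v by (cases v) (auto simp: s_def)
  have s2: "(-1 :: 'r) ^ length v' = - s" by (simp add: s_def v_def)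
  have sum_v: "sum_list v = sum_list v' + l" by (simp add: v_def)
  define h where "h = (\<lambda>r. F (add_head r v' @ [l + m - 1 - r, 1]))"
  have 1: "cohom (cohoch F) w = F w
     + s * ((\<Sum>r<m. \<epsilon> ^ r * cobar (\<lambda>u. F (add_head r u @ [m - 1 - r, 1])) v)
          - \<epsilon> ^ m * cobar (\<lambda>u. F (add_head m u @ [0, 0])) v)
     - (\<Sum>r<m. \<epsilon> ^ r * h r)"
  proof -
    have "(\<Sum>r<m. \<epsilon> ^ r * F (butlast (add_head r v) @ [last (add_head r v) + (m - 1 - r), 1])) =
       (\<Sum>r<m. \<epsilon> ^ r * h r)"
      by (rule sum.cong) (auto simp: v_def v' h_def butlast_append)
    then show ?thesis
      using cohom_cohoch[OF v \<epsilon>_def, of F] by (simp add: w v_def s_def)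
  qed
  have "cobar (\<lambda>u. cohom F (u @ [m])) v =
      cobar (\<lambda>u. - s * ((\<Sum>r<m. \<epsilon> ^ r * F (add_head r u @ [m - 1 - r, 1]))
          - \<epsilon> ^ m * F (add_head m u @ [0, 0]))) v"
  proof (rule cobar_cong)
    fix u :: "nat list" assume u: "u \<noteq> []" "Suc (length u) = length v" "sum_list u = sum_list v"
    have "(-1 :: 'r) ^ length u = - s" unfolding s_def u(2)[symmetric] by simp
    then show "cohom F (u @ [m]) = - s * ((\<Sum>r<m. \<epsilon> ^ r * F (add_head r u @ [m - 1 - r, 1]))
          - \<epsilon> ^ m * F (add_head m u @ [0, 0]))"
      unfolding cohom_snoc[OF u(1)] u(3) \<epsilon>_def by simp
  qed
  then have 2: "cobar (\<lambda>u. cohom F (u @ [m])) v =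
      - s * ((\<Sum>r<m. \<epsilon> ^ r * cobar (\<lambda>u. F (add_head r u @ [m - 1 - r, 1])) v)
          - \<epsilon> ^ m * cobar (\<lambda>u. F (add_head m u @ [0, 0])) v)"
    by (simp only: cobar_linear)
  have 3: "cohom F (v' @ [l + m]) =
      - s * ((\<Sum>r<m + l. \<epsilon> ^ r * h r) - \<epsilon> ^ (m + l) * F (add_head (m + l) v' @ [0, 0]))"
    unfolding cohom_snoc[OF v'] s2 by (simp add: \<epsilon>_def sum_v h_def add_ac)
  have 4: "cohom F (add_head m v' @ [l]) =
      - s * ((\<Sum>r<l. \<epsilon> ^ r * h (m + r)) - \<epsilon> ^ l * F (add_head (m + l) v' @ [0, 0]))"
    using v' s2 by (simp add: cohom_snoc \<epsilon>_def sum_v h_def add_head_add add_ac)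
  have 5: "(-1) ^ (length v + m * sum_list v) = s * \<epsilon> ^ m"
    unfolding s_def \<epsilon>_def power_mult[symmetric] power_add[symmetric] by (rule minus_one_power_cong) auto
  have "cohoch (cohom F) w = cobar (\<lambda>u. cohom F (u @ [m])) v - s * cohom F (v' @ [l + m])
     + s * \<epsilon> ^ m * cohom F (add_head m v' @ [l])"
    unfolding w v_def[symmetric] cohoch_snoc[OF v] 5 s1 using v' by (simp add: v_def)
  also have "\<dots> = - s * ((\<Sum>r<m. \<epsilon> ^ r * cobar (\<lambda>u. F (add_head r u @ [m - 1 - r, 1])) v)
          - \<epsilon> ^ m * cobar (\<lambda>u. F (add_head m u @ [0, 0])) v) + (\<Sum>r<m. \<epsilon> ^ r * h r)"
  proof -
    have "(\<Sum>r<m + l. \<epsilon> ^ r * h r) = (\<Sum>r<m. \<epsilon> ^ r * h r) + \<epsilon> ^ m * (\<Sum>r<l. \<epsilon> ^ r * h (m + r))"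
      unfolding sum_lessThan_add by (simp add: power_add sum_distrib_left mult.assoc)
    then have "- s * cohom F (v' @ [l + m]) + s * \<epsilon> ^ m * cohom F (add_head m v' @ [l])
       = (s * s) * (\<Sum>r<m. \<epsilon> ^ r * h r)"
      unfolding 3 4 by (simp add: power_add algebra_simps)
    then show ?thesis unfolding 2 ss by (simp add: algebra_simps)
  qed
  finally show ?thesis unfolding 1 by simp
qed

text \<open>Modulo graded commutators, \<open>x\<^sup>a d(x\<^sup>b)\<close> is this multiple of \<open>x\<^bsup>a+b-1\<^esup> dx\<close>: if \<open>a + b\<close> is odd, moving
  factors around costs no sign; otherwise the \<open>b\<close> terms alternate in sign.\<close>

definition diff_coeff :: "nat \<Rightarrow> nat \<Rightarrow> 'r::comm_ring_1" where
  "diff_coeff a b = (if odd (a + b) then of_nat b else if odd b then 1 else 0)"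

text \<open>On two factors \<open>h b\<close> vanishes, and \<open>1 - b h\<close> is the projection that rewrites every
  differential form as a multiple of \<open>x\<^bsup>n-1\<^esup> dx\<close>.\<close>

lemma cohom_homotopy_pair:
  fixes F :: "nat list \<Rightarrow> 'r::comm_ring_1"
  shows "cohom (cohoch F) [a, b] = F [a, b] - diff_coeff a b * F [a + b - 1, 1]"
proof -
  define \<epsilon> :: 'r where "\<epsilon> = (-1) ^ Suc (sum_list [a] + b)"
  have "(\<Sum>r<b. \<epsilon> ^ r * F (butlast (add_head r [a]) @ [last (add_head r [a]) + (b - 1 - r), 1])) =
      (\<Sum>r<b. \<epsilon> ^ r * F [a + b - 1, 1])"
    by (rule sum.cong) (auto simp: add_ac)
  also have "\<dots> = (\<Sum>r<b. \<epsilon> ^ r) * F [a + b - 1, 1]"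
    by (simp add: sum_distrib_right)
  also have "(\<Sum>r<b. \<epsilon> ^ r) = diff_coeff a b"
  proof (cases "odd (a + b)")
    case True
    then have "\<epsilon> = 1" by (simp add: \<epsilon>_def)
    then show ?thesis using True by (simp add: diff_coeff_def)
  next
    case False
    then have "\<epsilon> = -1" by (simp add: \<epsilon>_def)
    moreover have "(\<Sum>r<k. (-1) ^ r) = (if odd k then 1 else 0 :: 'r)" for k
      by (induction k) auto
    ultimately show ?thesis using False by (simp add: diff_coeff_def)
  qed
  finally show ?thesis
    using cohom_cohoch[of "[a]", OF _ \<epsilon>_def, of F] by simp
qed

section \<open>The small complex\<close>

text \<open>The coordinate of \<open>u\<^bsub>n,s\<^esub>\<close> under the projection to the small complex. For odd \<open>s\<close> the projection sends
  \<open>a \<otimes> b\<close> in column \<open>s - 1\<close> to the class of \<open>a db\<close>. A single factor \<open>a\<close> in the odd column \<open>s\<close> must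
  then go to \<open>da\<close>, so that \<open>b'\<close> and \<open>1 - t\<close> out of that column match.\<close>

definition small_coord :: "nat \<Rightarrow> nat \<Rightarrow> nat \<Rightarrow> nat list \<Rightarrow> 'r::comm_ring_1" where
  "small_coord n s c ms =
     (if even s then if c = s \<and> ms = [n] then 1 else 0
      else if Suc c = s then (case ms of [a, b] \<Rightarrow> if a + b = n then diff_coeff a b else 0 | _ \<Rightarrow> 0)
      else if c = s \<and> ms = [n] then diff_coeff 0 n else 0)"

lemma cotot_single:
  "cotot q \<phi> c [a] = (if c \<noteq> 0 \<and> even c then \<phi> (c - 1) [a] else 0) +
     (-1) ^ c * (if odd a then q * \<phi> c [a - 1] else 0)"
  by (auto simp: cotot_def conorm_def cocyc_def codiff_Cons)

lemma cotot_pair: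
  "cotot q \<phi> c [a, b] = (if even c then \<phi> c [a + b] - (-1) ^ (a * b) * \<phi> c [a + b] else - \<phi> c [a + b]) +
     (if c = 0 then 0 else if odd c then \<phi> (c - 1) [a, b] + (-1) ^ (a * b) * \<phi> (c - 1) [b, a]
      else \<phi> (c - 1) [a, b] - (-1) ^ (a * b) * \<phi> (c - 1) [b, a]) -
     (-1) ^ c * ((if odd a then q * \<phi> c [a - 1, b] else 0) + (-1) ^ a * (if odd b then q * \<phi> c [a, b - 1] else 0))"
  by (simp add: cotot_def conorm_def cocyc_def codiff_Cons cohoch_def cobar_def coface_def merge_def
      numeral_2_eq_2 mult.commute add.commute cong: if_cong)

lemma cotot_long:
  assumes "length ms \<ge> 3" "\<And>c' u. length u \<ge> 3 \<Longrightarrow> \<phi> c' u = 0"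
  shows "cotot q \<phi> c ms = (if even c then cohoch (\<phi> c) ms else - cobar (\<phi> c) ms)"
proof -
  have ne: "ms \<noteq> []" using assms(1) by auto
  have "codiff q (\<phi> c) ms = codiff q (\<lambda>u. 0) ms"
    by (rule codiff_cong) (use assms in auto)
  moreover have "conorm (\<phi> (c - 1)) ms = conorm (\<lambda>u. 0) ms"
    by (rule conorm_cong) (use assms in auto)
  moreover have "cocyc (\<phi> (c - 1)) ms = cocyc (\<lambda>u. 0) ms"
    by (rule cocyc_cong) (use assms ne in auto)
  ultimately show ?thesis using assms
    by (simp add: cotot_def codiff_linear conorm_linear cocyc_linear)
qed

text \<open>The projection to the small complex is a chain map. It kills tensors of three or more factors, so
  only tensors of at most three factors have to be compared.\<close>

lemma cotot_small_coord:
  assumes "ms \<noteq> []"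
  shows "cotot q (small_coord n s) c ms =
    (if even n \<and> even s then 2 * small_coord n (Suc s) c ms + q * small_coord (Suc n) s c ms
     else if odd n \<and> odd s then of_nat n * small_coord n (Suc s) c ms - q * small_coord (Suc n) s c ms
     else 0)"
proof -
  have z: "small_coord n' s' c' u = (0 :: 'a)" if "length u \<ge> 3" for n' s' c' and u :: "nat list"
    using that by (auto simp: small_coord_def split: list.splits)
  consider a where "ms = [a]" | a b where "ms = [a, b]" | a b d where "ms = [a, b, d]" | "length ms \<ge> 4"
  proof (cases ms rule: remdups_adj.cases)
    case (3 a b w)
    then show ?thesis using that by (cases w; cases "tl w") auto
  qed (use assms that in auto)
  then show ?thesis
  proof cases
    case 1
    then show ?thesis
      by (cases a; cases c) (auto simp: cotot_single small_coord_def diff_coeff_def)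
  next
    case 2
    then show ?thesis
      by (cases "even s"; cases "even a"; cases "even b"; cases a; cases b; cases c)
         (auto simp: cotot_pair small_coord_def diff_coeff_def algebra_simps)
  next
    case 3
    have b: "cobar F [a, b, d] = F [a + b, d] - F [a, b + d]" for F :: "nat list \<Rightarrow> 'a"
      by (simp add: cobar_def coface_def merge_def numeral_2_eq_2)
    have h: "cohoch F [a, b, d] = F [a + b, d] - F [a, b + d] + (-1) ^ (d * (a + b)) * F [d + a, b]"
      for F :: "nat list \<Rightarrow> 'a"
      by (simp add: cohoch_def coface_def merge_def numeral_2_eq_2 cocyc_def)
    have "cotot q (small_coord n s) c ms =
        (if even c then cohoch (small_coord n s c) ms else - cobar (small_coord n s c) ms)"
      by (rule cotot_long) (use z 3 in auto)
    also have "\<dots> = 0"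
      unfolding 3 b h
      by (cases "even a"; cases "even b"; cases "even d") (auto simp: small_coord_def diff_coeff_def algebra_simps)
    finally show ?thesis using z[of ms] 3 by simp
  next
    case 4
    have "cohoch (small_coord n s c) ms = cohoch (\<lambda>u. 0 :: 'a) ms" by (rule cohoch_cong, rule z) (use 4 in auto)
    moreover have "cobar (small_coord n s c) ms = cobar (\<lambda>u. 0 :: 'a) ms" by (rule cobar_cong, rule z) (use 4 in auto)
    ultimately show ?thesis using 4 z by (simp add: cotot_long cohoch_linear cobar_linear)
  qed
qed

section \<open>Linear functionals on free modules\<close>

definition lin_fun :: "('g \<Rightarrow> 'r::comm_ring_1) \<Rightarrow> ('g \<Rightarrow>\<^sub>0 'r) \<Rightarrow> 'r" where
  "lin_fun f x = (\<Sum>g\<in>Poly_Mapping.keys x. Poly_Mapping.lookup x g * f g)"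

lemma lin_fun_superset:
  "finite S \<Longrightarrow> Poly_Mapping.keys x \<subseteq> S \<Longrightarrow> lin_fun f x = (\<Sum>g\<in>S. Poly_Mapping.lookup x g * f g)"
  unfolding lin_fun_def by (rule sum.mono_neutral_left) (auto simp: in_keys_iff)

lemma lin_fun_0 [simp]: "lin_fun f 0 = 0"
  by (simp add: lin_fun_def)

lemma lin_fun_gen [simp]: "lin_fun f (gen g) = f g"
  by (simp add: lin_fun_def)

lemma lin_fun_add [simp]: "lin_fun f (x + y) = lin_fun f x + lin_fun f y"
proof -
  let ?S = "Poly_Mapping.keys x \<union> Poly_Mapping.keys y"
  have "Poly_Mapping.keys (x + y) \<subseteq> ?S" by (rule keys_add)
  then show ?thesis
    by (simp add: lin_fun_superset[of ?S] lookup_add sum.distrib distrib_right)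
qed

lemma keys_free_scale: "Poly_Mapping.keys (free_scale r x) \<subseteq> Poly_Mapping.keys x"
  by (auto simp: in_keys_iff lookup_free_scale)

lemma lin_fun_scale [simp]: "lin_fun f (free_scale r x) = r * lin_fun f x"
  using lin_fun_superset[OF finite_keys keys_free_scale, of f r x]
  by (simp add: lin_fun_def lookup_free_scale sum_distrib_left mult.assoc)

lemma free_scale_minus_one: "free_scale (-1) x = - x"
  by (rule poly_mapping_eqI) (simp add: lookup_free_scale)

lemma lin_fun_uminus [simp]: "lin_fun f (- x) = - lin_fun f x"
  using lin_fun_scale[of f "-1" x] by (simp add: free_scale_minus_one)

lemma lin_fun_diff [simp]: "lin_fun f (x - y) = lin_fun f x - lin_fun f y"
  using lin_fun_add[of f x "- y"] by simp

lemma lin_fun_sum [simp]: "lin_fun f (\<Sum>i\<in>I. x i) = (\<Sum>i\<in>I. lin_fun f (x i))"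
  by (induction I rule: infinite_finite_induct) auto

lemma lin_fun_cong: "(\<And>g. g \<in> Poly_Mapping.keys x \<Longrightarrow> f g = f' g) \<Longrightarrow> lin_fun f x = lin_fun f' x"
  by (simp add: lin_fun_def)

lemma lookup_linear_ext:
  "Poly_Mapping.lookup (linear_ext F x) h = lin_fun (\<lambda>g. Poly_Mapping.lookup (F g) h) x"
  by (simp add: linear_ext_def lin_fun_def lookup_sum lookup_free_scale)

lemma linear_ext_add [simp]: "linear_ext F (x + y) = linear_ext F x + linear_ext F y"
  by (rule poly_mapping_eqI) (simp add: lookup_linear_ext lookup_add)

lemma linear_ext_scale [simp]: "linear_ext F (free_scale r x) = free_scale r (linear_ext F x)"
  by (rule poly_mapping_eqI) (simp add: lookup_linear_ext lookup_free_scale)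

lemma linear_ext_0 [simp]: "linear_ext F 0 = 0"
  by (simp add: linear_ext_def)

lemma lin_fun_linear_ext: "lin_fun f (linear_ext F x) = lin_fun (\<lambda>g. lin_fun f (F g)) x"
  by (simp add: linear_ext_def lin_fun_def[of _ x])

definition supported :: "'g set \<Rightarrow> ('g \<Rightarrow>\<^sub>0 'r::comm_ring_1) set" where
  "supported S = {x. Poly_Mapping.keys x \<subseteq> S}"

lemma supported_0 [simp]: "0 \<in> supported S"
  by (simp add: supported_def)

lemma supported_gen: "g \<in> S \<Longrightarrow> gen g \<in> supported S"
  by (simp add: supported_def)

lemma supported_add: "x \<in> supported S \<Longrightarrow> y \<in> supported S \<Longrightarrow> x + y \<in> supported S"
  using keys_add[of x y] by (auto simp: supported_def)

lemma supported_scale: "x \<in> supported S \<Longrightarrow> free_scale r x \<in> supported S"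
  using keys_free_scale[of r x] by (auto simp: supported_def)

lemma supported_uminus: "x \<in> supported S \<Longrightarrow> - x \<in> supported S"
  by (simp add: supported_def)

lemma supported_diff: "x \<in> supported S \<Longrightarrow> y \<in> supported S \<Longrightarrow> x - y \<in> supported S"
  using supported_add[of x S "- y"] supported_uminus[of y] by simp

lemma supported_sum: "(\<And>i. i \<in> I \<Longrightarrow> x i \<in> supported S) \<Longrightarrow> (\<Sum>i\<in>I. x i) \<in> supported S"
  by (induction I rule: infinite_finite_induct) (auto intro: supported_add)

lemma supported_linear_ext:
  assumes "x \<in> supported S" "\<And>g. g \<in> S \<Longrightarrow> F g \<in> supported T"
  shows "linear_ext F x \<in> supported T"
  unfolding linear_ext_def
  by (intro supported_sum supported_scale assms(2)) (use assms(1) in \<open>auto simp: supported_def\<close>)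

lemma free_chains_supported: "free_chains A i = supported (chain_gens A i)"
  by (simp add: free_chains_def supported_def)

section \<open>Degrees of words\<close>

definition graded_words :: "('r::comm_ring_1, 'a::ring_1) dga \<Rightarrow> nat \<Rightarrow> int \<Rightarrow> 'a word set" where
  "graded_words A l d = {w. length w = l \<and> word_degree w = d \<and> (\<forall>(k, a)\<in>set w. a \<in> dg_comp A k)}"

lemma split_word_nth:
  assumes "i < length w"
  shows "w = take i w @ [w ! i] @ drop (Suc i) w"
  using assms by (simp add: id_take_nth_drop)

lemma split_word_nth2:
  assumes "Suc i < length w"
  shows "w = take i w @ [w ! i, w ! Suc i] @ drop (i + 2) w"
  using assms by (simp add: Cons_nth_drop_Suc)

lemma face_graded:
  assumes "dg_algebra A" "w \<in> graded_words A l d" "Suc i < l"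
  shows "face i w \<in> graded_words A (l - 1) d"
proof -
  define u v x y where "u = take i w" and "v = drop (i + 2) w" and "x = w ! i" and "y = w ! Suc i"
  have l: "length w = l" using assms(2) by (simp add: graded_words_def)
  then have w: "w = u @ [x, y] @ v"
    using split_word_nth2[of i w] assms(3) by (simp add: u_def v_def x_def y_def)
  have face: "face i w = u @ [(fst x + fst y, snd x * snd y)] @ v"
    by (simp add: face_def u_def v_def x_def y_def)
  have "snd x \<in> dg_comp A (fst x)" "snd y \<in> dg_comp A (fst y)"
    using assms(2) unfolding w graded_words_def by (auto simp: case_prod_beta)
  then have "snd x * snd y \<in> dg_comp A (fst x + fst y)"
    by (rule dg_algebra.comp_mult[OF assms(1)])
  then show ?thesis
    using assms(2) unfolding face unfolding w graded_words_def
    by (auto simp: word_degree_def)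
qed

lemma rot_graded:
  assumes "w \<in> graded_words A l d" "w \<noteq> []"
  shows "rot w \<in> graded_words A l d"
proof -
  obtain u x where w: "w = u @ [x]" using assms(2) by (metis rev_exhaust)
  show ?thesis using assms(1) by (auto simp: w rot_def graded_words_def word_degree_def)
qed

lemma bar_b'_graded:
  assumes "dg_algebra A" "w \<in> graded_words A l d"
  shows "bar_b' w \<in> supported (graded_words A (l - 1) d)"
  unfolding bar_b'_def
  by (intro supported_sum supported_scale supported_gen face_graded[OF assms])
    (use assms in \<open>auto simp: graded_words_def\<close>)

lemma hoch_b_graded:
  assumes "dg_algebra A" "w \<in> graded_words A l d"
  shows "hoch_b w \<in> supported (graded_words A (l - 1) d)"
proof -
  have "length w = l" using assms(2) by (simp add: graded_words_def)
  show ?thesis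
  proof (cases "l \<le> 1")
    case True
    then show ?thesis
      using bar_b'_graded[OF assms] \<open>length w = l\<close> by (simp add: hoch_b_def)
  next
    case False
    then have "rot w \<in> graded_words A l d"
      using \<open>length w = l\<close> by (intro rot_graded assms) auto
    then have "face 0 (rot w) \<in> graded_words A (l - 1) d"
      by (rule face_graded[OF assms(1)]) (use False in simp)
    moreover have nl: "\<not> length w \<le> 1" using False \<open>length w = l\<close> by simp
    ultimately show ?thesis
      unfolding hoch_b_def if_not_P[OF nl]
      by (intro supported_add supported_scale supported_gen bar_b'_graded[OF assms])
  qed
qed

lemma cyc_t_graded:
  assumes "w \<in> graded_words A l d" "w \<noteq> []"
  shows "cyc_t w \<in> supported (graded_words A l d)"
  unfolding cyc_t_def by (intro supported_scale supported_gen rot_graded assms)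

lemma norm_N_graded:
  assumes "w \<in> graded_words A l d" "w \<noteq> []"
  shows "norm_N w \<in> supported (graded_words A l d)"
proof -
  have l: "length w = l" "l > 0" using assms by (auto simp: graded_words_def)
  have "(linear_ext cyc_t ^^ j) (gen w) \<in> supported (graded_words A l d)" for j
  proof (induction j)
    case (Suc j)
    show ?case
      unfolding funpow.simps o_apply using Suc.IH
    proof (rule supported_linear_ext)
      fix g assume g: "g \<in> graded_words A l d"
      then have "g \<noteq> []" using l by (auto simp: graded_words_def)
      with g show "cyc_t g \<in> supported (graded_words A l d)" by (rule cyc_t_graded)
    qed
  qed (use assms in \<open>auto intro: supported_gen\<close>)
  then show ?thesis unfolding norm_N_def by (intro supported_sum)
qed

lemma int_diff_graded:
  assumes "dg_algebra A" "w \<in> graded_words A l d"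
  shows "int_diff A w \<in> supported (graded_words A l (d - 1))"
proof -
  have "w[i := (fst (w ! i) - 1, dg_diff A (snd (w ! i)))] \<in> graded_words A l (d - 1)"
    if "i < length w" for i
  proof -
    define u v x where "u = take i w" and "v = drop (Suc i) w" and "x = w ! i"
    have w: "w = u @ [x] @ v" using split_word_nth[OF that] by (simp add: u_def v_def x_def)
    have upd: "w[i := (fst (w ! i) - 1, dg_diff A (snd (w ! i)))] = u @ [(fst x - 1, dg_diff A (snd x))] @ v"
      using that by (simp add: upd_conv_take_nth_drop u_def v_def x_def)
    have "snd x \<in> dg_comp A (fst x)"
      using assms(2) unfolding w graded_words_def by (auto simp: case_prod_beta)
    then have "dg_diff A (snd x) \<in> dg_comp A (fst x - 1)"
      by (rule dg_algebra.diff_comp[OF assms(1)])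
    then show ?thesis using assms(2) unfolding upd unfolding w graded_words_def
      by (auto simp: word_degree_def)
  qed
  then show ?thesis unfolding int_diff_def
    by (intro supported_sum supported_scale supported_gen) auto
qed

lemma in_column_supported:
  assumes "y \<in> supported (graded_words A l d)" "int c + (int l - 1) + d = i" "l > 0"
  shows "in_column c y \<in> free_chains A i"
  unfolding free_chains_supported in_column_def using assms(1)
  by (rule supported_linear_ext)
    (use assms(2,3) in \<open>auto intro!: supported_gen simp: chain_gens_def graded_words_def\<close>)

lemma in_column_0 [simp]: "in_column c 0 = 0"
  by (simp add: in_column_def)

lemma total_diff_free_chains:
  assumes A: "dg_algebra A" and x: "x \<in> free_chains A i"
  shows "total_diff A x \<in> free_chains A (i - 1)"
  using x unfolding free_chains_supported total_diff_def
proof (rule supported_linear_ext)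
  fix g assume "g \<in> chain_gens A i"
  obtain c w where g: "g = (c, w)" by force
  define l d where "l = length w" and "d = word_degree w"
  have w: "w \<in> graded_words A l d" "w \<noteq> []" and i: "int c + (int l - 1) + d = i" and l: "l > 0"
    using \<open>g \<in> chain_gens A i\<close> unfolding g chain_gens_def graded_words_def l_def d_def by auto
  have 1: "in_column c (if even c then hoch_b w else - bar_b' w) \<in> free_chains A (i - 1)"
  proof (cases "l = 1")
    case True
    then have "bar_b' w = (0 :: 'b word \<Rightarrow>\<^sub>0 'a)" "hoch_b w = (0 :: 'b word \<Rightarrow>\<^sub>0 'a)"
      unfolding hoch_b_def bar_b'_def l_def by simp_all
    then show ?thesis by (simp add: free_chains_supported)
  next
    case False
    have "(if even c then hoch_b w else - bar_b' w) \<in> supported (graded_words A (l - 1) d)"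
      using hoch_b_graded[OF A w(1)] bar_b'_graded[OF A w(1)] by (auto intro: supported_uminus)
    then show ?thesis by (rule in_column_supported) (use False l i in auto)
  qed
  have 2: "in_column (c - 1) (if odd c then gen w - cyc_t w else norm_N w) \<in> free_chains A (i - 1)"
    if "c \<noteq> 0"
    by (rule in_column_supported[of _ A l d])
      (use w l i that in \<open>auto intro!: supported_diff supported_gen cyc_t_graded norm_N_graded\<close>)
  have 3: "in_column c (free_scale r (int_diff A w)) \<in> free_chains A (i - 1)" for r
    by (rule in_column_supported[of _ A l "d - 1"])
      (use i l in \<open>auto intro!: supported_scale int_diff_graded A w\<close>)
  show "total_diff_gen A g \<in> supported (chain_gens A (i - 1))"
    using 1 2 3 unfolding total_diff_gen_def g free_chains_supported
    by (auto intro!: supported_add)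
qed

section \<open>Monomial coordinates\<close>

text \<open>The zero polynomial may carry a negative degree, where \<open>nat\<close> would be misleading.\<close>

fun letter_coeff :: "int \<times> 'r::comm_ring_1 poly \<Rightarrow> 'r" where
  "letter_coeff (k, a) = (if k < 0 then 0 else coeff a (nat k))"

definition word_coeff :: "'r::comm_ring_1 poly word \<Rightarrow> 'r" where
  "word_coeff w = (\<Prod>x\<leftarrow>w. letter_coeff x)"

definition exponents :: "'a word \<Rightarrow> nat list" where
  "exponents w = map (\<lambda>x. nat (fst x)) w"

definition word_fun :: "(nat list \<Rightarrow> 'r::comm_ring_1) \<Rightarrow> 'r poly word \<Rightarrow> 'r" where
  "word_fun F w = word_coeff w * F (exponents w)"

text \<open>The value of a function on the monomial coordinates of a chain. Since
  \<open>pairing \<phi>\<close> respects multilinearity, it is a functional on the total complex itself.\<close>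

definition pairing :: "(nat \<Rightarrow> nat list \<Rightarrow> 'r::comm_ring_1) \<Rightarrow> ('r poly, 'r) chain \<Rightarrow> 'r" where
  "pairing \<phi> = lin_fun (\<lambda>(c, w). word_fun (\<phi> c) w)"

lemma word_coeff_append [simp]: "word_coeff (u @ v) = word_coeff u * word_coeff v"
  by (simp add: word_coeff_def)

lemma word_coeff_Cons [simp]: "word_coeff (x # v) = letter_coeff x * word_coeff v"
  by (simp add: word_coeff_def)

lemma word_coeff_Nil [simp]: "word_coeff [] = 1"
  by (simp add: word_coeff_def)

lemma exponents_append [simp]: "exponents (u @ v) = exponents u @ exponents v"
  by (simp add: exponents_def)

lemma exponents_Cons [simp]: "exponents (x # v) = nat (fst x) # exponents v"
  by (simp add: exponents_def)

lemma exponents_Nil [simp]: "exponents [] = []"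
  by (simp add: exponents_def)

lemma length_exponents [simp]: "length (exponents w) = length w"
  by (simp add: exponents_def)

lemma exponents_eq_Nil [simp]: "exponents w = [] \<longleftrightarrow> w = []"
  by (simp add: exponents_def)

lemma word_coeff_nonzero:
  assumes "word_coeff w \<noteq> 0"
  shows "\<forall>x\<in>set w. fst x \<ge> 0"
  using assms
proof (induction w)
  case (Cons x w)
  then have "letter_coeff x \<noteq> 0" "word_coeff w \<noteq> 0" by auto
  then show ?case using Cons.IH by (cases x) (auto split: if_splits)
qed simp

lemma word_degree_exponents:
  assumes "word_coeff w \<noteq> 0"
  shows "word_degree w = int (sum_list (exponents w))"
  using word_coeff_nonzero[OF assms] by (induction w) (auto simp: word_degree_def)

lemma dquot_comp_monom:
  assumes "a \<in> dg_comp (dquot q) k"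
  shows "a = monom (letter_coeff (k, a)) (nat k)"
  using assms by (auto simp: dquot_def split: if_splits)

lemma letter_coeff_mult:
  assumes "snd x \<in> dg_comp (dquot q) (fst x)" "snd y \<in> dg_comp (dquot q) (fst y)"
  shows "letter_coeff (fst x + fst y, snd x * snd y) = letter_coeff x * letter_coeff y"
proof (cases "fst x \<ge> 0 \<and> fst y \<ge> 0")
  case True
  have "snd x * snd y = monom (letter_coeff x * letter_coeff y) (nat (fst x) + nat (fst y))"
    using dquot_comp_monom[OF assms(1)] dquot_comp_monom[OF assms(2)]
    by (metis mult_monom prod.collapse)
  then show ?thesis using True by (simp add: nat_add_distrib)
next
  case False
  then have "snd x = 0 \<or> snd y = 0" using assms by (auto simp: dquot_def)
  then show ?thesis by (cases x; cases y) auto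
qed

lemma letter_coeff_diff:
  assumes "snd x \<in> dg_comp (dquot q) (fst x)"
  shows "letter_coeff (fst x - 1, dquot_diff q (snd x)) =
     (if odd (nat (fst x)) then q * letter_coeff x else 0)"
proof (cases "fst x \<ge> 1")
  case True
  define m where "m = nat (fst x - 1)"
  have "nat (fst x) = Suc m" "\<not> fst x < 0" "nat (fst x - 1) = m"
    using True by (auto simp: m_def)
  then show ?thesis using True by (cases x) (auto simp: coeff_dquot_diff)
next
  case False
  then show ?thesis by (cases x) auto
qed

abbreviation homogeneous :: "'r::comm_ring_1 \<Rightarrow> 'r poly word \<Rightarrow> bool" where
  "homogeneous q w \<equiv> (\<forall>(k, a)\<in>set w. a \<in> dg_comp (dquot q) k)"

text \<open>If a letter has negative degree, the word represents zero, and both sides vanish although the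
  exponents do not match.\<close>

lemma word_fun_face:
  assumes "homogeneous q w" "Suc i < length w"
  shows "word_fun F (face i w) = word_fun (\<lambda>u. F (merge i u)) w"
proof -
  define u v x y where "u = take i w" and "v = drop (i + 2) w" and "x = w ! i" and "y = w ! Suc i"
  have w: "w = u @ [x, y] @ v"
    using split_word_nth2[OF assms(2)] by (simp add: u_def v_def x_def y_def)
  have lu: "length u = i" using assms(2) by (simp add: u_def)
  have face: "face i w = u @ [(fst x + fst y, snd x * snd y)] @ v"
    by (simp add: face_def u_def v_def x_def y_def)
  have xy: "letter_coeff (fst x + fst y, snd x * snd y) = letter_coeff x * letter_coeff y"
    by (rule letter_coeff_mult[of _ q]) (use assms(1) in \<open>auto simp: w case_prod_beta\<close>)
  have mg: "merge i (exponents w) = exponents u @ [nat (fst x) + nat (fst y)] @ exponents v"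
    using lu by (simp add: w merge_def nth_append)
  show ?thesis
  proof (cases "letter_coeff x * letter_coeff y = 0")
    case True
    have "word_coeff w = word_coeff u * (letter_coeff x * letter_coeff y) * word_coeff v"
      by (simp add: w mult_ac)
    moreover have "word_coeff (face i w) = word_coeff u * (letter_coeff x * letter_coeff y) * word_coeff v"
      unfolding face by (simp only: word_coeff_append word_coeff_Cons word_coeff_Nil xy) (simp add: mult_ac)
    ultimately show ?thesis using True by (simp add: word_fun_def)
  next
    case False
    then have "fst x \<ge> 0" "fst y \<ge> 0" by (cases x; cases y; auto split: if_splits)+
    then have "nat (fst x + fst y) = nat (fst x) + nat (fst y)" by (simp add: nat_add_distrib)
    then have "exponents (face i w) = merge i (exponents w)" by (simp add: mg face)
    moreover have "word_coeff (face i w) = word_coeff w"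
      unfolding face by (simp only: word_coeff_append word_coeff_Cons word_coeff_Nil xy) (simp add: w mult_ac)
    ultimately show ?thesis by (simp add: word_fun_def)
  qed
qed

lemma ksign_int: "ksign (int k) = (-1) ^ k"
  by (simp add: ksign_def)

lemma word_fun_cyc_t:
  assumes "w \<noteq> []"
  shows "(-1) ^ (length w - 1) * rot_sign w * word_fun F (rot w) = word_fun (cocyc F) w"
proof -
  obtain u x where w: "w = u @ [x]" using assms by (metis rev_exhaust)
  have c: "word_coeff (rot w) = word_coeff w" by (simp add: w rot_def mult_ac)
  show ?thesis
  proof (cases "word_coeff w = 0")
    case False
    then have cu: "word_coeff u \<noteq> 0" and "letter_coeff x \<noteq> 0" by (auto simp: w)
    then have "fst x = int (nat (fst x))" by (cases x) (auto split: if_splits)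
    then have "rot_sign w = (ksign (int (nat (fst x) * sum_list (exponents u))) :: 'a)"
      using word_degree_exponents[OF cu] by (simp add: w rot_sign_def)
    then have "rot_sign w = ((-1) ^ (nat (fst x) * sum_list (exponents u)) :: 'a)"
      unfolding ksign_int .
    then show ?thesis using c
      by (simp add: word_fun_def w rot_def cocyc_snoc power_add mult_ac)
  qed (simp add: word_fun_def c)
qed

lemma lin_fun_cyc_t: "w \<noteq> [] \<Longrightarrow> lin_fun (word_fun F) (cyc_t w) = word_fun (cocyc F) w"
  using word_fun_cyc_t[of w F] by (simp add: cyc_t_def)

lemma homogeneous_rot: "homogeneous q w \<Longrightarrow> w \<noteq> [] \<Longrightarrow> homogeneous q (rot w)"
  by (auto simp: rot_def dest: in_set_butlastD)

lemma length_rot: "w \<noteq> [] \<Longrightarrow> length (rot w) = length w"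
  by (simp add: rot_def)

lemma word_fun_sum: "word_fun (\<lambda>u. \<Sum>i\<in>I. f i u) w = (\<Sum>i\<in>I. word_fun (f i) w)"
  by (simp add: word_fun_def sum_distrib_left)

lemma word_fun_scale: "word_fun (\<lambda>u. r * F u) w = r * word_fun F w"
  by (simp add: word_fun_def mult_ac)

lemma word_fun_cong: "F (exponents w) = G (exponents w) \<Longrightarrow> word_fun F w = word_fun G w"
  by (simp add: word_fun_def)

lemma lin_fun_bar_b':
  assumes "homogeneous q w"
  shows "lin_fun (word_fun F) (bar_b' w) = word_fun (cobar F) w"
proof -
  have "word_fun (cobar F) w = word_fun (\<lambda>u. \<Sum>i<length w - 1. (-1) ^ i * F (merge i u)) w"
    by (rule word_fun_cong) (auto simp: cobar_def coface_def intro!: sum.cong)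
  also have "\<dots> = lin_fun (word_fun F) (bar_b' w)"
    unfolding word_fun_sum word_fun_scale bar_b'_def
    by (auto intro!: sum.cong simp: word_fun_face[OF assms])
  finally show ?thesis by simp
qed

lemma lin_fun_hoch_b:
  assumes "homogeneous q w"
  shows "lin_fun (word_fun F) (hoch_b w) = word_fun (cohoch F) w"
proof (cases "length w \<le> 1")
  case True
  then show ?thesis
    by (simp add: hoch_b_def lin_fun_bar_b'[OF assms]) (simp add: word_fun_def cobar_def cohoch_def)
next
  case False
  then obtain n where n: "length w = Suc n" "n \<ge> 1" by (cases "length w") auto
  have ne: "w \<noteq> []" using False by auto
  have "word_fun (cohoch F) w = word_fun (\<lambda>u. cobar F u + cocyc (\<lambda>u. F (merge 0 u)) u) w"
    by (rule word_fun_cong) (use n in \<open>simp add: cohoch_def cobar_def coface_def[of n]\<close>)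
  also have "\<dots> = word_fun (cobar F) w + word_fun (cocyc (\<lambda>u. F (merge 0 u))) w"
    by (simp add: word_fun_def distrib_left)
  also have "word_fun (cocyc (\<lambda>u. F (merge 0 u))) w =
      (-1) ^ (length w - 1) * rot_sign w * word_fun F (face 0 (rot w))"
    using word_fun_face[OF homogeneous_rot[OF assms ne], of 0] length_rot[OF ne] False
    using word_fun_cyc_t[OF ne, of "\<lambda>u. F (merge 0 u)"] by simp
  finally show ?thesis
    using False by (simp add: hoch_b_def lin_fun_bar_b'[OF assms])
qed

lemma lin_fun_norm_N:
  assumes "w \<noteq> []"
  shows "lin_fun (word_fun F) (norm_N w) = word_fun (conorm F) w"
proof -
  define W where "W = {w :: 'a poly word. w \<noteq> []}"
  have sup: "(linear_ext cyc_t ^^ j) (gen w) \<in> supported W" for j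
    using assms
    by (induction j) (auto simp: W_def intro!: supported_gen elim!: supported_linear_ext,
      auto simp: cyc_t_def rot_def intro!: supported_scale supported_gen)
  have "lin_fun (word_fun F) ((linear_ext cyc_t ^^ j) (gen w)) = word_fun ((cocyc ^^ j) F) w" for j
  proof (induction j arbitrary: F)
    case (Suc j)
    have "lin_fun (word_fun F) ((linear_ext cyc_t ^^ Suc j) (gen w)) =
       lin_fun (\<lambda>v. lin_fun (word_fun F) (cyc_t v)) ((linear_ext cyc_t ^^ j) (gen w))"
      by (simp add: lin_fun_linear_ext)
    also have "\<dots> = lin_fun (word_fun (cocyc F)) ((linear_ext cyc_t ^^ j) (gen w))"
      using sup[of j] by (intro lin_fun_cong lin_fun_cyc_t) (auto simp: supported_def W_def)
    also have "\<dots> = word_fun ((cocyc ^^ Suc j) F) w"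
      unfolding Suc.IH by (simp add: funpow_swap1)
    finally show ?case .
  qed simp
  then have "lin_fun (word_fun F) (norm_N w) = (\<Sum>j<length w. word_fun ((cocyc ^^ j) F) w)"
    by (simp add: norm_N_def)
  also have "\<dots> = word_fun (conorm F) w"
    unfolding word_fun_sum[symmetric] by (rule word_fun_cong) (simp add: conorm_def)
  finally show ?thesis .
qed

lemma lin_fun_int_diff:
  assumes "homogeneous q w"
  shows "lin_fun (word_fun F) (int_diff (dquot q) w) = word_fun (codiff q F) w"
proof -
  have "ksign (word_degree (take i w)) *
      word_fun F (w[i := (fst (w ! i) - 1, dg_diff (dquot q) (snd (w ! i)))]) =
    word_fun (\<lambda>ms. (-1) ^ sum_list (take i ms) *
     (if odd (ms ! i) then q * F (ms[i := ms ! i - 1]) else 0)) w" if "i < length w" for i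
  proof -
    define u v x where "u = take i w" and "v = drop (Suc i) w" and "x = w ! i"
    have w: "w = u @ [x] @ v" using split_word_nth[OF that] by (simp add: u_def v_def x_def)
    have lu: "length u = i" using that by (simp add: u_def)
    have upd: "w[i := (fst (w ! i) - 1, dg_diff (dquot q) (snd (w ! i)))] =
        u @ [(fst x - 1, dquot_diff q (snd x))] @ v"
      using that by (simp add: upd_conv_take_nth_drop u_def v_def x_def dquot_def)
    have x: "letter_coeff (fst x - 1, dquot_diff q (snd x)) =
         (if odd (nat (fst x)) then q * letter_coeff x else 0)"
      by (rule letter_coeff_diff) (use assms in \<open>auto simp: w case_prod_beta\<close>)
    have "take i (exponents w) = exponents u" "exponents w ! i = nat (fst x)"
        "(exponents w)[i := nat (fst x) - 1] = exponents u @ [nat (fst x) - 1] @ exponents v"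
      using lu by (simp_all add: w nth_append list_update_append)
    note e = this
    have L: "word_coeff (u @ [(fst x - 1, dquot_diff q (snd x))] @ v) =
        word_coeff u * (if odd (nat (fst x)) then q * letter_coeff x else 0) * word_coeff v"
      by (simp only: word_coeff_append word_coeff_Cons word_coeff_Nil x) (simp add: mult_ac)
    show ?thesis
    proof (cases "word_coeff u = 0 \<or> even (nat (fst x))")
      case True
      then have "word_fun F (u @ [(fst x - 1, dquot_diff q (snd x))] @ v) = 0"
        unfolding word_fun_def L by auto
      moreover have "word_fun (\<lambda>ms. (-1) ^ sum_list (take i ms) *
         (if odd (ms ! i) then q * F (ms[i := ms ! i - 1]) else 0)) w = 0"
        using True unfolding word_fun_def e by (auto simp: w)
      ultimately show ?thesis unfolding upd by simp
    next
      case False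
      then have "ksign (word_degree u) = ((-1) ^ sum_list (exponents u) :: 'a)"
        by (simp add: word_degree_exponents ksign_int)
      moreover have "exponents (u @ [(fst x - 1, dquot_diff q (snd x))] @ v) =
          exponents u @ [nat (fst x) - 1] @ exponents v"
        by (simp add: nat_diff_distrib')
      ultimately show ?thesis
        using False unfolding upd word_fun_def L e u_def[symmetric] by (simp add: w mult_ac)
    qed
  qed
  then have "lin_fun (word_fun F) (int_diff (dquot q) w) =
     (\<Sum>i<length w. word_fun (\<lambda>ms. (-1) ^ sum_list (take i ms) *
     (if odd (ms ! i) then q * F (ms[i := ms ! i - 1]) else 0)) w)"
    by (simp add: int_diff_def)
  then show ?thesis
    unfolding word_fun_sum[symmetric] by (simp add: word_fun_def codiff_def)
qed

lemma lin_fun_in_column: "lin_fun f (in_column c y) = lin_fun (\<lambda>w. f (c, w)) y"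
  by (simp add: in_column_def lin_fun_linear_ext)

lemma pairing_total_diff:
  assumes "x \<in> free_chains (dquot q) i"
  shows "pairing \<phi> (total_diff (dquot q) x) = pairing (cotot q \<phi>) x"
  unfolding pairing_def total_diff_def lin_fun_linear_ext
proof (rule lin_fun_cong)
  fix g assume g: "g \<in> Poly_Mapping.keys x"
  obtain c w where cw: "g = (c, w)" by force
  then have w: "homogeneous q w" "w \<noteq> []"
    using g assms by (auto simp: free_chains_def chain_gens_def)
  have wf: "lin_fun (\<lambda>w. word_fun (\<phi> c') w) = lin_fun (word_fun (\<phi> c'))" for c' by simp
  have "word_fun (cotot q \<phi> c) w =
    (if even c then word_fun (cohoch (\<phi> c)) w else - word_fun (cobar (\<phi> c)) w) +
    (if c = 0 then 0 else if odd c then word_fun (\<phi> (c - 1)) w - word_fun (cocyc (\<phi> (c - 1))) w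
      else word_fun (conorm (\<phi> (c - 1))) w) +
    (-1) ^ (c + (length w - 1)) * word_fun (codiff q (\<phi> c)) w"
    by (simp add: word_fun_def cotot_def algebra_simps)
  then show "lin_fun (\<lambda>(c, w). word_fun (\<phi> c) w) (total_diff_gen (dquot q) g) =
         (case g of (c, w) \<Rightarrow> word_fun (cotot q \<phi> c) w)"
    by (simp add: cw total_diff_gen_def lin_fun_in_column lin_fun_hoch_b[OF w(1)] lin_fun_bar_b'[OF w(1)]
        lin_fun_cyc_t[OF w(2)] lin_fun_norm_N[OF w(2)] lin_fun_int_diff[OF w(1)])
qed

lemma pairing_linear [simp]:
  "pairing \<phi> (x + y) = pairing \<phi> x + pairing \<phi> y"
  "pairing \<phi> (x - y) = pairing \<phi> x - pairing \<phi> y"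
  "pairing \<phi> (free_scale r x) = r * pairing \<phi> x"
  "pairing \<phi> (- x) = - pairing \<phi> x"
  "pairing \<phi> 0 = 0"
  "pairing \<phi> (\<Sum>i\<in>I. f i) = (\<Sum>i\<in>I. pairing \<phi> (f i))"
  by (simp_all add: pairing_def)

lemma pairing_fun_linear:
  "pairing (\<lambda>c u. \<phi> c u + \<phi>' c u) x = pairing \<phi> x + pairing \<phi>' x"
  "pairing (\<lambda>c u. \<phi> c u - \<phi>' c u) x = pairing \<phi> x - pairing \<phi>' x"
  "pairing (\<lambda>c u. r * \<phi> c u) x = r * pairing \<phi> x"
  "pairing (\<lambda>c u. 0) x = 0"
  by (auto simp: pairing_def word_fun_def lin_fun_def case_prod_beta sum.distrib sum_subtractf sum_distrib_left algebra_simps)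

lemma pairing_cong:
  assumes "x \<in> free_chains (dquot q) i"
    "\<And>c u. u \<noteq> [] \<Longrightarrow> int c + (int (length u) - 1) + int (sum_list u) = i \<Longrightarrow> \<phi> c u = \<phi>' c u"
  shows "pairing \<phi> x = pairing \<phi>' x"
  unfolding pairing_def
proof (rule lin_fun_cong)
  fix g assume "g \<in> Poly_Mapping.keys x"
  moreover obtain c w where cw: "g = (c, w)" by force
  ultimately have w: "(c, w) \<in> chain_gens (dquot q) i"
    using assms by (auto simp: free_chains_def)
  show "(case g of (c, w) \<Rightarrow> word_fun (\<phi> c) w) = (case g of (c, w) \<Rightarrow> word_fun (\<phi>' c) w)"
  proof (cases "word_coeff w = 0")
    case False
    have "\<phi> c (exponents w) = \<phi>' c (exponents w)"
      by (rule assms(2)) (use w word_degree_exponents[OF False] in \<open>auto simp: chain_gens_def\<close>)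
    then show ?thesis by (simp add: cw word_fun_def)
  qed (simp add: cw word_fun_def)
qed

section \<open>The multilinearity relations\<close>

definition std_word :: "nat list \<Rightarrow> 'r::comm_ring_1 poly word" where
  "std_word ms = map (\<lambda>m. (int m, monom 1 m)) ms"

lemma word_coeff_std [simp]: "word_coeff (std_word ms) = 1"
  by (induction ms) (auto simp: std_word_def)

lemma exponents_std [simp]: "exponents (std_word ms) = ms"
  by (induction ms) (auto simp: std_word_def)

lemma pairing_std [simp]: "pairing \<phi> (gen (c, std_word ms)) = \<phi> c ms"
  by (simp add: pairing_def word_fun_def)

lemma std_word_chain_gens:
  assumes "ms \<noteq> []" "int c + (int (length ms) - 1) + int (sum_list ms) = i"
  shows "(c, std_word ms) \<in> chain_gens (dquot q) i"
proof -
  have "word_degree (std_word ms :: 'a poly word) = int (sum_list ms)"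
    by (induction ms) (auto simp: std_word_def word_degree_def)
  moreover have "homogeneous q (std_word ms)"
    by (auto simp: std_word_def dquot_def)
  ultimately show ?thesis
    using assms by (auto simp: chain_gens_def std_word_def)
qed

lemma std_word_free_chains:
  assumes "ms \<noteq> []" "int c + (int (length ms) - 1) + int (sum_list ms) = i"
  shows "gen (c, std_word ms) \<in> free_chains (dquot q) i"
  unfolding free_chains_supported by (intro supported_gen std_word_chain_gens assms)

lemma tensor_relations_subspace:
  "module.subspace free_scale (tensor_relations A i)"
  unfolding tensor_relations_def by (rule module.subspace_span[OF module_free_scale])

lemma tensor_relations_add: "x \<in> tensor_relations A i \<Longrightarrow> y \<in> tensor_relations A i \<Longrightarrow> x + y \<in> tensor_relations A i"
  and tensor_relations_scale: "x \<in> tensor_relations A i \<Longrightarrow> free_scale r x \<in> tensor_relations A i"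
  and tensor_relations_0: "0 \<in> tensor_relations A i"
  using tensor_relations_subspace[of A i] unfolding module.subspace_def[OF module_free_scale] by auto

lemma tensor_relations_sum:
  "(\<And>g. g \<in> S \<Longrightarrow> x g \<in> tensor_relations A i) \<Longrightarrow> (\<Sum>g\<in>S. x g) \<in> tensor_relations A i"
  by (induction S rule: infinite_finite_induct) (auto intro: tensor_relations_add tensor_relations_0)

lemma pairing_tensor_relations:
  assumes "x \<in> tensor_relations (dquot q) i"
  shows "pairing \<phi> x = 0"
proof -
  have "module.subspace free_scale {x. pairing \<phi> x = 0}"
    unfolding module.subspace_def[OF module_free_scale] by auto
  moreover have "add_relations (dquot q) i \<union> scale_relations (dquot q) i \<subseteq> {x. pairing \<phi> x = 0}"
  proof (clarify, elim UnE)
    fix x assume "x \<in> add_relations (dquot q) i"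
    then obtain c u k a a' v where
      x: "x = gen (c, u @ (k, a + a') # v) - gen (c, u @ (k, a) # v) - gen (c, u @ (k, a') # v)"
      unfolding add_relations_def by blast
    show "pairing \<phi> x = 0"
      unfolding x by (simp add: pairing_def word_fun_def algebra_simps)
  next
    fix x assume "x \<in> scale_relations (dquot q) i"
    then obtain c u k r a v where
      x: "x = gen (c, u @ (k, dg_scale (dquot q) r a) # v) - free_scale r (gen (c, u @ (k, a) # v))"
      unfolding scale_relations_def by blast
    show "pairing \<phi> x = 0"
      unfolding x by (simp add: pairing_def word_fun_def dquot_def algebra_simps)
  qed
  ultimately have "tensor_relations (dquot q) i \<subseteq> {x. pairing \<phi> x = 0}"
    unfolding tensor_relations_def by (intro module.span_minimal[OF module_free_scale])
  then show ?thesis using assms by auto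
qed

lemma scale_relation_in_tensor_relations:
  "(c, u @ (k, a) # v) \<in> chain_gens A i \<Longrightarrow>
     gen (c, u @ (k, dg_scale A r a) # v) - free_scale r (gen (c, u @ (k, a) # v)) \<in> tensor_relations A i"
  unfolding tensor_relations_def
  by (rule module.span_base[OF module_free_scale]) (auto simp: scale_relations_def)

lemma free_scale_0 [simp]: "free_scale 0 x = 0"
  by (rule poly_mapping_eqI) (simp add: lookup_free_scale)

lemma free_scale_1 [simp]: "free_scale 1 x = x"
  by (rule poly_mapping_eqI) (simp add: lookup_free_scale)

lemma free_scale_free_scale: "free_scale r (free_scale s x) = free_scale (r * s) x"
  by (rule poly_mapping_eqI) (simp add: lookup_free_scale mult.assoc)

lemma free_scale_diff: "free_scale r (x - y) = free_scale r x - free_scale r y"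
  by (rule poly_mapping_eqI) (simp add: lookup_free_scale lookup_minus algebra_simps)

text \<open>The letters behind the prefix \<open>s\<close> are replaced one at a time by \<open>x\<^sup>k\<close>, at the cost of their
  coefficients.\<close>

lemma word_equiv_std_nonneg:
  assumes "(c, s @ u) \<in> chain_gens (dquot q) i" "\<forall>x\<in>set u. fst x \<ge> 0"
  shows "gen (c, s @ u) - free_scale (word_coeff u) (gen (c, s @ std_word (exponents u)))
           \<in> tensor_relations (dquot q) i"
  using assms
proof (induction u arbitrary: s)
  case Nil
  then show ?case by (simp add: std_word_def tensor_relations_0)
next
  case (Cons x u)
  obtain k a where x: "x = (k, a)" by force
  have k: "\<not> k < 0" "int (nat k) = k" using Cons.prems(2) by (simp_all add: x)
  let ?y = "(k, monom 1 (nat k)) :: int \<times> 'a poly"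
  have "a \<in> dg_comp (dquot q) k" using Cons.prems(1) by (auto simp: x chain_gens_def)
  define r where "r = letter_coeff x"
  from dquot_comp_monom[OF \<open>a \<in> dg_comp (dquot q) k\<close>, folded x, folded r_def]
  have a: "a = dg_scale (dquot q) r (monom 1 (nat k))"
    by (simp add: dquot_def smult_monom)
  have g: "(c, s @ ?y # u) \<in> chain_gens (dquot q) i"
    using Cons.prems(1) k(1) by (auto simp: x chain_gens_def word_degree_def dquot_def)
  have 1: "gen (c, s @ x # u) - free_scale r (gen (c, s @ ?y # u)) \<in> tensor_relations (dquot q) i"
    using scale_relation_in_tensor_relations[OF g, of r] unfolding x a .
  have "gen (c, (s @ [?y]) @ u) - free_scale (word_coeff u) (gen (c, (s @ [?y]) @ std_word (exponents u)))
           \<in> tensor_relations (dquot q) i"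
    by (rule Cons.IH) (use g Cons.prems in auto)
  then have 2: "free_scale r (gen (c, s @ ?y # u) -
      free_scale (word_coeff u) (gen (c, s @ ?y # std_word (exponents u)))) \<in> tensor_relations (dquot q) i"
    by (intro tensor_relations_scale) simp
  have "std_word (exponents (x # u)) = ?y # std_word (exponents u)"
    using k by (simp add: x std_word_def)
  then show ?case
    using tensor_relations_add[OF 1 2] by (simp add: free_scale_diff free_scale_free_scale r_def)
qed

lemma word_equiv_std:
  assumes "(c, w) \<in> chain_gens (dquot q) i"
  shows "gen (c, w) - free_scale (word_coeff w) (gen (c, std_word (exponents w)))
           \<in> tensor_relations (dquot q) i"
proof (cases "\<forall>x\<in>set w. fst x \<ge> 0")
  case True
  then show ?thesis using word_equiv_std_nonneg[of c "[]" w] assms by simp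
next
  case False
  then obtain k a where ka: "(k, a) \<in> set w" "k < 0" by force
  then obtain u v where w: "w = u @ (k, a) # v" by (meson split_list)
  have a: "a = 0" using assms ka by (auto simp: w chain_gens_def dquot_def split: if_splits)
  then have "word_coeff w = 0" using ka by (simp add: w)
  moreover have "gen (c, w) \<in> tensor_relations (dquot q) i"
    using scale_relation_in_tensor_relations[of c u k a v "dquot q" i 0] assms
    by (simp add: w a dquot_def)
  ultimately show ?thesis by simp
qed

text \<open>Modulo the relations a chain equals the combination of standard words \<open>x^m\<^sub>0 \<otimes> \<dots> \<otimes> x^m\<^sub>n\<close> given by its
  monomial coordinates, and the pairing with indicator functions reads off these coordinates.\<close>

lemma tensor_relations_iff:
  assumes "x \<in> free_chains (dquot q) i"
  shows "x \<in> tensor_relations (dquot q) i \<longleftrightarrow> (\<forall>\<phi>. pairing \<phi> x = 0)"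
proof
  assume null: "\<forall>\<phi>. pairing \<phi> x = 0"
  define \<sigma> where "\<sigma> = (\<lambda>(c, w). free_scale (word_coeff w) (gen (c, std_word (exponents w)))
     :: ('a poly, 'a) chain)"
  have x: "x = (\<Sum>g\<in>Poly_Mapping.keys x. free_scale (Poly_Mapping.lookup x g) (gen g))"
    by (rule poly_mapping_eqI)
      (auto simp: lookup_sum lookup_free_scale lookup_single when_def in_keys_iff
        if_distrib[of "(*) _"] cong: if_cong)
  have "linear_ext \<sigma> x = 0"
  proof (rule poly_mapping_eqI)
    fix h :: "nat \<times> 'a poly word"
    have "Poly_Mapping.lookup (linear_ext \<sigma> x) h =
        pairing (\<lambda>c u. if (c, std_word u) = h then 1 else 0) x"
      unfolding lookup_linear_ext pairing_def
      by (rule lin_fun_cong)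
        (auto simp: \<sigma>_def word_fun_def lookup_free_scale lookup_single when_def)
    then show "Poly_Mapping.lookup (linear_ext \<sigma> x) h = Poly_Mapping.lookup 0 h"
      using null by simp
  qed
  then have "x = (\<Sum>g\<in>Poly_Mapping.keys x. free_scale (Poly_Mapping.lookup x g) (gen g - \<sigma> g))"
    using x by (simp add: free_scale_diff sum_subtractf linear_ext_def)
  also have "\<dots> \<in> tensor_relations (dquot q) i"
    by (intro tensor_relations_sum tensor_relations_scale)
      (use assms in \<open>auto simp: \<sigma>_def free_chains_def intro!: word_equiv_std\<close>)
  finally show "x \<in> tensor_relations (dquot q) i" .
qed (use pairing_tensor_relations in blast)

lemma free_chains_add: "x \<in> free_chains A i \<Longrightarrow> y \<in> free_chains A i \<Longrightarrow> x + y \<in> free_chains A i"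
  and free_chains_diff: "x \<in> free_chains A i \<Longrightarrow> y \<in> free_chains A i \<Longrightarrow> x - y \<in> free_chains A i"
  and free_chains_scale: "x \<in> free_chains A i \<Longrightarrow> free_scale r x \<in> free_chains A i"
  and free_chains_sum: "(\<And>j. j \<in> I \<Longrightarrow> f j \<in> free_chains A i) \<Longrightarrow> (\<Sum>j\<in>I. f j) \<in> free_chains A i"
  and free_chains_0: "0 \<in> free_chains A i"
  unfolding free_chains_supported
  by (auto intro: supported_add supported_diff supported_scale supported_sum)

lemma cycles_iff:
  "x \<in> cycles (dquot q) i \<longleftrightarrow> x \<in> free_chains (dquot q) i \<and> (\<forall>\<phi>. pairing (cotot q \<phi>) x = 0)"
  using total_diff_free_chains[OF dg_algebra_dquot, of x q i]
  by (auto simp: cycles_def tensor_relations_iff pairing_total_diff)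

lemma boundaries_iff:
  assumes "x \<in> free_chains (dquot q) i"
  shows "x \<in> boundaries (dquot q) i \<longleftrightarrow>
     (\<exists>w\<in>free_chains (dquot q) (i + 1). \<forall>\<phi>. pairing \<phi> x = pairing (cotot q \<phi>) w)"
proof
  assume "x \<in> boundaries (dquot q) i"
  then obtain w t where "x = total_diff (dquot q) w + t" "w \<in> free_chains (dquot q) (i + 1)"
      "t \<in> tensor_relations (dquot q) i"
    by (auto simp: boundaries_def set_plus_def)
  then show "\<exists>w\<in>free_chains (dquot q) (i + 1). \<forall>\<phi>. pairing \<phi> x = pairing (cotot q \<phi>) w"
    by (auto simp: pairing_total_diff pairing_tensor_relations)
next
  assume "\<exists>w\<in>free_chains (dquot q) (i + 1). \<forall>\<phi>. pairing \<phi> x = pairing (cotot q \<phi>) w"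
  then obtain w where w: "w \<in> free_chains (dquot q) (i + 1)" "\<And>\<phi>. pairing \<phi> x = pairing (cotot q \<phi>) w"
    by blast
  have "x - total_diff (dquot q) w \<in> free_chains (dquot q) i"
    using total_diff_free_chains[OF dg_algebra_dquot w(1)] assms by (auto intro: free_chains_diff)
  then have "x - total_diff (dquot q) w \<in> tensor_relations (dquot q) i"
    using w by (simp add: tensor_relations_iff pairing_total_diff)
  then have "total_diff (dquot q) w + (x - total_diff (dquot q) w) \<in> boundaries (dquot q) i"
    unfolding boundaries_def using w(1) by (intro set_plus_intro) auto
  then show "x \<in> boundaries (dquot q) i" by simp
qed

section \<open>Reduction to the small complex\<close>

definition cohomotopy :: "(nat \<Rightarrow> nat list \<Rightarrow> 'r::comm_ring_1) \<Rightarrow> nat \<Rightarrow> nat list \<Rightarrow> 'r" where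
  "cohomotopy \<phi> c u = (if odd c then - \<phi> c (0 # u) else cohom (\<phi> c) u)"

text \<open>On odd columns this is \<open>- 1 \<otimes> -\<close>. A single factor in an even column survives in the small
  complex, so the homotopy is zero there.\<close>

definition homotopy_gen :: "nat \<Rightarrow> nat list \<Rightarrow> ('r::comm_ring_1 poly, 'r) chain" where
  "homotopy_gen c w =
     (let v = butlast w; m = last w; \<epsilon> = (-1) ^ Suc (sum_list w) in
      if odd c then - gen (c, std_word (0 # w))
      else if length w \<le> 1 then 0
      else free_scale ((-1) ^ length v)
        ((\<Sum>r<m. free_scale (\<epsilon> ^ r) (gen (c, std_word (add_head r v @ [m - 1 - r, 1]))))
           - free_scale (\<epsilon> ^ m) (gen (c, std_word (add_head m v @ [0, 0])))))"

lemma pairing_homotopy_gen: "pairing \<phi> (homotopy_gen c u) = cohomotopy \<phi> c u"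
  by (simp add: homotopy_gen_def cohomotopy_def cohom_def Let_def)

lemma homotopy_gen_free_chains:
  assumes "ms \<noteq> []" "int c + (int (length ms) - 1) + int (sum_list ms) = i"
  shows "homotopy_gen c ms \<in> free_chains (dquot q) (i + 1)"
proof -
  have neg: "- x \<in> free_chains (dquot q) j" if "x \<in> free_chains (dquot q) j"
    for x :: "('a poly, 'a) chain" and j
    using free_chains_scale[OF that, of "-1"] by (simp add: free_scale_minus_one)
  show ?thesis
  proof (cases "odd c \<or> length ms \<le> 1")
    case True
    then show ?thesis using assms
      by (auto simp: homotopy_gen_def Let_def free_chains_0 intro!: neg std_word_free_chains)
  next
    case False
    then obtain v m where ms: "ms = v @ [m]" and v: "v \<noteq> []"
      by (cases ms rule: rev_cases) auto
    show ?thesis using False assms(2) v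
      by (auto simp: homotopy_gen_def Let_def ms of_nat_diff
          intro!: free_chains_scale free_chains_diff free_chains_sum std_word_free_chains)
  qed
qed

definition homotopy :: "('r::comm_ring_1 poly, 'r) chain \<Rightarrow> ('r poly, 'r) chain" where
  "homotopy = linear_ext (\<lambda>(c, w). free_scale (word_coeff w) (homotopy_gen c (exponents w)))"

lemma pairing_homotopy: "pairing \<phi> (homotopy x) = pairing (cohomotopy \<phi>) x"
proof -
  have "pairing \<phi> (homotopy x) = lin_fun (\<lambda>g. pairing \<phi>
      (case g of (c, w) \<Rightarrow> free_scale (word_coeff w) (homotopy_gen c (exponents w)))) x"
    unfolding homotopy_def pairing_def lin_fun_linear_ext ..
  also have "\<dots> = pairing (cohomotopy \<phi>) x"
    unfolding pairing_def[of "cohomotopy \<phi>"]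
    by (rule lin_fun_cong) (auto simp: pairing_homotopy_gen word_fun_def)
  finally show ?thesis .
qed

lemma homotopy_free_chains:
  assumes "x \<in> free_chains (dquot q) i"
  shows "homotopy x \<in> free_chains (dquot q) (i + 1)"
  using assms unfolding homotopy_def free_chains_supported
proof (rule supported_linear_ext)
  fix g assume g: "g \<in> chain_gens (dquot q) i"
  obtain c w where cw: "g = (c, w)" by force
  show "(case g of (c, w) \<Rightarrow> free_scale (word_coeff w) (homotopy_gen c (exponents w)))
     \<in> supported (chain_gens (dquot q) (i + 1))"
  proof (cases "word_coeff w = 0")
    case False
    then have "homotopy_gen c (exponents w) \<in> free_chains (dquot q) (i + 1)"
      using g word_degree_exponents[OF False]
      by (intro homotopy_gen_free_chains) (auto simp: cw chain_gens_def)
    then show ?thesis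
      by (simp add: cw free_chains_supported[symmetric] free_chains_scale)
  qed (simp add: cw)
qed

lemma cobar_Cons:
  assumes "u \<noteq> []"
  shows "cobar F (a # u) = F (add_head a u) - cobar (\<lambda>v. F (a # v)) u"
proof -
  obtain b v where u: "u = b # v" using assms by (cases u) auto
  have "coface (Suc i) F (a # u) = - coface i (\<lambda>v. F (a # v)) u" if "i < length v" for i
    using that by (simp add: coface_def u)
  moreover have "coface 0 F (a # u) = F (add_head a u)"
    by (simp add: coface_def u add.commute)
  ultimately show ?thesis
    by (simp add: cobar_def u sum.lessThan_Suc_shift sum_negf del: sum.lessThan_Suc)
qed

lemma cohom_cong:
  assumes "\<And>v. v \<noteq> [] \<Longrightarrow> sum_list v = sum_list u \<Longrightarrow> F v = G v"
  shows "cohom F u = cohom G u"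
proof (cases "length u \<le> 1")
  case False
  then obtain v m where u: "u = v @ [m]" and v: "v \<noteq> []"
    by (cases u rule: rev_cases) auto
  have "F (add_head r v @ [m - 1 - r, 1]) = G (add_head r v @ [m - 1 - r, 1])" if "r < m" for r
    by (rule assms) (use v that in \<open>auto simp: u\<close>)
  moreover have "F (add_head m v @ [0, 0]) = G (add_head m v @ [0, 0])"
    by (rule assms) (use v in \<open>auto simp: u\<close>)
  ultimately show ?thesis by (simp add: u cohom_snoc[OF v])
qed (simp add: cohom_def Let_def)

lemma cohom_0: "cohom (\<lambda>_. 0) u = 0"
  by (simp add: cohom_def Let_def)

text \<open>Tensors are ordered by column first and by weight (the sum of the exponents) second. A chain
  pairs to zero with all functions that vanish below \<open>(c, m)\<close> iff it only involves tensors
  strictly below \<open>(c, m)\<close>; this is how filtration steps are expressed.\<close>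

definition vanishes_below :: "nat \<Rightarrow> nat \<Rightarrow> (nat \<Rightarrow> nat list \<Rightarrow> 'r::comm_ring_1) \<Rightarrow> bool" where
  "vanishes_below c m \<phi> \<longleftrightarrow>
     (\<forall>c' u. u \<noteq> [] \<longrightarrow> c' < c \<or> c' = c \<and> sum_list u < m \<longrightarrow> \<phi> c' u = 0)"

lemma vanishes_belowD:
  "vanishes_below c m \<phi> \<Longrightarrow> u \<noteq> [] \<Longrightarrow> c' < c \<or> c' = c \<and> sum_list u < m \<Longrightarrow> \<phi> c' u = 0"
  by (auto simp: vanishes_below_def)

lemma vanishes_below_cotot:
  assumes "vanishes_below c m \<phi>"
  shows "vanishes_below c m (cotot q \<phi>)"
  unfolding vanishes_below_def
proof (intro allI impI)
  fix c' :: nat and u :: "nat list" assume u: "u \<noteq> []" "c' < c \<or> c' = c \<and> sum_list u < m"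
  have "cotot q \<phi> c' u = cotot q (\<lambda>_ _. 0) c' u"
    by (rule cotot_cong) (use u in \<open>auto intro!: vanishes_belowD[OF assms]\<close>)
  then show "cotot q \<phi> c' u = 0" by (simp add: cotot_zero)
qed

lemma vanishes_below_cohomotopy:
  assumes "vanishes_below c m \<phi>"
  shows "vanishes_below c m (cohomotopy \<phi>)"
  unfolding vanishes_below_def
proof (intro allI impI)
  fix c' :: nat and u :: "nat list" assume u: "u \<noteq> []" "c' < c \<or> c' = c \<and> sum_list u < m"
  have "cohom (\<phi> c') u = cohom (\<lambda>_. 0) u"
    by (rule cohom_cong) (use u in \<open>auto intro!: vanishes_belowD[OF assms]\<close>)
  moreover have "\<phi> c' (0 # u) = 0"
    by (rule vanishes_belowD[OF assms]) (use u in auto)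
  ultimately show "cohomotopy \<phi> c' u = 0" by (simp add: cohomotopy_def cohom_0)
qed

lemma cotot_leading:
  assumes "vanishes_below c m \<phi>" "sum_list u = m" "u \<noteq> []"
  shows "cotot q \<phi> c u = (if even c then cohoch (\<phi> c) u else - cobar (\<phi> c) u)"
proof -
  have "codiff q (\<phi> c) u = codiff q (\<lambda>_. 0) u"
  proof (rule codiff_cong)
    fix v assume "length v = length u" "Suc (sum_list v) = sum_list u"
    then show "\<phi> c v = 0"
      using assms(2,3) by (intro vanishes_belowD[OF assms(1)]) auto
  qed
  moreover have "conorm (\<phi> (c - 1)) u = conorm (\<lambda>_. 0) u" if "c \<noteq> 0"
    by (rule conorm_cong, rule vanishes_belowD[OF assms(1)])
      (use assms(3) that in \<open>auto simp flip: length_greater_0_conv\<close>)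
  moreover have "cocyc (\<phi> (c - 1)) u = cocyc (\<lambda>_. 0) u" if "c \<noteq> 0"
    by (rule cocyc_cong, rule vanishes_belowD[OF assms(1)])
      (use assms(3) that in \<open>auto simp flip: length_greater_0_conv\<close>)
  moreover have "\<phi> (c - 1) u = 0" if "c \<noteq> 0"
    by (rule vanishes_belowD[OF assms(1)]) (use assms(3) that in auto)
  ultimately show ?thesis
    by (cases "c = 0") (simp_all add: cotot_def codiff_linear conorm_linear cocyc_linear)
qed

text \<open>To leading order only the maps within a column and without the internal differential matter,
  since all others lower the column or the weight. In this approximation \<open>1 - D h - h D\<close> is zero on
  odd columns and factors through the coordinates of \<open>u\<^bsub>m,c\<^esub>\<close> and \<open>u\<^bsub>m,c+1\<^esub>\<close> on an even column \<open>c\<close>.\<close>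

lemma homotopy_leading:
  assumes van: "vanishes_below c m \<phi>" and u: "u \<noteq> []" "c' < c \<or> c' = c \<and> sum_list u < Suc m"
  shows "\<phi> c' u - cohomotopy (cotot q \<phi>) c' u - cotot q (cohomotopy \<phi>) c' u =
     (if even c then \<phi> c [m] * small_coord m c c' u + \<phi> c [m - 1, 1] * small_coord m (Suc c) c' u else 0)"
proof (cases "c' = c \<and> sum_list u = m")
  case False
  then have *: "c' < c \<or> c' = c \<and> sum_list u < m" using u by auto
  then have "small_coord m c c' u = (0 :: 'a)" if "even c"
    using that by (auto simp: small_coord_def)
  moreover have "small_coord m (Suc c) c' u = (0 :: 'a)" if "even c"
    using * that by (auto simp: small_coord_def split: list.splits)
  moreover have "\<phi> c' u = 0" "cohomotopy (cotot q \<phi>) c' u = 0" "cotot q (cohomotopy \<phi>) c' u = 0"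
    using * u(1) by (auto intro: vanishes_belowD[OF van]
        vanishes_belowD[OF vanishes_below_cotot[OF vanishes_below_cohomotopy[OF van]]]
        vanishes_belowD[OF vanishes_below_cohomotopy[OF vanishes_below_cotot[OF van]]])
  ultimately show ?thesis by simp
next
  case True
  then have c': "c' = c" and sum: "sum_list u = m" by auto
  show ?thesis
  proof (cases "odd c")
    case True
    have "cotot q (cohomotopy \<phi>) c u = - cobar (cohomotopy \<phi> c) u"
      using cotot_leading[OF vanishes_below_cohomotopy[OF van] sum u(1)] True by simp
    also have "cobar (cohomotopy \<phi> c) u = - cobar (\<lambda>v. \<phi> c (0 # v)) u"
      using True by (simp add: cohomotopy_def[abs_def] cobar_linear)
    finally have 1: "cotot q (cohomotopy \<phi>) c u = cobar (\<lambda>v. \<phi> c (0 # v)) u" by simp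
    have "cohomotopy (cotot q \<phi>) c u = cobar (\<phi> c) (0 # u)"
      using cotot_leading[OF van, of "0 # u" q] sum True by (simp add: cohomotopy_def)
    also have "\<dots> = \<phi> c u - cobar (\<lambda>v. \<phi> c (0 # v)) u"
      using u(1) by (simp add: cobar_Cons)
    finally show ?thesis using 1 True by (simp add: c')
  next
    case False
    have top: "cotot q (cohomotopy \<phi>) c u = cohoch (cohomotopy \<phi> c) u"
      using cotot_leading[OF vanishes_below_cohomotopy[OF van] sum u(1)] False by simp
    have "cohomotopy \<phi> c = cohom (\<phi> c)"
      using False by (simp add: cohomotopy_def[abs_def])
    with top have D: "cotot q (cohomotopy \<phi>) c u = cohoch (cohom (\<phi> c)) u" by simp
    have H: "cohomotopy (cotot q \<phi>) c u = cohom (cohoch (\<phi> c)) u"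
      using False cotot_leading[OF van] sum
      by (auto simp: cohomotopy_def intro!: cohom_cong)
    consider "u = [m]" | a b where "u = [a, b]" | "length u \<ge> 3"
    proof (cases u rule: remdups_adj.cases)
      case (3 a b w)
      then show ?thesis using that by (cases w) auto
    qed (use u sum that in auto)
    then show ?thesis
    proof cases
      case 1
      then show ?thesis using False unfolding c' D H
        by (simp add: small_coord_def cohom_def)
    next
      case (2 a b)
      have "cohoch (cohom (\<phi> c)) u = cohoch (\<lambda>_. 0) u"
        by (rule cohoch_cong) (use 2 in \<open>auto simp: cohom_def Let_def\<close>)
      then have "cohoch (cohom (\<phi> c)) u = 0" by (simp add: cohoch_linear)
      then show ?thesis
        using False sum cohom_homotopy_pair[of "\<phi> c" a b]
        unfolding c' D H
        by (simp add: small_coord_def 2 mult.commute)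
    next
      case 3
      have "small_coord m c c u = (0 :: 'a)" "small_coord m (Suc c) c u = (0 :: 'a)"
        using 3 False by (auto simp: small_coord_def split: list.splits)
      then show ?thesis using cohom_homotopy[OF 3, of "\<phi> c"] False unfolding c' D H
        by (simp add: algebra_simps)
    qed
  qed
qed

lemma small_coord_homotopy:
  assumes "x \<in> free_chains (dquot q) i"
  shows "pairing (small_coord n s) (homotopy x) = 0"
proof -
  have "cohomotopy (small_coord n s) c u = (0 :: 'a)" if u: "u \<noteq> []" for c u
  proof (cases "even c \<and> length u > 1")
    case True
    then obtain v m where uv: "u = v @ [m]" and v: "v \<noteq> []"
      by (cases u rule: rev_cases) auto
    have *: "small_coord n s c (add_head r v @ [a, b]) = (0 :: 'a)" for r a b
      using v True by (cases v) (auto simp: small_coord_def split: list.splits)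
    show ?thesis using True v by (simp add: cohomotopy_def uv cohom_snoc * del: One_nat_def)
  next
    case False
    then show ?thesis using u
      by (auto simp: cohomotopy_def cohom_def small_coord_def Let_def split: list.splits)
  qed
  then have "pairing (cohomotopy (small_coord n s)) x = pairing (\<lambda>_ _. 0) x"
    by (intro pairing_cong[OF assms]) auto
  then show ?thesis by (simp add: pairing_homotopy pairing_fun_linear)
qed

lemma pairing_cotot_cotot:
  assumes "x \<in> free_chains (dquot q) i"
  shows "pairing (cotot q (cotot q \<phi>)) x = 0"
proof -
  have "pairing (cotot q (cotot q \<phi>)) x = pairing (\<lambda>_ _. 0) x"
    by (rule pairing_cong[OF assms]) (rule cotot_cotot)
  then show ?thesis by (simp add: pairing_fun_linear)
qed

lemma pairing_cotot_small_coord: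
  assumes "x \<in> free_chains (dquot q) i"
  shows "pairing (cotot q (small_coord n s)) x =
    (if even n \<and> even s then 2 * pairing (small_coord n (Suc s)) x + q * pairing (small_coord (Suc n) s) x
     else if odd n \<and> odd s then of_nat n * pairing (small_coord n (Suc s)) x - q * pairing (small_coord (Suc n) s) x
     else 0)"
proof -
  have "pairing (cotot q (small_coord n s)) x =
      pairing (\<lambda>c u. if even n \<and> even s then 2 * small_coord n (Suc s) c u + q * small_coord (Suc n) s c u
        else if odd n \<and> odd s then of_nat n * small_coord n (Suc s) c u - q * small_coord (Suc n) s c u
        else 0) x"
    by (rule pairing_cong[OF assms]) (rule cotot_small_coord)
  then show ?thesis
    by (cases "even n"; cases "even s") (simp_all add: pairing_fun_linear)
qed

text \<open>A cycle \<open>z\<close> in the kernel of the projection may be replaced by \<open>z - D h z\<close>, which is again one and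
  lies one step lower in the filtration. Columns and weights are bounded in a given degree, so this
  ends with zero. The bounding chain can be kept in the kernel, because the projection kills \<open>h\<close>;
  this is needed to lift cycles from the small complex.\<close>

theorem small_coord_kernel_acyclic:
  fixes z :: "('r::comm_ring_1 poly, 'r) chain"
  assumes "z \<in> free_chains (dquot q) i" "\<And>\<phi>. pairing (cotot q \<phi>) z = 0"
    "\<And>n s. pairing (small_coord n s) z = 0"
  shows "\<exists>w\<in>free_chains (dquot q) (i + 1).
     (\<forall>n s. pairing (small_coord n s) w = 0) \<and> (\<forall>\<phi>. pairing \<phi> z = pairing (cotot q \<phi>) w)"
proof -
  define filtered where "filtered = (\<lambda>c m (z :: ('r poly, 'r) chain).
     \<forall>\<phi>. vanishes_below c m \<phi> \<longrightarrow> pairing \<phi> z = 0)"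
  define good where "good = (\<lambda>z :: ('r poly, 'r) chain. z \<in> free_chains (dquot q) i \<and>
     (\<forall>\<phi>. pairing (cotot q \<phi>) z = 0) \<and> (\<forall>n s. pairing (small_coord n s) z = 0))"
  define bounds where "bounds = (\<lambda>z :: ('r poly, 'r) chain. \<exists>w\<in>free_chains (dquot q) (i + 1).
     (\<forall>n s. pairing (small_coord n s) w = 0) \<and> (\<forall>\<phi>. pairing \<phi> z = pairing (cotot q \<phi>) w))"
  have step: "bounds z" if IH: "\<And>z. good z \<Longrightarrow> filtered c m z \<Longrightarrow> bounds z"
    and z: "good z" "filtered c (Suc m) z" for c m z
  proof -
    define z' where "z' = z - total_diff (dquot q) (homotopy z)"
    have zf: "z \<in> free_chains (dquot q) i" using z(1) by (simp add: good_def)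
    have hf: "homotopy z \<in> free_chains (dquot q) (i + 1)" by (rule homotopy_free_chains[OF zf])
    have z': "pairing \<phi> z' = pairing \<phi> z - pairing (cotot q \<phi>) (homotopy z)" for \<phi>
      by (simp add: z'_def pairing_total_diff[OF hf])
    have "good z'"
    proof -
      have "z' \<in> free_chains (dquot q) i"
        unfolding z'_def using total_diff_free_chains[OF dg_algebra_dquot hf] zf by (auto intro: free_chains_diff)
      moreover have "pairing (cotot q \<phi>) z' = 0" for \<phi>
        using z(1) by (simp add: z' good_def pairing_cotot_cotot[OF hf])
      moreover have "pairing (small_coord n s) z' = 0" for n s
        using z(1) by (simp add: z' good_def pairing_cotot_small_coord[OF hf] small_coord_homotopy[OF zf])
      ultimately show ?thesis by (simp add: good_def)
    qed
    moreover have "filtered c m z'"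
      unfolding filtered_def
    proof (intro allI impI)
      fix \<phi> :: "nat \<Rightarrow> nat list \<Rightarrow> 'r" assume van: "vanishes_below c m \<phi>"
      define G where "G = (\<lambda>c' u. if even c
        then \<phi> c [m] * small_coord m c c' u + \<phi> c [m - 1, 1] * small_coord m (Suc c) c' u else 0)"
      have "vanishes_below c (Suc m)
        (\<lambda>c' u. \<phi> c' u - cohomotopy (cotot q \<phi>) c' u - cotot q (cohomotopy \<phi>) c' u - G c' u)"
        unfolding vanishes_below_def G_def using homotopy_leading[OF van] by simp
      then have "pairing (\<lambda>c' u. \<phi> c' u - cohomotopy (cotot q \<phi>) c' u - cotot q (cohomotopy \<phi>) c' u - G c' u) z = 0"
        using z(2) unfolding filtered_def by blast
      moreover have "pairing G z = 0"
        using z(1) by (cases "even c") (simp_all add: G_def pairing_fun_linear good_def)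
      moreover have "pairing (cotot q (cohomotopy \<phi>)) z = 0"
        using z(1) by (simp add: good_def)
      ultimately show "pairing \<phi> z' = 0"
        by (simp add: pairing_fun_linear z' pairing_homotopy)
    qed
    ultimately obtain w where w: "w \<in> free_chains (dquot q) (i + 1)"
      "\<And>n s. pairing (small_coord n s) w = 0" "\<And>\<phi>. pairing \<phi> z' = pairing (cotot q \<phi>) w"
      using IH unfolding bounds_def by blast
    show ?thesis
      unfolding bounds_def
    proof (intro bexI conjI allI)
      show "w + homotopy z \<in> free_chains (dquot q) (i + 1)"
        using w(1) hf by (rule free_chains_add)
      show "pairing (small_coord n s) (w + homotopy z) = 0" for n s
        using w(2) by (simp add: small_coord_homotopy[OF zf])
      show "pairing \<phi> z = pairing (cotot q \<phi>) (w + homotopy z)" for \<phi>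
        using w(3)[of \<phi>] by (simp add: z' algebra_simps)
    qed
  qed
  have main: "bounds z" if "good z" "filtered c 0 z" for c z
    using that
  proof (induction c arbitrary: z)
    case 0
    then have "pairing \<phi> z = 0" for \<phi>
      by (simp add: filtered_def vanishes_below_def)
    then show ?case unfolding bounds_def
      by (intro bexI[of _ 0]) (auto simp: free_chains_0)
  next
    case (Suc c)
    have inner: "bounds z" if "good z" "filtered c m z" for m z
      using that
    proof (induction m arbitrary: z)
      case 0
      then show ?case by (rule Suc.IH)
    next
      case (Suc m)
      then show ?case using step[of c m z] by blast
    qed
    have "filtered c (nat (i + 1)) z"
      unfolding filtered_def
    proof (intro allI impI)
      fix \<phi> :: "nat \<Rightarrow> nat list \<Rightarrow> 'r" assume van: "vanishes_below c (nat (i + 1)) \<phi>"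
      define \<phi>' where "\<phi>' = (\<lambda>c' u. if c' \<le> c then 0 else \<phi> c' u)"
      have "pairing \<phi> z = pairing \<phi>' z"
      proof (rule pairing_cong)
        show "z \<in> free_chains (dquot q) i" using Suc.prems by (simp add: good_def)
        fix c' and u :: "nat list"
        assume u: "u \<noteq> []" "int c' + (int (length u) - 1) + int (sum_list u) = i"
        then have "length u \<ge> 1" by (cases u) auto
        then have "int (sum_list u) \<le> i" using u by linarith
        then show "\<phi> c' u = \<phi>' c' u"
          using vanishes_belowD[OF van u(1), of c'] zless_nat_eq_int_zless[of "sum_list u" "i + 1"]
          by (cases "c' \<le> c") (auto simp: \<phi>'_def le_less)
      qed
      also have "vanishes_below (Suc c) 0 \<phi>'"
        by (auto simp: vanishes_below_def \<phi>'_def)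
      then have "pairing \<phi>' z = 0" using Suc.prems by (simp add: filtered_def)
      finally show "pairing \<phi> z = 0" .
    qed
    then show ?case using Suc.prems inner by blast
  qed
  have "filtered (nat (i + 1)) 0 z"
    unfolding filtered_def
  proof (intro allI impI)
    fix \<phi> :: "nat \<Rightarrow> nat list \<Rightarrow> 'r" assume van: "vanishes_below (nat (i + 1)) 0 \<phi>"
    have "pairing \<phi> z = pairing (\<lambda>_ _. 0) z"
    proof (rule pairing_cong[OF assms(1)])
      fix c' and u :: "nat list"
      assume u: "u \<noteq> []" "int c' + (int (length u) - 1) + int (sum_list u) = i"
      then have "length u \<ge> 1" by (cases u) auto
      then have "c' < nat (i + 1)" using u by linarith
      then show "\<phi> c' u = 0" using vanishes_belowD[OF van u(1), of c'] by auto
    qed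
    then show "pairing \<phi> z = 0" by (simp add: pairing_fun_linear)
  qed
  then have "bounds z" by (intro main) (use assms in \<open>auto simp: good_def\<close>)
  then show ?thesis by (simp add: bounds_def)
qed

section \<open>Cycles and boundaries\<close>

lemma pairing_small_coord_degree:
  assumes "x \<in> free_chains (dquot q) i" "int (n + s) \<noteq> i"
  shows "pairing (small_coord n s) x = 0"
proof -
  have "pairing (small_coord n s) x = pairing (\<lambda>_ _. 0) x"
    by (rule pairing_cong[OF assms(1)]) (use assms(2) in \<open>auto simp: small_coord_def split: list.splits\<close>)
  then show ?thesis by (simp add: pairing_fun_linear)
qed

lemma small_coord_0_odd: "odd s \<Longrightarrow> u \<noteq> [] \<Longrightarrow> small_coord 0 s c u = 0"
  by (auto simp: small_coord_def diff_coeff_def split: list.splits)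

lemma pairing_small_coord_0_odd:
  assumes "x \<in> free_chains (dquot q) i" "odd s"
  shows "pairing (small_coord 0 s) x = 0"
proof -
  have "pairing (small_coord 0 s) x = pairing (\<lambda>_ _. 0) x"
    by (rule pairing_cong[OF assms(1)]) (use assms(2) in \<open>auto intro: small_coord_0_odd\<close>)
  then show ?thesis by (simp add: pairing_fun_linear)
qed

lemma cycle_in_boundaries:
  assumes "z \<in> cycles (dquot q) i" "\<And>n s. int (n + s) = i \<Longrightarrow> pairing (small_coord n s) z = 0"
  shows "z \<in> boundaries (dquot q) i"
proof -
  have z: "z \<in> free_chains (dquot q) i" "\<And>\<phi>. pairing (cotot q \<phi>) z = 0"
    using assms(1) by (auto simp: cycles_iff)
  have "pairing (small_coord n s) z = 0" for n s
    using assms(2) pairing_small_coord_degree[OF z(1), of n s] by blast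
  then show ?thesis
    using small_coord_kernel_acyclic[OF z] by (auto simp: boundaries_iff[OF z(1)])
qed

lemma boundaries_subspace: "module.subspace free_scale (boundaries (dquot q) i)"
proof -
  have b: "x \<in> boundaries (dquot q) i \<longleftrightarrow>
      (\<exists>w t. x = total_diff (dquot q) w + t \<and> w \<in> free_chains (dquot q) (i + 1) \<and>
         t \<in> tensor_relations (dquot q) i)" for x
    by (auto simp: boundaries_def set_plus_def)
  show ?thesis
    unfolding module.subspace_def[OF module_free_scale]
  proof (intro conjI ballI allI)
    show "0 \<in> boundaries (dquot q) i"
      unfolding b by (rule exI[of _ 0])+ (simp add: total_diff_def free_chains_0 tensor_relations_0)
  next
    fix x y assume "x \<in> boundaries (dquot q) i" "y \<in> boundaries (dquot q) i"
    then obtain w t w' t' where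
      "x = total_diff (dquot q) w + t" "w \<in> free_chains (dquot q) (i + 1)" "t \<in> tensor_relations (dquot q) i"
      "y = total_diff (dquot q) w' + t'" "w' \<in> free_chains (dquot q) (i + 1)" "t' \<in> tensor_relations (dquot q) i"
      unfolding b by blast
    then show "x + y \<in> boundaries (dquot q) i"
      unfolding b by (intro exI[of _ "w + w'"] exI[of _ "t + t'"])
        (simp add: total_diff_def free_chains_add tensor_relations_add)
  next
    fix r x assume "x \<in> boundaries (dquot q) i"
    then obtain w t where
      "x = total_diff (dquot q) w + t" "w \<in> free_chains (dquot q) (i + 1)" "t \<in> tensor_relations (dquot q) i"
      unfolding b by blast
    then show "free_scale r x \<in> boundaries (dquot q) i"
      unfolding b by (intro exI[of _ "free_scale r w"] exI[of _ "free_scale r t"])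
        (simp add: total_diff_def free_chains_scale tensor_relations_scale
          module.scale_right_distrib[OF module_free_scale])
  qed
qed

lemma cycles_subspace: "module.subspace free_scale (cycles (dquot q) i)"
  unfolding module.subspace_def[OF module_free_scale]
  by (auto simp: cycles_iff intro: free_chains_0 free_chains_add free_chains_scale)

text \<open>By induction on \<open>n\<close>, the coordinates of a cycle vanish: the coefficient of \<open>d z\<close> at \<open>u\<^bsub>n,s\<^esub>\<close> combines
  the coordinate at \<open>u\<^bsub>n,s+1\<^esub>\<close>, already known to be zero, with \<open>q\<close> times the one at \<open>u\<^bsub>n+1,s\<^esub>\<close>.\<close>

theorem odd_cycle_in_boundaries:
  fixes q :: "'r::comm_ring_1"
  assumes q: "\<And>r. q * r = 0 \<Longrightarrow> r = 0" and i: "odd i" and z: "z \<in> cycles (dquot q) i"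
  shows "z \<in> boundaries (dquot q) i"
proof (rule cycle_in_boundaries[OF z])
  fix n s assume ns: "int (n + s) = i"
  have zf: "z \<in> free_chains (dquot q) i" and zc: "\<And>\<phi>. pairing (cotot q \<phi>) z = 0"
    using z by (auto simp: cycles_iff)
  from ns show "pairing (small_coord n s) z = 0"
  proof (induction n arbitrary: s)
    case 0
    then have "odd s" using i by auto
    then show ?case by (rule pairing_small_coord_0_odd[OF zf])
  next
    case (Suc n)
    then have 0: "pairing (small_coord n (Suc s)) z = 0" by simp
    have "even n = even s" using Suc.prems i by auto
    then have "q * pairing (small_coord (Suc n) s) z = 0"
      using zc[of "small_coord n s"] 0 by (auto simp: pairing_cotot_small_coord[OF zf] split: if_splits)
    then show ?case by (rule q)
  qed
qed

definition coord_zero :: "nat \<Rightarrow> ('r::comm_ring_1 poly, 'r) chain \<Rightarrow> 'r" where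
  "coord_zero N = pairing (small_coord 0 (2 * N))"

text \<open>Coordinates after the generators of even weight have been eliminated: modulo boundaries,
  \<open>2 u\<^bsub>2j+2,s\<^esub>\<close> equals \<open>q u\<^bsub>2j+1,s+1\<^esub>\<close>, and \<open>h\<close> stands for \<open>1/2\<close>.\<close>

definition coord_odd :: "'r \<Rightarrow> 'r \<Rightarrow> nat \<Rightarrow> nat \<Rightarrow> ('r::comm_ring_1 poly, 'r) chain \<Rightarrow> 'r" where
  "coord_odd q h N j z = pairing (small_coord (2 * j + 1) (2 * N - 2 * j - 1)) z
      + h * q * pairing (small_coord (2 * j + 2) (2 * N - 2 * j - 2)) z"

text \<open>The boundaries of \<open>x\<^bsup>2j+1\<^esup>\<close> in the even columns give the relations with coefficients \<open>\<rho> j\<close>, and the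
  boundaries of the generators of even weight are invisible to \<open>coord_odd\<close>. Conversely, a
  cycle whose coordinates satisfy the relations agrees, in all coordinates of the small complex,
  with the boundary of a suitable combination of both kinds of generators.\<close>

theorem even_boundaries_iff:
  fixes q h :: "'r::comm_ring_1"
  assumes h: "2 * h = 1" and z: "z \<in> cycles (dquot q) (int (2 * N))"
  shows "z \<in> boundaries (dquot q) (int (2 * N)) \<longleftrightarrow>
    (\<exists>\<rho>. coord_zero N z = q * \<rho> 0 \<and>
       (\<forall>j<N. coord_odd q h N j z = of_nat (2 * j + 1) * \<rho> j + h * q\<^sup>2 * \<rho> (Suc j)))"
    (is "_ \<longleftrightarrow> ?R")
proof
  have zf: "z \<in> free_chains (dquot q) (int (2 * N))" and zc: "\<And>\<phi>. pairing (cotot q \<phi>) z = 0"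
    using z by (auto simp: cycles_iff)
  have d: "2 * N - 2 * j - 1 = Suc (2 * N - 2 * j - 2)" "2 * N - 2 * j = Suc (2 * N - 2 * j - 1)"
      "2 * N - 2 * Suc j = 2 * N - 2 * j - 2"
    if "j < N" for j using that by auto
  {
    assume "z \<in> boundaries (dquot q) (int (2 * N))"
    then obtain w where w: "w \<in> free_chains (dquot q) (int (2 * N) + 1)"
      "\<And>\<phi>. pairing \<phi> z = pairing (cotot q \<phi>) w"
      using boundaries_iff[OF zf] by auto
    define b where "b = (\<lambda>n s. pairing (small_coord n s) w)"
    define \<rho> where "\<rho> = (\<lambda>j. b (2 * j + 1) (2 * N - 2 * j))"
    have b: "pairing (small_coord n s) z = (if even n \<and> even s then 2 * b n (Suc s) + q * b (Suc n) s
        else if odd n \<and> odd s then of_nat n * b n (Suc s) - q * b (Suc n) s else 0)" for n s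
      unfolding w(2) b_def by (rule pairing_cotot_small_coord[OF w(1)])
    have "b 0 (Suc (2 * N)) = 0"
      unfolding b_def by (rule pairing_small_coord_0_odd[OF w(1)]) simp
    then have "coord_zero N z = q * \<rho> 0"
      by (simp add: coord_zero_def b \<rho>_def)
    moreover have "coord_odd q h N j z = of_nat (2 * j + 1) * \<rho> j + h * q\<^sup>2 * \<rho> (Suc j)" if j: "j < N" for j
    proof -
      have 1: "pairing (small_coord (2 * j + 1) (2 * N - 2 * j - 1)) z =
          of_nat (2 * j + 1) * \<rho> j - q * b (2 * j + 2) (2 * N - 2 * j - 1)"
        using j d(2)[OF j] by (simp add: b \<rho>_def)
      have 2: "pairing (small_coord (2 * j + 2) (2 * N - 2 * j - 2)) z =
          2 * b (2 * j + 2) (2 * N - 2 * j - 1) + q * \<rho> (Suc j)"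
        using j d[OF j] by (simp add: b \<rho>_def)
      have "coord_odd q h N j z = of_nat (2 * j + 1) * \<rho> j + h * q\<^sup>2 * \<rho> (Suc j)
          + (2 * h - 1) * (q * b (2 * j + 2) (2 * N - 2 * j - 1))"
        unfolding coord_odd_def 1 2 by (simp only: power2_eq_square ring_distribs mult_ac) (simp add: algebra_simps)
      then show ?thesis using h by simp
    qed
    ultimately show ?R by blast
  }
  assume ?R
  then obtain \<rho> where \<rho>: "coord_zero N z = q * \<rho> 0"
    "\<And>j. j < N \<Longrightarrow> coord_odd q h N j z = of_nat (2 * j + 1) * \<rho> j + h * q\<^sup>2 * \<rho> (Suc j)"
    by blast
  \<comment> \<open>\<open>\<rho>\<close> fixes the odd weights; \<open>\<beta>\<close> then solves the equation at \<open>u\<^bsub>2j+2\<^esub>\<close> for the coefficient of \<open>x\<^bsup>2j+1\<^esup> dx\<close>.\<close>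
  define \<beta> where "\<beta> = (\<lambda>j. h * (pairing (small_coord (2 * j + 2) (2 * N - 2 * j - 2)) z - q * \<rho> (Suc j)))"
  define w :: "('r poly, 'r) chain" where "w = (\<Sum>j\<le>N. free_scale (\<rho> j) (gen (2 * N - 2 * j, std_word [2 * j + 1]))) +
     (\<Sum>j<N. free_scale (\<beta> j) (gen (2 * N - 2 * j - 2, std_word [2 * j + 1, 1])))"
  have w: "w \<in> free_chains (dquot q) (int (2 * N) + 1)"
    unfolding w_def
    by (intro free_chains_add free_chains_sum free_chains_scale std_word_free_chains) auto
  define b where "b = (\<lambda>n s. pairing (small_coord n s) w)"
  have b_eq: "b n s = (\<Sum>j\<le>N. \<rho> j * small_coord n s (2 * N - 2 * j) [2 * j + 1]) +
     (\<Sum>j<N. \<beta> j * small_coord n s (2 * N - 2 * j - 2) [2 * j + 1, 1])" for n s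
    by (simp add: b_def w_def)
  have b_odd: "b (2 * j + 1) (2 * N - 2 * j) = \<rho> j" if "j \<le> N" for j
  proof -
    have "(\<Sum>k\<le>N. \<rho> k * small_coord (2 * j + 1) (2 * N - 2 * j) (2 * N - 2 * k) [2 * k + 1]) =
       (\<Sum>k\<le>N. if k = j then \<rho> k else 0)"
      by (rule sum.cong) (use that in \<open>auto simp: small_coord_def\<close>)
    moreover have "(\<Sum>k<N. \<beta> k * small_coord (2 * j + 1) (2 * N - 2 * j) (2 * N - 2 * k - 2) [2 * k + 1, 1]) = 0"
      by (rule sum.neutral) (auto simp: small_coord_def)
    ultimately show ?thesis using that by (simp add: b_eq)
  qed
  have b_even: "b (2 * j + 2) (2 * N - 2 * j - 1) = \<beta> j" if "j < N" for j
  proof -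
    have "(\<Sum>k<N. \<beta> k * small_coord (2 * j + 2) (2 * N - 2 * j - 1) (2 * N - 2 * k - 2) [2 * k + 1, 1]) =
       (\<Sum>k<N. if k = j then \<beta> k else 0)"
      by (rule sum.cong) (use that in \<open>auto simp: small_coord_def diff_coeff_def\<close>)
    moreover have "(\<Sum>k\<le>N. \<rho> k * small_coord (2 * j + 2) (2 * N - 2 * j - 1) (2 * N - 2 * k) [2 * k + 1]) = 0"
    proof (rule sum.neutral, intro ballI)
      fix k
      have "Suc (2 * k) \<noteq> Suc (Suc (2 * j))" by presburger
      then show "\<rho> k * small_coord (2 * j + 2) (2 * N - 2 * j - 1) (2 * N - 2 * k) [2 * k + 1] = 0"
        using that by (simp add: small_coord_def)
    qed
    ultimately show ?thesis using that by (simp add: b_eq)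
  qed
  have b: "pairing (cotot q (small_coord n s)) w = (if even n \<and> even s then 2 * b n (Suc s) + q * b (Suc n) s
        else if odd n \<and> odd s then of_nat n * b n (Suc s) - q * b (Suc n) s else 0)" for n s
    unfolding b_def by (rule pairing_cotot_small_coord[OF w])
  have b0: "b 0 (Suc (2 * N)) = 0"
    unfolding b_def by (rule pairing_small_coord_0_odd[OF w]) simp
  have eq: "pairing (small_coord n s) z = pairing (cotot q (small_coord n s)) w" if ns: "n + s = 2 * N" for n s
  proof -
    consider "n = 0" | j where "n = 2 * j + 1" "j < N" | j where "n = 2 * j + 2" "j < N"
    proof (cases "n = 0")
      case False
      then obtain m where m: "n = Suc m" by (cases n) auto
      define j where "j = m div 2"
      have "m = 2 * j \<or> m = 2 * j + 1" by (auto simp: j_def)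
      then show ?thesis using that(2)[of j] that(3)[of j] m ns by auto
    qed (use that in auto)
    then show ?thesis
    proof cases
      case 1
      then show ?thesis using ns \<rho>(1) b_odd[of 0] b0 by (simp add: b coord_zero_def)
    next
      case (2 j)
      then have s: "s = 2 * N - 2 * j - 1" using ns by simp
      have "pairing (cotot q (small_coord n s)) w = of_nat (2 * j + 1) * \<rho> j - q * \<beta> j"
        using b_odd[of j] b_even[OF 2(2)] d(2)[OF 2(2)] 2 by (simp add: b s)
      also have "\<dots> = coord_odd q h N j z - h * q * pairing (small_coord (2 * j + 2) (2 * N - 2 * j - 2)) z"
        unfolding \<rho>(2)[OF 2(2)] \<beta>_def by (simp add: algebra_simps power2_eq_square)
      finally show ?thesis by (simp add: coord_odd_def s 2)
    next
      case (3 j)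
      then have s: "s = 2 * N - 2 * j - 2" using ns by simp
      have "pairing (cotot q (small_coord n s)) w = 2 * \<beta> j + q * \<rho> (Suc j)"
        using b_odd[of "Suc j"] b_even[OF 3(2)] d[OF 3(2)] 3 by (simp add: b s)
      also have "\<dots> = (2 * h) * pairing (small_coord (2 * j + 2) (2 * N - 2 * j - 2)) z + (1 - 2 * h) * (q * \<rho> (Suc j))"
        by (simp add: \<beta>_def algebra_simps)
      finally show ?thesis using h by (simp add: s 3)
    qed
  qed
  define z' where "z' = z - total_diff (dquot q) w"
  have z': "pairing \<phi> z' = pairing \<phi> z - pairing (cotot q \<phi>) w" for \<phi>
    by (simp add: z'_def pairing_total_diff[OF w])
  have "pairing (cotot q (cotot q \<phi>)) w = 0" for \<phi>
    by (rule pairing_cotot_cotot[OF w])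
  then have "z' \<in> cycles (dquot q) (int (2 * N))"
    using zf zc total_diff_free_chains[OF dg_algebra_dquot w]
    by (auto simp: cycles_iff z') (auto simp: z'_def intro: free_chains_diff)
  then have "z' \<in> boundaries (dquot q) (int (2 * N))"
    by (rule cycle_in_boundaries) (use eq in \<open>simp add: z'\<close>)
  moreover have "total_diff (dquot q) w \<in> boundaries (dquot q) (int (2 * N))"
    unfolding boundaries_def using w tensor_relations_0[of "dquot q"]
    by (metis add.right_neutral imageI set_plus_intro)
  ultimately have "z' + total_diff (dquot q) w \<in> boundaries (dquot q) (int (2 * N))"
    using boundaries_subspace unfolding module.subspace_def[OF module_free_scale] by blast
  then show "z \<in> boundaries (dquot q) (int (2 * N))" by (simp add: z'_def)
qed

text \<open>The obvious chain with the prescribed coordinates is a cycle only in the small complex. Its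
  boundary is a cycle in the kernel of the projection, hence bounds a chain of that kernel, and
  subtracting this chain gives a cycle with the same coordinates.\<close>

theorem even_cycle_exists:
  fixes q h :: "'r::comm_ring_1"
  shows "\<exists>z\<in>cycles (dquot q) (int (2 * N)). coord_zero N z = y0 \<and> (\<forall>j<N. coord_odd q h N j z = y j)"
proof -
  define z0 :: "('r poly, 'r) chain" where "z0 = free_scale y0 (gen (2 * N, std_word [0])) +
     (\<Sum>j<N. free_scale (y j) (gen (2 * N - 2 * j - 2, std_word [2 * j, 1])))"
  have z0: "z0 \<in> free_chains (dquot q) (int (2 * N))"
    unfolding z0_def
    by (intro free_chains_add free_chains_sum free_chains_scale std_word_free_chains) auto
  define a where "a = (\<lambda>n s. pairing (small_coord n s) z0)"
  have a_eq: "a n s = y0 * small_coord n s (2 * N) [0] +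
     (\<Sum>j<N. y j * small_coord n s (2 * N - 2 * j - 2) [2 * j, 1])" for n s
    by (simp add: a_def z0_def)
  have a0: "a 0 (2 * N) = y0"
  proof -
    have "(\<Sum>j<N. y j * small_coord 0 (2 * N) (2 * N - 2 * j - 2) [2 * j, 1]) = 0"
      by (rule sum.neutral) (auto simp: small_coord_def)
    then show ?thesis by (simp add: a_eq small_coord_def)
  qed
  have a_odd: "a (2 * j + 1) (2 * N - 2 * j - 1) = y j" if "j < N" for j
  proof -
    have "(\<Sum>k<N. y k * small_coord (2 * j + 1) (2 * N - 2 * j - 1) (2 * N - 2 * k - 2) [2 * k, 1]) =
       (\<Sum>k<N. if k = j then y k else 0)"
      by (rule sum.cong) (use that in \<open>auto simp: small_coord_def diff_coeff_def\<close>)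
    then show ?thesis using that by (simp add: a_eq) (auto simp: small_coord_def)
  qed
  have a_even: "a (2 * j + 2) (2 * N - 2 * j - 2) = 0" if "j < N" for j
    unfolding a_eq by (auto simp: small_coord_def intro!: sum.neutral)
  let ?x = "total_diff (dquot q) z0"
  have x: "?x \<in> free_chains (dquot q) (int (2 * N) - 1)"
    by (rule total_diff_free_chains[OF dg_algebra_dquot z0])
  have "pairing (cotot q \<phi>) ?x = 0" for \<phi>
    by (simp add: pairing_total_diff[OF z0] pairing_cotot_cotot[OF z0])
  moreover have "pairing (small_coord n s) ?x = 0" for n s
  proof -
    have "pairing (small_coord n (Suc s)) z0 = 0 \<and> pairing (small_coord (Suc n) s) z0 = 0" if "even n = even s"
      using that by (auto intro!: pairing_small_coord_degree[OF z0]) presburger+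
    then show ?thesis
      by (auto simp: pairing_total_diff[OF z0] pairing_cotot_small_coord[OF z0])
  qed
  ultimately obtain w where w: "w \<in> free_chains (dquot q) (int (2 * N))"
      "\<And>n s. pairing (small_coord n s) w = 0" "\<And>\<phi>. pairing \<phi> ?x = pairing (cotot q \<phi>) w"
    using small_coord_kernel_acyclic[OF x] by auto
  have "z0 - w \<in> cycles (dquot q) (int (2 * N))"
    using w z0 w(3) by (auto simp: cycles_iff pairing_total_diff[OF z0, symmetric] intro: free_chains_diff)
  moreover have "coord_zero N (z0 - w) = y0"
    using a0 by (simp add: coord_zero_def w(2) a_def)
  moreover have "coord_odd q h N j (z0 - w) = y j" if "j < N" for j
    using a_odd[OF that] a_even[OF that] by (simp add: coord_odd_def w(2) a_def)
  ultimately show ?thesis by blast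
qed

section \<open>Diagonalizing a bidiagonal presentation\<close>

lemma unitriangular_solvable:
  fixes \<gamma> :: "nat \<Rightarrow> 'r::comm_ring_1"
  assumes "\<gamma> 0 = 1"
  shows "\<exists>x. \<forall>j<N. (\<Sum>k<N - j. \<gamma> k * x (j + k)) = b j"
proof (induction N arbitrary: b)
  case (Suc N)
  obtain x where x: "\<And>j. j < N \<Longrightarrow> (\<Sum>k<N - j. \<gamma> k * x (j + k)) = b (Suc j)"
    using Suc[of "\<lambda>j. b (Suc j)"] by blast
  define x' where "x' = (\<lambda>j. case j of 0 \<Rightarrow> b 0 - (\<Sum>k<N. \<gamma> (Suc k) * x k) | Suc j \<Rightarrow> x j)"
  have "(\<Sum>k<Suc N - j. \<gamma> k * x' (j + k)) = b j" if "j < Suc N" for j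
  proof (cases j)
    case 0
    then show ?thesis
      by (simp add: sum.lessThan_Suc_shift x'_def assms del: sum.lessThan_Suc)
  next
    case (Suc i)
    then show ?thesis using x[of i] that by (simp add: x'_def)
  qed
  then show ?case by blast
qed simp

lemma unitriangular_injective:
  fixes \<gamma> :: "nat \<Rightarrow> 'r::comm_ring_1"
  assumes "\<gamma> 0 = 1" "\<And>j. j < N \<Longrightarrow> (\<Sum>k<N - j. \<gamma> k * x (j + k)) = (\<Sum>k<N - j. \<gamma> k * y (j + k))" "j < N"
  shows "x j = y j"
  using assms(2,3)
proof (induction N arbitrary: x y j)
  case (Suc N)
  have suc: "x (Suc j) = y (Suc j)" if "j < N" for j
    by (rule Suc.IH[of "\<lambda>j. x (Suc j)" "\<lambda>j. y (Suc j)"]) (use Suc.prems(1)[of "Suc _"] that in auto)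
  show ?case
  proof (cases j)
    case 0
    have "(\<Sum>k<N. \<gamma> (Suc k) * x (Suc k)) = (\<Sum>k<N. \<gamma> (Suc k) * y (Suc k))"
      using suc by simp
    then show ?thesis
      using Suc.prems(1)[of 0] by (simp add: sum.lessThan_Suc_shift assms(1) 0 del: sum.lessThan_Suc)
  next
    case (Suc i)
    then show ?thesis using suc[of i] Suc.prems(2) by simp
  qed
qed simp

text \<open>The relations \<open>(2j + 1) e\<^sub>j + \<kappa> e\<^bsub>j-1\<^esub>\<close>, together with \<open>q e + e\<^sub>0\<close> and \<open>\<kappa> e\<^bsub>N-1\<^esub>\<close>, and the data that
  diagonalize them. The recursion for \<open>\<gamma>\<close> is that of \<open>(- \<kappa>/2)\<^sup>k / k!\<close>; it is stated without divisions, as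
  \<open>k\<close> need not be invertible. The numbers \<open>\<alpha> j\<close> make \<open>e \<mapsto> 1\<close>, \<open>e\<^sub>j \<mapsto> \<alpha> j\<close> vanish on all
  relations but the last, and \<open>\<delta>\<close> records that the last relation is compatible with the
  diagonal form.\<close>

locale bidiagonal =
  fixes q \<kappa> :: "'r::comm_ring_1" and \<gamma> \<alpha> \<delta> :: "nat \<Rightarrow> 'r" and N :: nat
  assumes \<gamma>_0: "\<gamma> 0 = 1" and \<gamma>_Suc: "of_nat (2 * Suc k) * \<gamma> (Suc k) = - \<kappa> * \<gamma> k"
    and \<alpha>_0: "\<alpha> 0 = - q" and \<alpha>_Suc: "of_nat (2 * j + 3) * \<alpha> (Suc j) = - \<kappa> * \<alpha> j"
    and \<delta>: "j < N \<Longrightarrow> \<kappa> * \<gamma> (N - 1 - j) = of_nat (2 * j + 1) * \<delta> j"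
begin

definition eigen :: "(nat \<Rightarrow> 'r) \<Rightarrow> nat \<Rightarrow> 'r" where
  "eigen y j = (\<Sum>k<N - j. \<gamma> k * y (j + k))"

text \<open>The functional \<open>eigen\<close> is the coefficient of \<open>y\<^bsup>2j+1\<^esup>\<close> after multiplication by the exponential, which
  turns the bidiagonal operator into multiplication of \<open>y\<^bsup>2j+1\<^esup>\<close> by \<open>2j + 1\<close>.\<close>

lemma eigen_bidiagonal:
  assumes "j < N"
  shows "eigen (\<lambda>j. of_nat (2 * j + 1) * \<rho> j + \<kappa> * \<rho> (Suc j)) j =
     of_nat (2 * j + 1) * (eigen \<rho> j + \<delta> j * \<rho> N)"
proof -
  have *: "(\<Sum>k<Suc m. \<gamma> k * (of_nat (2 * (j + k) + 1) * \<rho> (j + k) + \<kappa> * \<rho> (Suc (j + k)))) =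
     of_nat (2 * j + 1) * (\<Sum>k<Suc m. \<gamma> k * \<rho> (j + k)) + \<kappa> * \<gamma> m * \<rho> (Suc (j + m))" for m
  proof (induction m)
    case (Suc m)
    have "\<gamma> (Suc m) * (of_nat (2 * (j + Suc m) + 1) * \<rho> (j + Suc m)) + \<kappa> * \<gamma> m * \<rho> (Suc (j + m)) =
       of_nat (2 * j + 1) * (\<gamma> (Suc m) * \<rho> (j + Suc m)) +
       (of_nat (2 * Suc m) * \<gamma> (Suc m) + \<kappa> * \<gamma> m) * \<rho> (Suc (j + m))"
      by (simp add: algebra_simps)
    then show ?case
      unfolding sum.lessThan_Suc[of _ "Suc m"] Suc.IH \<gamma>_Suc by (simp add: algebra_simps)
  qed (simp add: \<gamma>_0)
  have N: "N - j = Suc (N - 1 - j)" "Suc (j + (N - 1 - j)) = N" using assms by auto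
  show ?thesis
    unfolding eigen_def N(1) * N(2) \<delta>[OF assms] by (simp add: algebra_simps)
qed

lemma alpha_bidiagonal:
  assumes "N > 0"
  shows "q * \<rho> 0 + (\<Sum>j<N. \<alpha> j * (of_nat (2 * j + 1) * \<rho> j + \<kappa> * \<rho> (Suc j))) = \<kappa> * \<alpha> (N - 1) * \<rho> N"
proof -
  have "q * \<rho> 0 + (\<Sum>j<Suc m. \<alpha> j * (of_nat (2 * j + 1) * \<rho> j + \<kappa> * \<rho> (Suc j))) = \<kappa> * \<alpha> m * \<rho> (Suc m)" for m
  proof (induction m)
    case (Suc m)
    have "\<alpha> (Suc m) * (of_nat (2 * Suc m + 1) * \<rho> (Suc m)) + \<kappa> * \<alpha> m * \<rho> (Suc m) =
       (of_nat (2 * m + 3) * \<alpha> (Suc m) + \<kappa> * \<alpha> m) * \<rho> (Suc m)"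
      by (simp add: algebra_simps numeral_3_eq_3)
    then have "\<alpha> (Suc m) * (of_nat (2 * Suc m + 1) * \<rho> (Suc m)) + \<kappa> * \<alpha> m * \<rho> (Suc m) = 0"
      unfolding \<alpha>_Suc by simp
    then show ?case
      unfolding sum.lessThan_Suc[of _ "Suc m"] add.assoc[symmetric] Suc.IH
      by (simp add: distrib_left mult_ac add_ac)
  qed (simp add: \<alpha>_0 algebra_simps)
  from this[of "N - 1"] show ?thesis using assms by simp
qed

text \<open>In the new coordinates the submodule of relations is diagonal. The change of coordinates is
  unitriangular, hence bijective over any ring.\<close>

lemma image_iff:
  assumes "N > 0"
  shows "(\<exists>\<rho>. y0 = q * \<rho> 0 \<and> (\<forall>j<N. y j = of_nat (2 * j + 1) * \<rho> j + \<kappa> * \<rho> (Suc j))) \<longleftrightarrow>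
     \<kappa> * \<alpha> (N - 1) dvd y0 + (\<Sum>j<N. \<alpha> j * y j) \<and> (\<forall>j<N. of_nat (2 * j + 1) dvd eigen y j)"
    (is "?L \<longleftrightarrow> ?R")
proof
  assume ?L
  then obtain \<rho> where \<rho>: "y0 = q * \<rho> 0" "\<And>j. j < N \<Longrightarrow> y j = of_nat (2 * j + 1) * \<rho> j + \<kappa> * \<rho> (Suc j)"
    by blast
  have "y0 + (\<Sum>j<N. \<alpha> j * y j) = \<kappa> * \<alpha> (N - 1) * \<rho> N"
    using alpha_bidiagonal[OF assms, of \<rho>] \<rho> by simp
  moreover have "eigen y j = of_nat (2 * j + 1) * (eigen \<rho> j + \<delta> j * \<rho> N)" if "j < N" for j
  proof -
    have "eigen y j = eigen (\<lambda>j. of_nat (2 * j + 1) * \<rho> j + \<kappa> * \<rho> (Suc j)) j"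
      unfolding eigen_def by (rule sum.cong) (use \<rho> that in auto)
    then show ?thesis using eigen_bidiagonal[OF that] by simp
  qed
  ultimately show ?R by auto
next
  assume R: ?R
  obtain c where c: "y0 + (\<Sum>j<N. \<alpha> j * y j) = \<kappa> * \<alpha> (N - 1) * c" using R by (auto elim: dvdE)
  obtain l where l: "\<And>j. j < N \<Longrightarrow> eigen y j = of_nat (2 * j + 1) * l j"
    using R unfolding dvd_def by metis
  obtain x where x: "\<And>j. j < N \<Longrightarrow> eigen x j = l j - \<delta> j * c"
    using unitriangular_solvable[of \<gamma> N "\<lambda>j. l j - \<delta> j * c"] \<gamma>_0 unfolding eigen_def by blast
  \<comment> \<open>The entry at \<open>N\<close>, free in the triangular system, is the multiple of the last relation.\<close>
  define \<rho> where "\<rho> = x(N := c)"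
  have \<rho>: "eigen \<rho> j = l j - \<delta> j * c" if "j < N" for j
    unfolding x[OF that, symmetric] eigen_def by (rule sum.cong) (use that in \<open>auto simp: \<rho>_def\<close>)
  have y: "y j = of_nat (2 * j + 1) * \<rho> j + \<kappa> * \<rho> (Suc j)" if "j < N" for j
  proof (rule unitriangular_injective[of \<gamma> N y])
    fix j assume j: "j < N"
    have "eigen y j = eigen (\<lambda>j. of_nat (2 * j + 1) * \<rho> j + \<kappa> * \<rho> (Suc j)) j"
      unfolding eigen_bidiagonal[OF j] \<rho>[OF j] l[OF j] by (simp add: \<rho>_def)
    then show "(\<Sum>k<N - j. \<gamma> k * y (j + k)) =
        (\<Sum>k<N - j. \<gamma> k * (of_nat (2 * (j + k) + 1) * \<rho> (j + k) + \<kappa> * \<rho> (Suc (j + k))))"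
      unfolding eigen_def .
  qed (use \<gamma>_0 that in auto)
  have "y0 + (\<Sum>j<N. \<alpha> j * y j) = q * \<rho> 0 + (\<Sum>j<N. \<alpha> j * y j)"
    using alpha_bidiagonal[OF assms, of \<rho>] c y by (simp add: \<rho>_def)
  then show ?L using y by (intro exI[of _ \<rho>]) auto
qed

lemma eigen_surj: "\<exists>y. \<forall>j<N. eigen y j = l j"
  using unitriangular_solvable[of \<gamma> N l] \<gamma>_0 unfolding eigen_def by blast

end

section \<open>Localized integers\<close>

lemma Z_loc_iff: "x \<in> Z_loc p \<longleftrightarrow> (\<exists>a b. x = of_int a / of_int b \<and> \<not> int p dvd b)"
  unfolding Z_loc_def using dvd_0_right by blast

lemma of_int_Z_loc: "prime p \<Longrightarrow> of_int a \<in> Z_loc p"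
  unfolding Z_loc_iff by (rule exI[of _ a], rule exI[of _ 1]) (auto simp: prime_nat_iff)

lemma inverse_Z_loc: "\<not> int p dvd b \<Longrightarrow> 1 / of_int b \<in> Z_loc p"
  unfolding Z_loc_iff by (rule exI[of _ 1], rule exI[of _ b]) auto

lemma Z_loc_mult:
  assumes "prime p" "x \<in> Z_loc p" "y \<in> Z_loc p"
  shows "x * y \<in> Z_loc p"
proof -
  obtain a b c d where "x = of_int a / of_int b" "y = of_int c / of_int d" "\<not> int p dvd b" "\<not> int p dvd d"
    using assms(2,3) unfolding Z_loc_iff by blast
  then show ?thesis unfolding Z_loc_iff
    using assms(1) by (intro exI[of _ "a * c"] exI[of _ "b * d"]) (auto simp: prime_dvd_mult_iff)
qed

lemma Z_loc_power: "prime p \<Longrightarrow> x \<in> Z_loc p \<Longrightarrow> x ^ n \<in> Z_loc p"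
  using of_int_Z_loc[of p 1] by (induction n) (auto intro: Z_loc_mult)

lemma of_nat_Z_loc: "prime p \<Longrightarrow> of_nat a \<in> Z_loc p"
  using of_int_Z_loc[of p "int a"] by simp

text \<open>Up to a unit, \<open>k!\<close> is \<open>p\<^sup>d d!\<close> with \<open>d = k div p\<close>, as only the multiples of \<open>p\<close> contribute; and
  \<open>2 d \<le> k\<close> leaves one factor \<open>p\<^sup>d\<close> for \<open>p\<^sup>d\<close> and another one for \<open>d!\<close>.\<close>

lemma prime_power_div_fact_Z_loc:
  assumes p: "prime p"
  shows "of_nat p ^ k / fact k \<in> Z_loc p"
proof (induction k rule: less_induct)
  case (less k)
  have p2: "p \<ge> 2" using p by (rule prime_ge_2_nat)
  have fact: "\<exists>u. \<not> p dvd u \<and> fact m = p ^ (m div p) * fact (m div p) * u" for m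
  proof (induction m)
    case 0
    then show ?case using p2 by (intro exI[of _ 1]) auto
  next
    case (Suc m)
    then obtain u where u: "\<not> p dvd u" "fact m = p ^ (m div p) * fact (m div p) * u" by blast
    show ?case
    proof (cases "p dvd Suc m")
      case True
      define d where "d = m div p"
      have 1: "Suc m div p = Suc d"
        using True by (simp add: div_Suc mod_eq_0_iff_dvd d_def)
      have 2: "Suc m = p * Suc d"
        using True dvd_mult_div_cancel[of p "Suc m"] 1 by simp
      have "fact (Suc m) = Suc m * (fact m :: nat)" by simp
      also have "\<dots> = (p * Suc d) * (p ^ d * fact d * u)"
        by (simp only: 2 u(2) d_def)
      also have "\<dots> = p ^ Suc d * (Suc d * fact d) * u"
        by (simp only: power_Suc mult_ac)
      also have "Suc d * fact d = (fact (Suc d) :: nat)" by simp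
      finally show ?thesis unfolding 1 using u(1) by blast
    next
      case False
      then have "Suc m div p = m div p" by (simp add: div_Suc mod_eq_0_iff_dvd)
      moreover have "\<not> p dvd Suc m * u"
        using u(1) False prime_dvd_multD[OF p, of "Suc m" u] by blast
      moreover have "fact (Suc m) = p ^ (m div p) * fact (m div p) * (Suc m * u)"
        by (simp only: fact_Suc of_nat_id u(2) mult_ac)
      ultimately show ?thesis by metis
    qed
  qed
  show ?case
  proof (cases "k = 0")
    case True
    then show ?thesis using of_int_Z_loc[OF p, of 1] by simp
  next
    case False
    define d where "d = k div p"
    have d: "d < k" "2 * d \<le> k" using False p2 by (auto simp: d_def) 
        (metis div_times_less_eq_dividend le_trans mult.commute mult_le_mono1)
    obtain u where u: "\<not> p dvd u" "fact k = p ^ d * fact d * u"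
      using fact[of k] unfolding d_def by blast
    have u0: "u \<noteq> 0" using u(1) by (metis dvd_0_right)
    have "(fact k :: rat) = of_nat p ^ d * fact d * of_nat u"
      using arg_cong[OF u(2), of "of_nat :: nat \<Rightarrow> rat"] by simp
    moreover have "(of_nat p :: rat) ^ k = of_nat p ^ d * of_nat p ^ d * of_nat p ^ (k - 2 * d)"
      using d(2) by (simp flip: power_add)
    ultimately have "of_nat p ^ k / fact k =
        (of_nat p ^ d / fact d) * of_nat p ^ (k - 2 * d) * (1 / of_int (int u) :: rat)"
      using u0 p2 by (simp add: field_simps)
    also have "\<dots> \<in> Z_loc p"
      by (intro Z_loc_mult p less.IH Z_loc_power of_nat_Z_loc inverse_Z_loc d) (use u in auto)
    finally show ?thesis .
  qed
qed

lemma prime_power_div_Z_loc: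
  assumes p: "prime p" and m: "m > 0" "\<not> p ^ Suc e dvd m"
  shows "of_nat p ^ e / of_nat m \<in> Z_loc p"
proof -
  obtain m' where m': "m = p ^ multiplicity p m * m'" "\<not> p dvd m'"
    using multiplicity_decompose'[of m p] m p by (metis not_prime_unit not_gr_zero)
  define v where "v = multiplicity p m"
  have v: "v \<le> e"
  proof (rule ccontr)
    assume "\<not> v \<le> e"
    then have "p ^ Suc e dvd p ^ v" by (intro le_imp_power_dvd) auto
    then show False using m(2) m'(1) unfolding v_def by (metis dvd_mult2)
  qed
  have "(of_nat m :: rat) = of_nat p ^ v * of_nat m'"
    using arg_cong[OF m'(1), of "of_nat :: nat \<Rightarrow> rat"] by (simp add: v_def)
  moreover have "(of_nat p :: rat) ^ e = of_nat p ^ v * of_nat p ^ (e - v)"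
    using v by (simp flip: power_add)
  ultimately have "of_nat p ^ e / of_nat m = of_nat p ^ (e - v) * (1 / of_int (int m') :: rat)"
    using p m by (simp add: field_simps prime_gt_0_nat)
  also have "\<dots> \<in> Z_loc p"
    by (intro Z_loc_mult p Z_loc_power of_nat_Z_loc inverse_Z_loc) (use m' in auto)
  finally show ?thesis .
qed

lemma A_seq_closed_form: "A_seq p (2 * j + 1) = of_nat p ^ (2 * j + 1) * 2 ^ j * fact j / fact (2 * j + 1)"
proof (induction j)
  case (Suc j)
  have "A_seq p (2 * Suc j + 1) = (of_nat p)\<^sup>2 * A_seq p (2 * j + 1) / of_nat (2 * j + 3)"
    by (simp add: numeral_3_eq_3)
  also have "\<dots> = of_nat p ^ (2 * Suc j + 1) * 2 ^ Suc j * fact (Suc j) / fact (2 * Suc j + 1)"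
  proof -
    have "2 * Suc j + 1 = Suc (Suc (2 * j + 1))" by simp
    then have f: "(fact (2 * Suc j + 1) :: rat) =
        of_nat (2 * j + 3) * (2 * of_nat (Suc j)) * fact (2 * j + 1)"
      by (simp only: fact_Suc) (simp add: algebra_simps)
    have "(P :: rat) * (Q * T * J / F) / d = (P * Q) * (2 * T) * (c * J) / (d * (2 * c) * F)"
      if "c \<noteq> 0" "d \<noteq> 0" "F \<noteq> 0" for P Q T J F c d
      using that by (simp add: field_simps)
    from this[of "of_nat (Suc j)" "of_nat (2 * j + 3)" "fact (2 * j + 1)" "(of_nat p)\<^sup>2"
        "of_nat p ^ (2 * j + 1)" "2 ^ j" "fact j"]
    have "(of_nat p)\<^sup>2 * (of_nat p ^ (2 * j + 1) * 2 ^ j * fact j / fact (2 * j + 1)) / of_nat (2 * j + 3) =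
        ((of_nat p)\<^sup>2 * of_nat p ^ (2 * j + 1)) * (2 * 2 ^ j) * (of_nat (Suc j) * fact j) /
        (fact (2 * Suc j + 1) :: rat)"
      unfolding f by (simp del: of_nat_Suc fact_Suc of_nat_add of_nat_mult)
    also have "(of_nat p)\<^sup>2 * of_nat p ^ (2 * j + 1) = (of_nat p ^ (2 * Suc j + 1) :: rat)"
      by (simp add: power2_eq_square)
    also have "2 * 2 ^ j = (2 ^ Suc j :: rat)" by simp
    also have "of_nat (Suc j) * fact j = (fact (Suc j) :: rat)" by simp
    finally show ?thesis unfolding Suc.IH .
  qed
  finally show ?case .
qed simp

lemma A_seq_Z_loc:
  assumes "prime p"
  shows "A_seq p (2 * j + 1) \<in> Z_loc p"
proof -
  have "A_seq p (2 * j + 1) = (of_nat p ^ (2 * j + 1) / fact (2 * j + 1)) * of_int (2 ^ j * fact j)"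
    unfolding A_seq_closed_form by simp
  also have "\<dots> \<in> Z_loc p"
    by (intro Z_loc_mult prime_power_div_fact_Z_loc of_int_Z_loc assms)
  finally show ?thesis .
qed

lemma Z_loc_valuation:
  assumes p: "prime p" and x: "x \<in> Z_loc p" "x \<noteq> 0"
  shows "\<exists>u. x = of_nat p ^ nat (padic_val p x) * u \<and> u \<in> Z_loc p \<and> 1 / u \<in> Z_loc p"
proof -
  obtain a b where ab: "quotient_of x = (a, b)" by force
  have x_ab: "x = of_int a / of_int b" and b: "b > 0" and cop: "coprime a b"
    using quotient_of_div[OF ab] quotient_of_denom_pos[OF ab] quotient_of_coprime[OF ab] by auto
  have pb: "\<not> int p dvd b"
  proof
    assume pb: "int p dvd b"
    obtain c d where cd: "x = of_int c / of_int d" "\<not> int p dvd d"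
      using x(1) unfolding Z_loc_iff by blast
    then have d0: "d \<noteq> 0" by auto
    have "of_int (c * b) = (of_int (a * d) :: rat)"
      using cd(1) x_ab b d0 by (simp add: field_simps)
    then have "c * b = a * d" by (rule of_int_eq_iff[THEN iffD1])
    then have "int p dvd a * d" using pb by (metis dvd_mult)
    then have "int p dvd a" using cd(2) p by (simp add: prime_dvd_mult_iff)
    then show False using pb cop p by (metis coprime_common_divisor not_prime_unit prime_nat_int_transfer)
  qed
  have a0: "a \<noteq> 0" using x(2) x_ab by auto
  have "\<not> is_unit (int p)" using p by (metis not_prime_unit prime_nat_int_transfer)
  then obtain a' where a': "a = int p ^ multiplicity (int p) a * a'" "\<not> int p dvd a'"
    using multiplicity_decompose'[of a "int p"] a0 by metis
  have v: "nat (padic_val p x) = multiplicity (int p) a"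
    using pb by (simp add: padic_val_def ab not_dvd_imp_multiplicity_0)
  define u :: rat where "u = of_int a' / of_int b"
  have "(of_int a :: rat) = of_nat p ^ multiplicity (int p) a * of_int a'"
    using arg_cong[OF a'(1), of "of_int :: int \<Rightarrow> rat"] by simp
  then have "x = of_nat p ^ nat (padic_val p x) * u"
    unfolding v by (simp add: u_def x_ab)
  moreover have "u \<in> Z_loc p"
    unfolding Z_loc_iff u_def using pb by blast
  moreover have "1 / u = of_int b / of_int a'" by (simp add: u_def)
  then have "1 / u \<in> Z_loc p"
    unfolding Z_loc_iff using a'(2) by blast
  ultimately show ?thesis by blast
qed

lemma Z_loc_algebra_hom:
  assumes "prime p" "Z_loc_algebra p \<phi>"
  shows Z_loc_algebra_add: "x \<in> Z_loc p \<Longrightarrow> y \<in> Z_loc p \<Longrightarrow> \<phi> (x + y) = \<phi> x + \<phi> y"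
    and Z_loc_algebra_mult: "x \<in> Z_loc p \<Longrightarrow> y \<in> Z_loc p \<Longrightarrow> \<phi> (x * y) = \<phi> x * \<phi> y"
    and Z_loc_algebra_1: "\<phi> 1 = 1"
    and Z_loc_algebra_of_nat: "\<phi> (of_nat n) = of_nat n"
    and Z_loc_algebra_uminus: "x \<in> Z_loc p \<Longrightarrow> \<phi> (- x) = - \<phi> x"
    and Z_loc_algebra_power: "x \<in> Z_loc p \<Longrightarrow> \<phi> (x ^ n) = \<phi> x ^ n"
proof -
  show add: "\<phi> (x + y) = \<phi> x + \<phi> y" and mult: "\<phi> (x * y) = \<phi> x * \<phi> y"
    if "x \<in> Z_loc p" "y \<in> Z_loc p" for x y
    using assms(2) that unfolding Z_loc_algebra_def by blast+
  show one: "\<phi> 1 = 1" using assms(2) unfolding Z_loc_algebra_def by blast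
  have z: "0 \<in> Z_loc p" "1 \<in> Z_loc p" "-1 \<in> Z_loc p"
    using of_int_Z_loc[OF assms(1), of 0] of_int_Z_loc[OF assms(1), of 1] of_int_Z_loc[OF assms(1), of "-1"]
    by auto
  have zero: "\<phi> 0 = 0" using add[of 0 0] z by simp
  show "\<phi> (of_nat n) = of_nat n"
    by (induction n) (use zero one add z of_nat_Z_loc[OF assms(1)] in \<open>simp_all add: add\<close>)
  show "\<phi> (- x) = - \<phi> x" if "x \<in> Z_loc p"
  proof -
    have "- x \<in> Z_loc p" using Z_loc_mult[OF assms(1) z(3) that] by simp
    then show ?thesis using add[OF that, of "- x"] zero by (simp add: eq_neg_iff_add_eq_0 add.commute)
  qed
  show "\<phi> (x ^ n) = \<phi> x ^ n" if "x \<in> Z_loc p"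
    by (induction n) (use that one in \<open>simp_all add: mult Z_loc_power[OF assms(1)]\<close>)
qed

lemma half_Z_loc:
  assumes "prime p" "odd p"
  shows "1 / 2 \<in> Z_loc p"
proof -
  have "\<not> int p dvd 2"
  proof
    assume "int p dvd 2"
    then have "p dvd 2" by presburger
    then show False using assms by (metis primes_dvd_imp_eq two_is_prime_nat even_numeral dvd_refl)
  qed
  then show ?thesis using inverse_Z_loc[of p 2] by simp
qed

lemma Z_loc_algebra_half:
  assumes "prime p" "odd p" "Z_loc_algebra p \<phi>"
  shows "2 * \<phi> (1 / 2) = 1"
  using Z_loc_algebra_mult[OF assms(1,3) of_nat_Z_loc[OF assms(1), of 2] half_Z_loc[OF assms(1,2)]]
    Z_loc_algebra_1[OF assms(1,3)] Z_loc_algebra_of_nat[OF assms(1,3), of 2] by simp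

section \<open>Quotients isomorphic to sums of cyclic modules\<close>

lemma module_coset_facts:
  assumes "module.subspace scale B" "module scale"
  shows coset_eq_iff: "x +o B = y +o B \<longleftrightarrow> x - y \<in> B"
    and coset_add: "(x +o B) + (y +o B) = (x + y) +o B"
    and coset_scale: "scale r ` (x +o B) + B = scale r x +o B"
proof -
  have 0: "0 \<in> B" and add: "\<And>x y. x \<in> B \<Longrightarrow> y \<in> B \<Longrightarrow> x + y \<in> B" and sc: "\<And>r x. x \<in> B \<Longrightarrow> scale r x \<in> B"
    using assms unfolding module.subspace_def[OF assms(2)] by auto
  have diff: "\<And>x y. x \<in> B \<Longrightarrow> y \<in> B \<Longrightarrow> x - y \<in> B"
    by (rule module.subspace_diff[OF assms(2,1)])
  show "x +o B = y +o B \<longleftrightarrow> x - y \<in> B"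
  proof
    assume "x +o B = y +o B"
    moreover have "x \<in> x +o B"
      unfolding elt_set_plus_def using 0 by (auto intro!: bexI[of _ 0])
    ultimately have "x \<in> y +o B" by simp
    then show "x - y \<in> B" by (auto simp: elt_set_plus_def)
  next
    assume d: "x - y \<in> B"
    show "x +o B = y +o B"
    proof (intro set_eqI iffI)
      fix z assume "z \<in> x +o B"
      then obtain b where "b \<in> B" "z = x + b" by (auto simp: elt_set_plus_def)
      then show "z \<in> y +o B" using add[OF d, of b]
        by (auto simp: elt_set_plus_def intro!: bexI[of _ "(x - y) + b"])
    next
      fix z assume "z \<in> y +o B"
      then obtain b where "b \<in> B" "z = y + b" by (auto simp: elt_set_plus_def)
      then show "z \<in> x +o B" using diff[of b "x - y"] d
        by (auto simp: elt_set_plus_def intro!: bexI[of _ "b - (x - y)"])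
    qed
  qed
  show "(x +o B) + (y +o B) = (x + y) +o B"
  proof (intro set_eqI iffI)
    fix z assume "z \<in> (x +o B) + (y +o B)"
    then obtain b c where "b \<in> B" "c \<in> B" "z = (x + b) + (y + c)"
      by (auto simp: elt_set_plus_def set_plus_def)
    then show "z \<in> (x + y) +o B" using add[of b c]
      by (auto simp: elt_set_plus_def intro!: bexI[of _ "b + c"])
  next
    fix z assume "z \<in> (x + y) +o B"
    then obtain b where "b \<in> B" "z = (x + 0) + (y + b)"
      by (auto simp: elt_set_plus_def add.assoc)
    then show "z \<in> (x +o B) + (y +o B)"
      using 0 by (auto simp: elt_set_plus_def intro!: set_plus_intro) 
  qed
  show "scale r ` (x +o B) + B = scale r x +o B"
  proof (intro set_eqI iffI)
    fix z assume "z \<in> scale r ` (x +o B) + B"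
    then obtain b c where "b \<in> B" "c \<in> B" "z = scale r (x + b) + c"
      by (auto simp: elt_set_plus_def set_plus_def)
    then show "z \<in> scale r x +o B" using add[OF sc[of b r], of c]
      by (auto simp: elt_set_plus_def module.scale_right_distrib[OF assms(2)] intro!: bexI[of _ "scale r b + c"])
  next
    fix z assume "z \<in> scale r x +o B"
    then obtain b where "b \<in> B" "z = scale r (x + 0) + b" by (auto simp: elt_set_plus_def)
    then show "z \<in> scale r ` (x +o B) + B"
      using 0 by (auto simp: elt_set_plus_def intro!: set_plus_intro)
  qed
qed

lemma quotient_module_iso:
  fixes M B :: "'v::ab_group_add set" and P :: "('r::comm_ring_1, 'n) rmodule"
  assumes mod: "module scale" "module.subspace scale B" "module.subspace scale M"
    and range: "\<theta> ` M = mcarrier P"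
    and add: "\<And>x y. x \<in> M \<Longrightarrow> y \<in> M \<Longrightarrow> \<theta> (x + y) = mplus P (\<theta> x) (\<theta> y)"
    and scale: "\<And>r x. x \<in> M \<Longrightarrow> \<theta> (scale r x) = mscale P r (\<theta> x)"
    and ker: "\<And>x y. x \<in> M \<Longrightarrow> y \<in> M \<Longrightarrow> \<theta> x = \<theta> y \<longleftrightarrow> x - y \<in> B"
  shows "quotient_module scale M B \<cong>\<^sub>R P"
proof -
  define f where "f = (\<lambda>X. \<theta> (SOME x. x \<in> M \<and> x +o B = X))"
  have f: "f (x +o B) = \<theta> x" if "x \<in> M" for x
  proof -
    have "(SOME y. y \<in> M \<and> y +o B = x +o B) \<in> M \<and> (SOME y. y \<in> M \<and> y +o B = x +o B) +o B = x +o B"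
      by (rule someI[of _ x]) (use that in auto)
    then show ?thesis using that unfolding f_def
      by (subst ker) (auto simp: coset_eq_iff[OF mod(2,1), symmetric])
  qed
  have M: "x + y \<in> M" "scale r x \<in> M" if "x \<in> M" "y \<in> M" for x y r
    using mod(3) that unfolding module.subspace_def[OF mod(1)] by auto
  have "module_iso (quotient_module scale M B) P f"
    unfolding module_iso_def quotient_module_def rmodule.simps
  proof (intro conjI ballI allI)
    have "inj_on f ((\<lambda>x. x +o B) ` M)"
    proof (rule inj_onI, clarify)
      fix x y assume "x \<in> M" "y \<in> M" "f (x +o B) = f (y +o B)"
      then show "x +o B = y +o B" by (simp add: f ker coset_eq_iff[OF mod(2,1)])
    qed
    moreover have "f ` (\<lambda>x. x +o B) ` M = mcarrier P"
      unfolding range[symmetric] image_image by (rule image_cong) (auto simp: f)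
    ultimately show "bij_betw f ((\<lambda>x. x +o B) ` M) (mcarrier P)" by (simp add: bij_betw_def)
  qed (auto simp: coset_add[OF mod(2,1)] coset_scale[OF mod(2,1)] f M add scale)
  then show ?thesis unfolding isomorphic_def by blast
qed

lemma module_mult: "module ((*) :: 'r::comm_ring_1 \<Rightarrow> 'r \<Rightarrow> 'r)"
  by unfold_locales (auto simp: algebra_simps)

lemma subspace_principal: "module.subspace ((*) :: 'r::comm_ring_1 \<Rightarrow> 'r \<Rightarrow> 'r) (range ((*) c))"
  unfolding module.subspace_def[OF module_mult]
  by (auto simp: image_iff) (metis mult_zero_right, metis distrib_left, metis mult.left_commute)

lemma cyclic_module_facts:
  fixes c :: "'r::comm_ring_1"
  shows carrier_cyclic: "mcarrier (cyclic_module c) = range (\<lambda>x. x +o range ((*) c))"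
    and plus_cyclic: "mplus (cyclic_module c) (x +o range ((*) c)) (y +o range ((*) c)) = (x + y) +o range ((*) c)"
    and scale_cyclic: "mscale (cyclic_module c) r (x +o range ((*) c)) = (r * x) +o range ((*) c)"
    and coset_cyclic_eq: "x +o range ((*) c) = y +o range ((*) c) \<longleftrightarrow> c dvd x - y"
  by (simp_all add: cyclic_module_def quotient_module_def coset_add[OF subspace_principal module_mult]
      coset_scale[OF subspace_principal module_mult] coset_eq_iff[OF subspace_principal module_mult])
    (auto simp: dvd_def)

lemma quotient_iso_cyclic:
  fixes L :: "'v::ab_group_add \<Rightarrow> 'r::comm_ring_1"
  assumes mod: "module scale" "module.subspace scale B" "module.subspace scale M"
    and add: "\<And>x y. L (x + y) = L x + L y" and scale: "\<And>r x. L (scale r x) = r * L x"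
    and surj: "\<And>r. \<exists>x\<in>M. L x = r"
    and ker: "\<And>x. x \<in> M \<Longrightarrow> x \<in> B \<longleftrightarrow> c dvd L x"
  shows "quotient_module scale M B \<cong>\<^sub>R cyclic_module c"
proof (rule quotient_module_iso[OF mod, where \<theta> = "\<lambda>x. L x +o range ((*) c)"])
  have diff: "L (x - y) = L x - L y" for x y
    using add[of "x - y" y] by simp
  have surj': "L ` M = UNIV"
  proof (intro set_eqI iffI)
    fix r show "r \<in> L ` M" using surj[of r] by blast
  qed simp
  show "(\<lambda>x. L x +o range ((*) c)) ` M = mcarrier (cyclic_module c)"
    unfolding carrier_cyclic surj'[symmetric] image_image ..
  show "(L x +o range ((*) c) = L y +o range ((*) c)) = (x - y \<in> B)" if "x \<in> M" "y \<in> M" for x y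
    using ker[OF module.subspace_diff[OF mod(1,3) that]] by (simp add: coset_cyclic_eq diff)
qed (simp_all add: plus_cyclic scale_cyclic add scale)

lemma quotient_iso_cyclic_sum:
  fixes K :: "'v::ab_group_add \<Rightarrow> 'r::comm_ring_1" and L :: "'i \<Rightarrow> 'v \<Rightarrow> 'r"
  assumes mod: "module scale" "module.subspace scale B" "module.subspace scale M"
    and add: "\<And>x y. K (x + y) = K x + K y" "\<And>i x y. L i (x + y) = L i x + L i y"
    and scale: "\<And>r x. K (scale r x) = r * K x" "\<And>i r x. L i (scale r x) = r * L i x"
    and surj: "\<And>r s. \<exists>x\<in>M. K x = r \<and> (\<forall>i\<in>I. L i x = s i)"
    and ker: "\<And>x. x \<in> M \<Longrightarrow> x \<in> B \<longleftrightarrow> b dvd K x \<and> (\<forall>i\<in>I. c i dvd L i x)"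
  shows "quotient_module scale M B \<cong>\<^sub>R
     cyclic_module b \<oplus>\<^sub>R finite_direct_sum I (\<lambda>i. cyclic_module (c i))"
proof (rule quotient_module_iso[OF mod, where \<theta> =
    "\<lambda>x. (K x +o range ((*) b), \<lambda>i\<in>I. L i x +o range ((*) (c i)))"])
  let ?P = "cyclic_module b \<oplus>\<^sub>R finite_direct_sum I (\<lambda>i. cyclic_module (c i))"
  let ?\<theta> = "\<lambda>x. (K x +o range ((*) b), \<lambda>i\<in>I. L i x +o range ((*) (c i)))"
  have diff: "K (x - y) = K x - K y" "L i (x - y) = L i x - L i y" for x y i
    using add(1)[of "x - y" y] add(2)[of i "x - y" y] by simp_all
  show "?\<theta> ` M = mcarrier ?P"
  proof (intro set_eqI iffI)
    fix z assume "z \<in> ?\<theta> ` M"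
    then show "z \<in> mcarrier ?P"
      by (auto simp: binary_sum_def finite_direct_sum_def carrier_cyclic)
  next
    fix z assume z: "z \<in> mcarrier ?P"
    then obtain r where r: "fst z = r +o range ((*) b)"
      by (auto simp: binary_sum_def carrier_cyclic)
    have "\<forall>i\<in>I. \<exists>s. snd z i = s +o range ((*) (c i))"
      using z by (auto simp: binary_sum_def finite_direct_sum_def carrier_cyclic dest!: PiE_mem)
    then obtain s where s: "\<And>i. i \<in> I \<Longrightarrow> snd z i = s i +o range ((*) (c i))" by metis
    have ext: "snd z \<in> extensional I"
      using z by (auto simp: binary_sum_def finite_direct_sum_def PiE_def)
    obtain x where x: "x \<in> M" "K x = r" "\<forall>i\<in>I. L i x = s i" using surj by blast
    have "?\<theta> x = z"
      using x r s ext by (auto simp: prod_eq_iff intro!: ext simp: extensional_def restrict_def fun_eq_iff)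
    then show "z \<in> ?\<theta> ` M" using x(1) by blast
  qed
  show "?\<theta> (x + y) = mplus ?P (?\<theta> x) (?\<theta> y)" for x y
    by (auto simp: binary_sum_def finite_direct_sum_def plus_cyclic add cong: restrict_cong)
  show "?\<theta> (scale r x) = mscale ?P r (?\<theta> x)" for r x
    by (auto simp: binary_sum_def finite_direct_sum_def scale_cyclic scale cong: restrict_cong)
  show "(?\<theta> x = ?\<theta> y) = (x - y \<in> B)" if "x \<in> M" "y \<in> M" for x y
  proof -
    have "(\<lambda>i\<in>I. L i x +o range ((*) (c i))) = (\<lambda>i\<in>I. L i y +o range ((*) (c i))) \<longleftrightarrow>
        (\<forall>i\<in>I. c i dvd L i (x - y))"
      by (auto simp: fun_eq_iff restrict_def coset_cyclic_eq diff split: if_splits)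
    then show ?thesis
      using ker[OF module.subspace_diff[OF mod(1,3) that]] by (simp add: coset_cyclic_eq diff)
  qed
qed

section \<open>Cyclic homology of the derived quotient\<close>

lemma HC_odd_zero:
  fixes q :: "'r::comm_ring_1"
  assumes "torsion_free q" "odd i"
  shows "is_zero_module (HC i (dquot q))"
proof -
  have q: "r = 0" if "q * r = 0" for r
    using assms(1) that unfolding torsion_free_def inj_def by (metis mult_zero_right)
  have "cycles (dquot q) i \<subseteq> boundaries (dquot q) i"
    using odd_cycle_in_boundaries[of q, OF q assms(2)] by blast
  moreover have "0 \<in> cycles (dquot q) i"
    by (simp add: cycles_iff free_chains_0)
  moreover have "x +o boundaries (dquot q) i = 0 +o boundaries (dquot q) i" if "x \<in> boundaries (dquot q) i" for x
    using that unfolding coset_eq_iff[OF boundaries_subspace module_free_scale] by simp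
  ultimately have "(\<lambda>x. x +o boundaries (dquot q) i) ` cycles (dquot q) i = {0 +o boundaries (dquot q) i}"
    by blast
  then have "mcarrier (HC i (dquot q)) = {0 +o boundaries (dquot q) i}"
    by (simp add: HC_def quotient_module_def)
  then show ?thesis unfolding is_zero_module_def by blast
qed

lemma HC_zero_iso:
  fixes q h :: "'r::comm_ring_1"
  assumes "2 * h = 1"
  shows "HC 0 (dquot q) \<cong>\<^sub>R cyclic_module q"
  unfolding HC_def
proof (rule quotient_iso_cyclic[OF module_free_scale boundaries_subspace cycles_subspace, where L = "coord_zero 0"])
  show "\<exists>x\<in>cycles (dquot q) 0. coord_zero 0 x = r" for r
    using even_cycle_exists[of q 0 r] by simp
  show "z \<in> boundaries (dquot q) 0 \<longleftrightarrow> q dvd coord_zero 0 z" if "z \<in> cycles (dquot q) 0" for z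
    using even_boundaries_iff[OF assms, of z q 0] that by (auto simp: dvd_def)
qed (simp_all add: coord_zero_def)

lemma coord_linear:
  "coord_zero N (x + y) = coord_zero N x + coord_zero N y"
  "coord_zero N (free_scale r x) = r * coord_zero N x"
  "coord_odd q h N j (x + y) = coord_odd q h N j x + coord_odd q h N j y"
  "coord_odd q h N j (free_scale r x) = r * coord_odd q h N j x"
  by (simp_all add: coord_zero_def coord_odd_def algebra_simps)

lemma HC_even_iso_diagonal:
  fixes q h :: "'r::comm_ring_1"
  assumes "2 * h = 1" "N > 0" "bidiagonal q (h * q\<^sup>2) \<gamma> \<alpha> \<delta> N"
    and c: "\<And>x. c dvd x \<longleftrightarrow> h * q\<^sup>2 * \<alpha> (N - 1) dvd x"
  shows "HC (int (2 * N)) (dquot q) \<cong>\<^sub>R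
     cyclic_module c \<oplus>\<^sub>R finite_direct_sum {n. odd n \<and> 1 \<le> n \<and> n \<le> 2 * N - 1} (\<lambda>n. cyclic_module (of_nat n))"
proof -
  interpret bidiagonal q "h * q\<^sup>2" \<gamma> \<alpha> \<delta> N by fact
  let ?I = "{n. odd n \<and> 1 \<le> n \<and> n \<le> 2 * N - 1}"
  have I: "(\<forall>n\<in>?I. Q n ((n - 1) div 2)) \<longleftrightarrow> (\<forall>j<N. Q (2 * j + 1) j)" for Q
  proof
    assume Q: "\<forall>n\<in>?I. Q n ((n - 1) div 2)"
    show "\<forall>j<N. Q (2 * j + 1) j"
    proof (intro allI impI)
      fix j assume "j < N"
      then have "2 * j + 1 \<in> ?I" by auto
      then have "Q (2 * j + 1) ((2 * j + 1 - 1) div 2)" using Q by blast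
      then show "Q (2 * j + 1) j" by simp
    qed
  next
    assume "\<forall>j<N. Q (2 * j + 1) j"
    then show "\<forall>n\<in>?I. Q n ((n - 1) div 2)" using assms(2) by (auto elim!: oddE)
  qed
  define K where "K = (\<lambda>x. coord_zero N x + (\<Sum>j<N. \<alpha> j * coord_odd q h N j x))"
  define L where "L = (\<lambda>n x. eigen (\<lambda>j. coord_odd q h N j x) ((n - 1) div 2))"
  show ?thesis
    unfolding HC_def
  proof (rule quotient_iso_cyclic_sum[OF module_free_scale boundaries_subspace cycles_subspace,
      where K = K and L = L])
    show "K (x + y) = K x + K y" "K (free_scale r x) = r * K x"
      "L n (x + y) = L n x + L n y" "L n (free_scale r x) = r * L n x" for x y r n
      by (simp_all add: K_def L_def eigen_def coord_linear algebra_simps sum.distrib sum_distrib_left)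
    show "\<exists>x\<in>cycles (dquot q) (int (2 * N)). K x = r \<and> (\<forall>n\<in>?I. L n x = s n)" for r s
    proof -
      obtain y where y: "\<And>j. j < N \<Longrightarrow> eigen y j = s (2 * j + 1)"
        using eigen_surj[of "\<lambda>j. s (2 * j + 1)"] by blast
      obtain x where x: "x \<in> cycles (dquot q) (int (2 * N))"
        "coord_zero N x = r - (\<Sum>j<N. \<alpha> j * y j)" "\<And>j. j < N \<Longrightarrow> coord_odd q h N j x = y j"
        using even_cycle_exists[of q N "r - (\<Sum>j<N. \<alpha> j * y j)" h y] by blast
      have "eigen (\<lambda>j. coord_odd q h N j x) j = eigen y j" if "j < N" for j
        unfolding eigen_def by (rule sum.cong) (use x(3) that in auto)
      then have "\<forall>n\<in>?I. L n x = s n"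
        unfolding L_def I[of "\<lambda>n j. eigen (\<lambda>j. coord_odd q h N j x) j = s n"] using y by simp
      moreover have "K x = r" using x by (simp add: K_def)
      ultimately show ?thesis using x(1) by blast
    qed
    show "z \<in> boundaries (dquot q) (int (2 * N)) \<longleftrightarrow> c dvd K z \<and> (\<forall>n\<in>?I. of_nat n dvd L n z)"
      if "z \<in> cycles (dquot q) (int (2 * N))" for z
      unfolding even_boundaries_iff[OF assms(1) that] image_iff[OF assms(2)] c K_def L_def
        I[of "\<lambda>n j. of_nat n dvd eigen (\<lambda>j. coord_odd q h N j z) j"] ..
  qed
qed

text \<open>The bidiagonal presentation is diagonalized with \<open>\<gamma> k = (- p\<^sup>2/4)\<^sup>k / k!\<close> and
  \<open>\<alpha> j = - (- 1/2)\<^sup>j A\<^bsub>2j+1\<^esub>\<close>, computed in the localized integers. The divisibility hypothesis makes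
  \<open>\<delta> j\<close> integral at \<open>p\<close>: with \<open>k = N - 1 - j\<close>, one factor \<open>p\<^sup>k\<close> of \<open>\<gamma> k\<close> is used for \<open>k!\<close> and the other
  one for \<open>2j + 1\<close>.\<close>

lemma HC_even_iso:
  fixes \<phi> :: "rat \<Rightarrow> 'r::comm_ring_1"
  assumes p: "prime p" "odd p" and \<phi>: "Z_loc_algebra p \<phi>" and N: "N > 0"
    and nd: "\<And>j. j < N \<Longrightarrow> \<not> p ^ (N - j) dvd 2 * j + 1"
  shows "HC (int (2 * N)) (dquot (of_nat p :: 'r)) \<cong>\<^sub>R
     cyclic_module (of_nat (p ^ (a_exp p (2 * N - 1) + 2))) \<oplus>\<^sub>R
     finite_direct_sum {n. odd n \<and> 1 \<le> n \<and> n \<le> 2 * N - 1} (\<lambda>n. cyclic_module (of_nat n))"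
proof -
  note hom = Z_loc_algebra_add[OF p(1) \<phi>] Z_loc_algebra_mult[OF p(1) \<phi>] Z_loc_algebra_1[OF p(1) \<phi>]
    Z_loc_algebra_of_nat[OF p(1) \<phi>] Z_loc_algebra_uminus[OF p(1) \<phi>] Z_loc_algebra_power[OF p(1) \<phi>]
  note Zm = Z_loc_mult[OF p(1)] and Zn = of_nat_Z_loc[OF p(1)] and Zp = Z_loc_power[OF p(1)]
  have p2: "p \<noteq> 0" using p(1) by auto
  note half = half_Z_loc[OF p]
  have neg: "- x \<in> Z_loc p" if "x \<in> Z_loc p" for x
    using Zm[OF of_int_Z_loc[OF p(1), of "-1"] that] by simp
  define h where "h = \<phi> (1 / 2)"
  have h: "2 * h = 1"
    unfolding h_def by (rule Z_loc_algebra_half[OF p \<phi>])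
  define q where "q = (of_nat p :: 'r)"
  define \<kappa>\<^sub>0 :: rat where "\<kappa>\<^sub>0 = 1 / 2 * of_nat p ^ 2"
  define g :: "nat \<Rightarrow> rat" where "g k = (of_nat p ^ k / fact k) * (of_nat p * - ((1 / 2) ^ 2)) ^ k" for k
  define \<alpha>\<^sub>0 :: "nat \<Rightarrow> rat" where "\<alpha>\<^sub>0 j = A_seq p (2 * j + 1) * - ((- (1 / 2)) ^ j)" for j
  have \<kappa>: "\<kappa>\<^sub>0 \<in> Z_loc p" "\<phi> \<kappa>\<^sub>0 = h * q\<^sup>2"
    unfolding \<kappa>\<^sub>0_def hom(2)[OF half Zp[OF Zn]] hom(6)[OF Zn] hom(4) h_def q_def
    by (intro Zm Zp half Zn) (rule refl)
  have g: "g k \<in> Z_loc p" for k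
    unfolding g_def by (intro Zm Zp prime_power_div_fact_Z_loc p(1) neg half Zn)
  have \<alpha>: "\<alpha>\<^sub>0 j \<in> Z_loc p" for j
    unfolding \<alpha>\<^sub>0_def by (intro Zm neg Zp half A_seq_Z_loc p(1))
  define d :: "nat \<Rightarrow> rat" where "d j = \<kappa>\<^sub>0 * g (N - 1 - j) / of_nat (2 * j + 1)" for j
  have d: "d j \<in> Z_loc p" if "j < N" for j
  proof -
    define k where "k = N - 1 - j"
    have "\<not> p ^ Suc k dvd 2 * j + 1" using nd[OF that] that by (simp add: k_def Suc_diff_Suc)
    then have m: "of_nat p ^ k / of_nat (2 * j + 1) \<in> Z_loc p"
      by (intro prime_power_div_Z_loc p(1)) auto
    have "d j = \<kappa>\<^sub>0 * ((of_nat p ^ k / fact k) * ((of_nat p ^ k / of_nat (2 * j + 1)) * (- ((1 / 2) ^ 2)) ^ k))"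
      unfolding d_def g_def k_def[symmetric] by (simp only: power_mult_distrib times_divide_eq_left times_divide_eq_right mult_ac)
    also have "\<dots> \<in> Z_loc p"
      by (intro Zm Zp prime_power_div_fact_Z_loc p(1) neg half Zn \<kappa>(1) m)
    finally show ?thesis .
  qed
  have bi: "bidiagonal q (h * q\<^sup>2) (\<lambda>k. \<phi> (g k)) (\<lambda>j. \<phi> (\<alpha>\<^sub>0 j)) (\<lambda>j. \<phi> (d j)) N"
  proof
    show "\<phi> (g 0) = 1" by (simp add: g_def hom(3))
    show "of_nat (2 * Suc k) * \<phi> (g (Suc k)) = - (h * q\<^sup>2) * \<phi> (g k)" for k
    proof -
      have "of_nat (2 * Suc k) * g (Suc k) = - (\<kappa>\<^sub>0 * g k)"
      proof -
        define c :: rat where "c = of_nat (Suc k)"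
        have c: "c \<noteq> 0" "of_nat (2 * Suc k) = 2 * c" "fact (Suc k) = c * fact k"
          by (simp_all add: c_def)
        show ?thesis
          unfolding g_def \<kappa>\<^sub>0_def c power_Suc using c(1) by (simp add: field_simps power2_eq_square)
      qed
      then have "\<phi> (of_nat (2 * Suc k) * g (Suc k)) = \<phi> (- (\<kappa>\<^sub>0 * g k))" by simp
      then show ?thesis
        unfolding hom(2)[OF Zn g] hom(4) hom(5)[OF Zm[OF \<kappa>(1) g]] hom(2)[OF \<kappa>(1) g] \<kappa>(2) by simp
    qed
    show "\<phi> (\<alpha>\<^sub>0 0) = - q" by (simp add: \<alpha>\<^sub>0_def hom(5)[OF Zn] hom(4) q_def)
    show "of_nat (2 * j + 3) * \<phi> (\<alpha>\<^sub>0 (Suc j)) = - (h * q\<^sup>2) * \<phi> (\<alpha>\<^sub>0 j)" for j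
    proof -
      have A: "A_seq p (2 * Suc j + 1) = (of_nat p)\<^sup>2 * A_seq p (2 * j + 1) / of_nat (2 * j + 3)"
        by (simp add: numeral_3_eq_3)
      have "of_nat (2 * j + 3) * \<alpha>\<^sub>0 (Suc j) = - (\<kappa>\<^sub>0 * \<alpha>\<^sub>0 j)"
        unfolding \<alpha>\<^sub>0_def A \<kappa>\<^sub>0_def by (simp add: field_simps)
      then have "\<phi> (of_nat (2 * j + 3) * \<alpha>\<^sub>0 (Suc j)) = \<phi> (- (\<kappa>\<^sub>0 * \<alpha>\<^sub>0 j))" by simp
      then show ?thesis
        unfolding hom(2)[OF Zn \<alpha>] hom(4) hom(5)[OF Zm[OF \<kappa>(1) \<alpha>]] hom(2)[OF \<kappa>(1) \<alpha>] \<kappa>(2) by simp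
    qed
    show "h * q\<^sup>2 * \<phi> (g (N - 1 - j)) = of_nat (2 * j + 1) * \<phi> (d j)" if "j < N" for j
    proof -
      have "\<kappa>\<^sub>0 * g (N - 1 - j) = of_nat (2 * j + 1) * d j"
        unfolding d_def by (simp del: of_nat_add of_nat_mult of_nat_Suc add: nonzero_mult_div_cancel_left)
      then have "\<phi> (\<kappa>\<^sub>0 * g (N - 1 - j)) = \<phi> (of_nat (2 * j + 1) * d j)" by simp
      then show ?thesis
        unfolding hom(2)[OF Zn d[OF that]] hom(4) hom(2)[OF \<kappa>(1) g] \<kappa>(2) .
    qed
  qed
  have AN: "2 * (N - 1) + 1 = 2 * N - 1" using N by simp
  define e where "e = a_exp p (2 * N - 1)"
  have A0: "A_seq p (2 * N - 1) \<noteq> 0"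
    using A_seq_closed_form[of p "N - 1"] p2 unfolding AN by simp
  obtain u where u: "A_seq p (2 * N - 1) = of_nat p ^ e * u" "u \<in> Z_loc p" "1 / u \<in> Z_loc p"
    using Z_loc_valuation[OF p(1) A_seq_Z_loc[OF p(1), of "N - 1", unfolded AN] A0] unfolding e_def a_exp_def by blast
  \<comment> \<open>The unit by which \<open>\<kappa> \<alpha> (N - 1)\<close> differs from the power of \<open>p\<close>.\<close>
  define w :: rat where "w = 1 / 2 * (u * - ((- (1 / 2)) ^ (N - 1)))"
  have w: "w \<in> Z_loc p" unfolding w_def by (intro Zm neg Zp half u)
  have "u \<noteq> 0" using u A0 by auto
  have w': "1 / w \<in> Z_loc p"
  proof -
    have "1 / w = of_nat 2 * ((1 / u) * - ((- of_nat 2) ^ (N - 1)))"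
      using \<open>u \<noteq> 0\<close> by (simp add: w_def field_simps) (simp add: power_mult_distrib[symmetric])
    also have "\<dots> \<in> Z_loc p" by (intro Zm neg Zp Zn u)
    finally show ?thesis .
  qed
  have w0: "w * (1 / w) = 1" using \<open>u \<noteq> 0\<close> by (simp add: w_def)
  have ww': "\<phi> w * \<phi> (1 / w) = 1"
    unfolding hom(2)[OF w w', symmetric] w0 by (rule hom(3))
  have "\<kappa>\<^sub>0 * \<alpha>\<^sub>0 (N - 1) = of_nat (p ^ (e + 2)) * w"
    unfolding \<alpha>\<^sub>0_def AN u(1) \<kappa>\<^sub>0_def w_def by (simp add: power_add power2_eq_square)
  then have "\<phi> (\<kappa>\<^sub>0 * \<alpha>\<^sub>0 (N - 1)) = \<phi> (of_nat (p ^ (e + 2)) * w)" by simp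
  then have fin: "h * q\<^sup>2 * \<phi> (\<alpha>\<^sub>0 (N - 1)) = of_nat (p ^ (e + 2)) * \<phi> w"
    unfolding hom(2)[OF Zn w] hom(4) hom(2)[OF \<kappa>(1) \<alpha>] \<kappa>(2) .
  have unit: "c dvd x \<longleftrightarrow> c * \<phi> w dvd x" for c x :: 'r
  proof
    assume "c dvd x"
    then obtain y where "x = c * y" by (elim dvdE)
    then have "x = c * \<phi> w * (\<phi> (1 / w) * y)" using ww' by (simp add: mult.assoc[symmetric]) (simp add: mult.assoc)
    then show "c * \<phi> w dvd x" by (rule dvdI)
  qed (metis dvd_mult_left)
  have c: "of_nat (p ^ (e + 2)) dvd x \<longleftrightarrow> h * q\<^sup>2 * \<phi> (\<alpha>\<^sub>0 (N - 1)) dvd x" for x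
    unfolding fin by (rule unit)
  show ?thesis
    using HC_even_iso_diagonal[OF h N bi c] unfolding e_def q_def .
qed

text \<open>With \<open>k = N - 1 - j\<close>, the number \<open>2 (2j + 1)\<close> is \<open>p\<^sup>a \<plusminus> 1 - 4k\<close>. If \<open>p\<^bsup>k+1\<^esup>\<close> divided \<open>2j + 1\<close>, which is
  less than \<open>p\<^sup>a\<close>, it would divide \<open>p\<^sup>a\<close> and so \<open>4k \<minusplus> 1\<close>, but it exceeds \<open>4k + 1\<close>.\<close>

lemma power_prime_not_dvd:
  fixes p a N j :: nat
  assumes p: "prime p" "odd p" and a: "a > 0" and j: "j < N"
    and N: "2 * (2 * N - 1) = p ^ a + 1 \<or> 2 * (2 * N - 1) + 1 = p ^ a"
  shows "\<not> p ^ (N - j) dvd 2 * j + 1"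
proof
  assume dvd: "p ^ (N - j) dvd 2 * j + 1"
  define k where "k = N - 1 - j"
  have k: "N - j = Suc k" "N = j + k + 1" using j by (auto simp: k_def)
  have p3: "p \<ge> 3" using p prime_ge_2_nat[of p] by (cases "p = 2") auto
  have pa: "p ^ a \<ge> p" using a p3 by (cases a) auto
  have "p ^ Suc k \<le> 2 * j + 1" using dvd k by (intro dvd_imp_le) auto
  also have "\<dots> < p ^ a" using N k p3 pa by auto
  finally have "p ^ Suc k < p ^ a" .
  then have "Suc k < a" by (rule power_less_imp_less_exp[rotated]) (use p3 in linarith)
  then have pk: "int p ^ Suc k dvd int p ^ a" by (intro le_imp_power_dvd) auto
  have "int p ^ Suc k dvd int (2 * j + 1)"
    using dvd unfolding k(1) of_nat_power[symmetric] of_nat_dvd_iff .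
  then have d: "int p ^ Suc k dvd int p ^ a - 2 * int (2 * j + 1)"
    using pk by (meson dvd_diff dvd_mult)
  have N': "int p ^ a - 2 * int (2 * j + 1) = 4 * int k - 1 \<or> int p ^ a - 2 * int (2 * j + 1) = 4 * int k + 1"
  proof -
    have "int P = 2 * int (2 * j + 1) + 4 * int k - 1 \<or> int P = 2 * int (2 * j + 1) + 4 * int k + 1"
      if "2 * (2 * N - 1) = P + 1 \<or> 2 * (2 * N - 1) + 1 = P" for P
      using that k(2) by auto
    from this[OF N] show ?thesis by auto
  qed
  then have "int p ^ a - 2 * int (2 * j + 1) \<noteq> 0" by presburger
  then have "int p ^ Suc k \<le> \<bar>int p ^ a - 2 * int (2 * j + 1)\<bar>"
    using d by (intro zdvd_imp_le) auto
  also have "\<dots> \<le> 4 * int k + 1" using N' by auto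
  finally have "int (p ^ Suc k) \<le> int (4 * k + 1)" by simp
  then have "p ^ Suc k \<le> 4 * k + 1" by (rule of_nat_le_iff[THEN iffD1])
  moreover have "3 ^ Suc k \<le> p ^ Suc k" using p3 by (rule power_mono) simp
  moreover have "4 * k + 1 < 3 ^ Suc k" by (induction k) auto
  ultimately show False by linarith
qed

theorem theorem1p2:
  fixes p :: nat
    and \<phi> :: "rat \<Rightarrow> 'r::comm_ring_1"
  assumes "prime p" and "odd p"
    and "Z_loc_algebra p \<phi>"
    and "torsion_free (of_nat p :: 'r)"
  shows "(\<forall>i. odd i \<longrightarrow> is_zero_module (HC i (dquot (of_nat p :: 'r)))) \<and>
         HC 0 (dquot (of_nat p :: 'r)) \<cong>\<^sub>R cyclic_module (of_nat p :: 'r) \<and>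
         (\<exists>Z :: nat set. infinite Z \<and> (\<forall>i\<in>Z. 0 < i \<and> even i) \<and>
            (\<forall>i\<in>Z. HC (int i) (dquot (of_nat p :: 'r)) \<cong>\<^sub>R
                    cyclic_module (of_nat (p ^ (a_exp p (i - 1) + 2)) :: 'r) \<oplus>\<^sub>R
                    finite_direct_sum {n. odd n \<and> 1 \<le> n \<and> n \<le> i - 1}
                      (\<lambda>n. cyclic_module (of_nat n :: 'r))) \<and>
            {i. even i \<and> (\<exists>a>0. i = (p ^ a + 1) div 2 + 1 \<or> i = (p ^ a - 1) div 2 + 1)} \<subseteq> Z)"
proof (intro conjI)
  show "\<forall>i. odd i \<longrightarrow> is_zero_module (HC i (dquot (of_nat p :: 'r)))"
    using HC_odd_zero[OF assms(4)] by blast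
  show "HC 0 (dquot (of_nat p :: 'r)) \<cong>\<^sub>R cyclic_module (of_nat p :: 'r)"
    by (rule HC_zero_iso[OF Z_loc_algebra_half[OF assms(1,2,3)]])
  define Z where "Z = {i. even i \<and> (\<exists>a>0. i = (p ^ a + 1) div 2 + 1 \<or> i = (p ^ a - 1) div 2 + 1)}"
  have p3: "p \<ge> 3" using assms(1,2) prime_ge_2_nat[of p] by (cases "p = 2") auto
  have "infinite Z"
    unfolding infinite_nat_iff_unbounded
  proof
    fix n
    \<comment> \<open>Of the consecutive numbers \<open>(p\<^sup>a - 1)/2\<close> and \<open>(p\<^sup>a + 1)/2\<close> one is odd, so each \<open>a\<close> contributes an element.\<close>
    define a where "a = Suc n"
    have "2 * a + 1 \<le> 3 ^ a" by (induction a) auto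
    also have "3 ^ a \<le> p ^ a" using p3 by (rule power_mono) simp
    finally have a: "2 * a + 1 \<le> p ^ a" .
    have "odd (p ^ a)" using assms(2) by simp
    then obtain b where b: "p ^ a = 2 * b + 1" by (elim oddE)
    have "b + 1 \<in> Z \<or> b + 2 \<in> Z"
      unfolding Z_def using b by (auto simp: a_def intro!: exI[of _ a])
    moreover have "b + 1 > n" "b + 2 > n" using a b by (auto simp: a_def)
    ultimately show "\<exists>m>n. m \<in> Z" by blast
  qed
  moreover have "0 < i \<and> even i" if "i \<in> Z" for i
    using that by (auto simp: Z_def)
  moreover have "HC (int i) (dquot (of_nat p :: 'r)) \<cong>\<^sub>R
                    cyclic_module (of_nat (p ^ (a_exp p (i - 1) + 2)) :: 'r) \<oplus>\<^sub>R
                    finite_direct_sum {n. odd n \<and> 1 \<le> n \<and> n \<le> i - 1}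
                      (\<lambda>n. cyclic_module (of_nat n :: 'r))" if i: "i \<in> Z" for i
  proof -
    obtain N where N: "i = 2 * N" using i by (auto simp: Z_def)
    obtain a where a: "a > 0" "i = (p ^ a + 1) div 2 + 1 \<or> i = (p ^ a - 1) div 2 + 1"
      using i by (auto simp: Z_def)
    have "odd (p ^ a)" using assms(2) by simp
    then obtain b where b: "p ^ a = 2 * b + 1" by (elim oddE)
    have N0: "N > 0" using a N by auto
    have "2 * (2 * N - 1) = p ^ a + 1 \<or> 2 * (2 * N - 1) + 1 = p ^ a"
      using a(2) unfolding N b by auto
    then have "\<not> p ^ (N - j) dvd 2 * j + 1" if "j < N" for j
      using power_prime_not_dvd[OF assms(1,2) a(1) that] by blast
    then show ?thesis
      using HC_even_iso[OF assms(1,2,3) N0] unfolding N by blast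
  qed
  ultimately show "\<exists>Z :: nat set. infinite Z \<and> (\<forall>i\<in>Z. 0 < i \<and> even i) \<and>
            (\<forall>i\<in>Z. HC (int i) (dquot (of_nat p :: 'r)) \<cong>\<^sub>R
                    cyclic_module (of_nat (p ^ (a_exp p (i - 1) + 2)) :: 'r) \<oplus>\<^sub>R
                    finite_direct_sum {n. odd n \<and> 1 \<le> n \<and> n \<le> i - 1}
                      (\<lambda>n. cyclic_module (of_nat n :: 'r))) \<and>
            {i. even i \<and> (\<exists>a>0. i = (p ^ a + 1) div 2 + 1 \<or> i = (p ^ a - 1) div 2 + 1)} \<subseteq> Z"
    unfolding Z_def[symmetric] by blast
qed

end
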